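(* Let $K$ be a non-Archimedean local field (a finite extension of $\mathbb{Q}_p$ or of $\mathbb{F}_p((t))$) and let $f\in\mathcal{A}_K[1,1]$. Assume that the set $$\{\xi\in\mu_\infty : f(\xi)\in\mu_\infty\}$$ is infinite. Then $f$ is special.
   Context: Let $|\cdot|$ denote the absolute value of $K$, extended to a fixed algebraically closed field $\Omega$ containing $K$ that is complete with respect to an extension of $|\cdot|$ (the completion of an algebraic closure of $K$; it is $\mathbb{C}_p$ in characteristic $0$). $\mu_\infty$ denotes the group of all roots of unity in $\Omega$. $\mathcal{A}_K[1,1]$ denotes the set of Laurent series $f=\sum_{n\in\mathbb{Z}} f_nX^n$ with $f_n\in K$ such that $|f_n|\to 0$ as $|n|\to\infty$ (i.e. $f$ converges on the unit sphere $\{|x|=1\}$); for $x\in\Omega$ with $|x|=1$, $f(x)=\sum_n f_nx^n$. Such an $f$ is called special if either $K$ has characteristic $0$ and $f(X)=\eta X^m$ for some $\eta\in\mu_\infty$ and $m\in\mathbb{Z}$, or $K$ has characteristic $p>0$ and $f\in\overline{\mathbb{F}}_p[X,X^{-1}]$ (a Laurent polynomial whose coefficients are algebraic over $\mathbb{F}_p$). *)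

theory Defs
  imports Complex_Main "HOL-Computational_Algebra.Polynomial"
begin

definition nonarch_abs :: "('a::field \<Rightarrow> real) \<Rightarrow> bool" where
  "nonarch_abs av \<longleftrightarrow>
     (\<forall>x. av x \<ge> 0) \<and> (\<forall>x. av x = 0 \<longleftrightarrow> x = 0) \<and>
     (\<forall>x y. av (x * y) = av x * av y) \<and>
     (\<forall>x y. av (x + y) \<le> max (av x) (av y))"

definition is_subfield :: "'a::field set \<Rightarrow> bool" where
  "is_subfield K \<longleftrightarrow> 0 \<in> K \<and> 1 \<in> K \<and>
     (\<forall>x\<in>K. \<forall>y\<in>K. x + y \<in> K \<and> x * y \<in> K) \<and>
     (\<forall>x\<in>K. - x \<in> K \<and> inverse x \<in> K)"

definition av_tendsto :: "('a::field \<Rightarrow> real) \<Rightarrow> (nat \<Rightarrow> 'a) \<Rightarrow> 'a \<Rightarrow> bool" where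
  "av_tendsto av s l \<longleftrightarrow> (\<forall>e>0. \<exists>N. \<forall>n\<ge>N. av (s n - l) < e)"

definition av_cauchy :: "('a::field \<Rightarrow> real) \<Rightarrow> (nat \<Rightarrow> 'a) \<Rightarrow> bool" where
  "av_cauchy av s \<longleftrightarrow> (\<forall>e>0. \<exists>N. \<forall>m\<ge>N. \<forall>n\<ge>N. av (s m - s n) < e)"

definition av_complete :: "('a::field \<Rightarrow> real) \<Rightarrow> 'a set \<Rightarrow> bool" where
  "av_complete av S \<longleftrightarrow>
     (\<forall>s. (\<forall>n. s n \<in> S) \<longrightarrow> av_cauchy av s \<longrightarrow> (\<exists>l\<in>S. av_tendsto av s l))"

definition alg_closed_field :: "'a::field itself \<Rightarrow> bool" where
  "alg_closed_field _ \<longleftrightarrow> (\<forall>p :: 'a poly. degree p > 0 \<longrightarrow> (\<exists>x. poly p x = 0))"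

definition algebraic_over :: "'a::field set \<Rightarrow> 'a \<Rightarrow> bool" where
  "algebraic_over K x \<longleftrightarrow> (\<exists>q :: 'a poly. q \<noteq> 0 \<and> (\<forall>i. coeff q i \<in> K) \<and> poly q x = 0)"

text \<open>Algebraic over the prime field of 'a (i.e. over \<open>\<int>\<close>-image; this is
  \<open>\<bar>\<FF>\<^sub>p\<close> in characteristic p and \<open>\<bar>\<QQ>\<close> in characteristic 0).\<close>
definition algebraic_over_prime_field :: "'a::field \<Rightarrow> bool" where
  "algebraic_over_prime_field x \<longleftrightarrow>
     (\<exists>q :: int poly. map_poly of_int q \<noteq> (0 :: 'a poly) \<and> poly (map_poly of_int q) x = 0)"

text \<open>K is a non-Archimedean local field inside \<Omega> = UNIV :: 'a set, with respect to the
  restriction of av: a subfield, complete, discretely and non-trivially valued, with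
  finite residue field.\<close>
definition nonarch_local_field :: "('a::field \<Rightarrow> real) \<Rightarrow> 'a set \<Rightarrow> bool" where
  "nonarch_local_field av K \<longleftrightarrow>
     is_subfield K \<and> av_complete av K \<and>
     (\<exists>\<pi>\<in>K. 0 < av \<pi> \<and> av \<pi> < 1 \<and>
        (\<forall>x\<in>K. x \<noteq> 0 \<longrightarrow> (\<exists>k::int. av x = av \<pi> powi k))) \<and>
     (\<exists>S. finite S \<and> S \<subseteq> {x\<in>K. av x \<le> 1} \<and>
        (\<forall>x\<in>K. av x \<le> 1 \<longrightarrow> (\<exists>s\<in>S. av (x - s) < 1)))"

definition completed_alg_closure :: "('a::field \<Rightarrow> real) \<Rightarrow> 'a set \<Rightarrow> bool" where
  "completed_alg_closure av K \<longleftrightarrow>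
     alg_closed_field TYPE('a) \<and> av_complete av UNIV \<and>
     (\<forall>x. \<forall>e>0. \<exists>y. algebraic_over K y \<and> av (x - y) < e)"

definition roots_of_unity :: "'a::field set" where
  "roots_of_unity = {x. \<exists>n>0. x ^ n = 1}"

text \<open>Laurent series \<open>\<Sum> c n X^n\<close> with coefficients in K converging on the unit sphere.\<close>
definition laurent_A11 :: "('a::field \<Rightarrow> real) \<Rightarrow> 'a set \<Rightarrow> (int \<Rightarrow> 'a) \<Rightarrow> bool" where
  "laurent_A11 av K c \<longleftrightarrow> (\<forall>n. c n \<in> K) \<and>
     (\<forall>e>0. \<exists>N. \<forall>n. \<bar>n\<bar> > N \<longrightarrow> av (c n) < e)"

definition laurent_eval :: "('a::field \<Rightarrow> real) \<Rightarrow> (int \<Rightarrow> 'a) \<Rightarrow> 'a \<Rightarrow> 'a" where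
  "laurent_eval av c x =
     (THE y. av_tendsto av (\<lambda>N. \<Sum>n\<in>{- int N..int N}. c n * x powi n) y)"

definition special :: "(int \<Rightarrow> 'a::field) \<Rightarrow> bool" where
  "special c \<longleftrightarrow>
     (CHAR('a) = 0 \<and> (\<exists>\<eta>\<in>roots_of_unity. \<exists>m::int. \<forall>n. c n = (if n = m then \<eta> else 0))) \<or>
     (CHAR('a) > 0 \<and> finite {n. c n \<noteq> 0} \<and> (\<forall>n. algebraic_over_prime_field (c n)))"

end

theory Submission
  imports Defs "HOL-Number_Theory.Cong" "HOL-Library.FuncSet"
begin

text \<open>
  If \<open>\<rho>\<close> is a root of unity with \<open>f(\<rho>^s) = \<rho>^t\<close>, then \<open>f(\<rho>'^s) = \<rho>'^t\<close> for every
  conjugate \<open>\<rho>'\<close> over \<open>K\<close>, because \<open>K[\<rho>] \<rightarrow> K[\<rho>']\<close> is isometric (equivalence of norms).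
  Let \<open>\<rho>\<close> generate the group of \<open>M\<close>-th roots of unity, where \<open>M\<close> is the lcm of the orders of
  \<open>\<xi>\<close> and \<open>f(\<xi>)\<close>.

  If the \<open>p\<close>-parts of these \<open>M\<close> are unbounded (so the characteristic is 0), ramification of
  \<open>K(\<rho>)\<close> yields pairs of conjugates \<open>\<rho>'\<close>, \<open>\<delta>\<rho>'\<close> with \<open>\<delta>\<close> of any large \<open>p\<close>-power order.
  Pigeonholing, \<open>f(\<epsilon>X) = \<epsilon>'f(X)\<close> at infinitely many points of the unit sphere, hence identically,
  for some \<open>\<epsilon>\<close> of arbitrarily large \<open>p\<close>-power order; so \<open>f\<close> is a monomial.

  If they are bounded, Frobenius (a power \<open>Q\<close> of \<open>p\<close> depending only on \<open>K\<close> and the bound) fixes the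
  \<open>p\<close>-parts, and \<open>g(\<omega>^Q) = g(\<omega>)^Q\<close> for a twist \<open>g\<close> of \<open>f\<close> and infinitely many \<open>\<omega>\<close> of order
  prime to \<open>p\<close>. In characteristic \<open>p\<close> one may take \<open>g = f\<close>, and comparing coefficients gives
  \<open>f\<^sub>n^Q = f\<^sub>n\<close>. In characteristic 0 the equation holds on the whole unit sphere, so \<open>g\<close> maps
  roots of unity of \<open>p\<close>-power order to roots of unity, which is the unbounded case.
\<close>

section \<open>Non-Archimedean absolute values\<close>

text \<open>The split by \<open>p\<close>-parts reflects residue discs: distinct roots of unity of
  order prime to \<open>p\<close> have distinct reductions, while all those of
  \<open>p\<close>-power order lie in the disc around 1. Distinct reductions let Gauss norms be read
  off from values. The number |\<rho> - \<omega>| < 1, with \<omega> the prime-to-\<open>p\<close>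
  part of \<rho>, measures ramification. No field automorphism is constructed. A conjugate of x is a
  point that satisfies every polynomial relation of x over \<open>K\<close>. Values of the series
  are only limits of polynomial values, so an equation f(x) = x' is carried to a conjugate only if
  absolute values do not grow on the way; this is where completeness of \<open>K\<close> enters.
  Pigeonholing requires finitely many pairs (\<epsilon>, \<epsilon>'). Hence only a fixed amount of
  \<open>p\<close>-power torsion is extracted from each \<rho>, however large its order, and in the
  bounded case the Frobenius power must not depend on the point. In characteristic 0 the equation
  g(x^Q) = g(x)^Q is not additive in the coefficients of g, so they cannot be compared; only its
  consequences for values at roots of unity of \<open>p\<close>-power order are used.\<close>

locale nonarch_field =
  fixes av :: "'a::field \<Rightarrow> real"
  assumes nonarch: "nonarch_abs av"
begin

lemma av_nonneg [simp]: "av x \<ge> 0"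
  using nonarch by (simp add: nonarch_abs_def)

lemma av_eq_0_iff [simp]: "av x = 0 \<longleftrightarrow> x = 0"
  using nonarch by (simp add: nonarch_abs_def)

lemma av_0 [simp]: "av 0 = 0"
  by simp

lemma av_pos_iff [simp]: "av x > 0 \<longleftrightarrow> x \<noteq> 0"
  using av_nonneg[of x] av_eq_0_iff[of x] by linarith

lemma av_mult: "av (x * y) = av x * av y"
  using nonarch by (simp add: nonarch_abs_def)

lemma av_add: "av (x + y) \<le> max (av x) (av y)"
  using nonarch by (simp add: nonarch_abs_def)

lemma av_1 [simp]: "av 1 = 1"
  using av_mult[of 1 1] by simp

lemma av_power: "av (x ^ n) = av x ^ n"
  by (induction n) (auto simp: av_mult)

lemma av_minus [simp]: "av (- x) = av x"
proof -
  have "av (-1) ^ 2 = 1"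
    using av_power[of "-1" 2] by simp
  then have "av (-1) = 1"
    using av_nonneg[of "-1"] by (metis abs_of_nonneg real_sqrt_abs real_sqrt_one)
  then show ?thesis
    using av_mult[of "-1" x] by simp
qed

lemma av_diff: "av (x - y) \<le> max (av x) (av y)"
  using av_add[of x "-y"] by simp

lemma av_diff_commute: "av (x - y) = av (y - x)"
  using av_minus[of "x - y"] by simp

lemma av_diff_triangle: "av (x - z) \<le> max (av (x - y)) (av (y - z))"
  using av_add[of "x - y" "y - z"] by simp

lemma av_inverse: "av (inverse x) = inverse (av x)"
proof (cases "x = 0")
  case False
  then have "av x * av (inverse x) = 1"
    by (simp flip: av_mult)
  then show ?thesis
    by (simp add: inverse_unique)
qed simp

lemma av_divide: "av (x / y) = av x / av y"
  by (simp add: divide_inverse av_mult av_inverse)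

lemma av_powi: "av (x powi n) = av x powi n"
  by (simp add: power_int_def av_power av_inverse)

lemma av_add_eq: "av y < av x \<Longrightarrow> av (x + y) = av x"
  using av_add[of x y] av_diff[of "x + y" y] by (simp add: max_def split: if_splits)

lemma av_eq_of_diff_less: "av (x - y) < av x \<Longrightarrow> av y = av x"
  using av_add_eq[of "y - x" x] av_diff_commute[of x y] by simp

lemma av_sum_le:
  assumes "\<And>i. i \<in> A \<Longrightarrow> av (f i) \<le> B" "B \<ge> 0"
  shows "av (\<Sum>i\<in>A. f i) \<le> B"
  using assms(1)
proof (induction A rule: infinite_finite_induct)
  case (insert x F)
  then show ?case
    using av_add[of "f x" "sum f F"] by (auto simp: max_def split: if_splits intro: order_trans)
qed (use assms in auto)

lemma av_prod: "av (\<Prod>i\<in>A. f i) = (\<Prod>i\<in>A. av (f i))"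
  by (induction A rule: infinite_finite_induct) (auto simp: av_mult)

lemma av_of_nat_le_1: "av (of_nat n) \<le> 1"
proof (induction n)
  case (Suc n)
  then show ?case using av_add[of 1 "of_nat n"] by simp
qed simp

lemma av_eq_1_if_power_eq_1:
  assumes "x ^ n = 1" "n > 0"
  shows "av x = 1"
proof -
  have "av x ^ n = 1" using assms av_power[of x n] by simp
  then show ?thesis using assms(2) power_eq_imp_eq_base[of "av x" n 1] by simp
qed

lemma av_poly_le:
  assumes "\<And>i. av (coeff R i) \<le> B" "av x \<le> 1"
  shows "av (poly R x) \<le> B"
proof -
  have B: "B \<ge> 0" using assms(1)[of 0] av_nonneg order_trans by blast
  show ?thesis unfolding poly_altdef
  proof (rule av_sum_le[OF _ B])
    fix i
    have "av (coeff R i) * av x ^ i \<le> B * 1"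
      using assms B by (intro mult_mono power_le_one) auto
    then show "av (coeff R i * x ^ i) \<le> B" by (simp add: av_mult av_power)
  qed
qed

lemma av_poly_diff_le:
  assumes "\<And>i. av (coeff R i) \<le> B" "av x \<le> 1" "av y \<le> 1"
  shows "av (poly R x - poly R y) \<le> B * av (x - y)"
  using assms(1)
proof (induction R)
  case 0
  then show ?case by simp
next
  case (pCons a R)
  have c: "av (coeff R i) \<le> B" for i using pCons.prems[of "Suc i"] by simp
  have B: "B \<ge> 0" using c[of 0] av_nonneg order_trans by blast
  have e: "poly (pCons a R) x - poly (pCons a R) y
     = x * (poly R x - poly R y) + (x - y) * poly R y"
    by (simp add: algebra_simps)
  have "av x * av (poly R x - poly R y) \<le> 1 * (B * av (x - y))"
    using assms(2) pCons.IH[OF c] B by (intro mult_mono) auto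
  moreover have "av (x - y) * av (poly R y) \<le> av (x - y) * B"
    using av_poly_le[OF c assms(3)] by (intro mult_left_mono) auto
  ultimately show ?case
    unfolding e using av_add[of "x * (poly R x - poly R y)" "(x - y) * poly R y"]
    by (simp add: av_mult mult.commute)
qed

lemma av_tendsto_unique:
  assumes "av_tendsto av s l" "av_tendsto av s l'"
  shows "l = l'"
proof (rule ccontr)
  assume "l \<noteq> l'"
  then have "av (l - l') > 0" by simp
  then obtain N N' where "\<forall>n\<ge>N. av (s n - l) < av (l - l')" "\<forall>n\<ge>N'. av (s n - l') < av (l - l')"
    using assms unfolding av_tendsto_def by metis
  then have "av (s (max N N') - l) < av (l - l')" "av (s (max N N') - l') < av (l - l')"
    by auto
  then show False
    using av_diff_triangle[of l l' "s (max N N')"] av_diff_commute[of l "s (max N N')"] by simp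
qed

text \<open>Each division by a linear factor \<open>X - z\<close> with \<open>|z| = 1\<close> lowers the top index of Gauss
  norm by one and preserves the bottom one.\<close>
lemma approx_zeros_bound:
  assumes "finite X" "\<And>x. x \<in> X \<Longrightarrow> av x = 1"
    and "\<And>x y. x \<in> X \<Longrightarrow> y \<in> X \<Longrightarrow> x \<noteq> y \<Longrightarrow> \<delta> \<le> av (x - y)"
    and "0 < \<delta>" "\<delta> \<le> 1"
    and "\<And>i. av (coeff R i) \<le> 1"
    and "av (coeff R N) = 1" "\<And>i. i > N \<Longrightarrow> av (coeff R i) < 1"
    and "av (coeff R m) = 1" "\<And>i. i < m \<Longrightarrow> av (coeff R i) < 1"
    and "\<And>x. x \<in> X \<Longrightarrow> av (poly R x) < \<delta> ^ card X"
  shows "card X + m \<le> N"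
  using assms
proof (induction X arbitrary: R N rule: finite_induct)
  case empty
  then show ?case by (metis card.empty add_0 linorder_not_less order_less_irrefl)
next
  case (insert z X)
  define U where "U = synthetic_div R z"
  define v where "v = poly R z"
  have z: "av z = 1" using insert by simp
  have rec: "coeff U i = coeff R (Suc i) + z * coeff U (Suc i)"
    and rec0: "v = coeff R 0 + z * coeff U 0" for i
    using arg_cong[OF synthetic_div_correct[of R z], of "\<lambda>p. coeff p (Suc i)"]
      arg_cong[OF synthetic_div_correct[of R z], of "\<lambda>p. coeff p 0"]
    by (simp_all add: U_def v_def)
  have dpow: "\<delta> ^ card (insert z X) \<le> 1"
    using insert.prems by (intro power_le_one) auto
  have v1: "av v < 1"
    using insert.prems(10)[of z] dpow by (auto simp: v_def)
  have U0: "coeff U i = 0" if "i \<ge> degree R" for i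
  proof (cases "degree R = 0")
    case True
    then have "U = 0" by (simp add: U_def synthetic_div_eq_0_iff)
    then show ?thesis by simp
  next
    case False
    then have "degree U < i" using that by (simp add: U_def degree_synthetic_div)
    then show ?thesis by (rule coeff_eq_0)
  qed
  \<comment> \<open>Read from the top, the recursion \<open>rec\<close> passes bounds downwards, by
    induction on the distance to the degree. Solved for \<open>coeff U (Suc i)\<close>, it passes
    the strict bound below \<open>m\<close> upwards, starting from |v| < 1.\<close>
  have U1: "av (coeff U i) \<le> 1" for i
  proof (induction "degree R - i" arbitrary: i)
    case 0 then show ?case using U0 by simp
  next
    case (Suc k)
    then have "av (coeff U (Suc i)) \<le> 1" by simp
    then show ?case
      using rec[of i] av_add[of "coeff R (Suc i)" "z * coeff U (Suc i)"] insert.prems(5)[of "Suc i"] z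
      by (simp add: av_mult)
  qed
  have Utop: "av (coeff U i) < 1" if "i \<ge> N" for i
    using that
  proof (induction "degree R - i" arbitrary: i)
    case 0 then show ?case using U0 by simp
  next
    case (Suc k)
    have "av (coeff U (Suc i)) < 1" by (rule Suc.hyps(1)) (use Suc in auto)
    then show ?case
      using rec[of i] av_add[of "coeff R (Suc i)" "z * coeff U (Suc i)"] insert.prems(7)[of "Suc i"] z Suc.prems
      by (simp add: av_mult)
  qed
  have Ubot: "av (coeff U i) < 1" if "i < m" for i
    using that
  proof (induction i)
    case 0
    have "z * coeff U 0 = v - coeff R 0" using rec0 by simp
    then show ?case using av_diff[of v "coeff R 0"] v1 insert.prems(9)[of 0] 0 z
      by (metis av_mult max_less_iff_conj mult_1 order_le_less_trans)
  next
    case (Suc i)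
    have "z * coeff U (Suc i) = coeff U i - coeff R (Suc i)" using rec[of i] by simp
    then show ?case using av_diff[of "coeff U i" "coeff R (Suc i)"] Suc insert.prems(9)[of "Suc i"] z
      by (metis Suc_lessD av_mult max_less_iff_conj mult_1 order_le_less_trans)
  qed
  have "N > 0"
  proof (rule ccontr)
    assume "\<not> N > 0"
    then have "av (coeff R 0) = 1" "av (z * coeff U 0) < 1"
      using insert.prems(6) Utop[of 0] z by (auto simp: av_mult)
    then have "av v = 1" using rec0 av_add_eq[of "z * coeff U 0" "coeff R 0"] by simp
    then show False using v1 by simp
  qed
  then obtain N' where N': "N = Suc N'" using gr0_implies_Suc by blast
  have UN: "av (coeff U N') = 1"
    using rec[of N'] av_add_eq[of "z * coeff U N" "coeff R N"] Utop[of N] insert.prems(6) z N'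
    by (simp add: av_mult)
  have Um: "av (coeff U m) = 1"
  proof (cases m)
    case 0
    have "z * coeff U 0 = - coeff R 0 + v" using rec0 by simp
    then show ?thesis using av_add_eq[of v "- coeff R 0"] v1 insert.prems(8) 0 z
      by (metis av_minus av_mult mult_1)
  next
    case (Suc i)
    have "z * coeff U m = - coeff R m + coeff U i" using rec[of i] Suc by simp
    then show ?thesis using av_add_eq[of "coeff U i" "- coeff R m"] Ubot[of i] insert.prems(8) Suc z
      by (metis av_minus av_mult mult_1 lessI)
  qed
  have fac: "poly R x = (x - z) * poly U x + v" for x
    using arg_cong[OF synthetic_div_correct'[of z R], of "\<lambda>p. poly p x"]
    by (simp add: U_def v_def algebra_simps)
  have "card X + m \<le> N'"
  proof (rule insert.IH)
    fix x assume x: "x \<in> X"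
    then have ne: "x \<noteq> z" using insert by auto
    have d: "\<delta> \<le> av (x - z)" using insert.prems(2)[of x z] x ne by simp
    have "av ((x - z) * poly U x) = av (poly R x - v)" using fac by simp
    also have "\<dots> < \<delta> ^ card (insert z X)"
      using av_diff[of "poly R x" v] insert.prems(10)[of x] insert.prems(10)[of z] x
      by (simp add: v_def)
    \<comment> \<open>Dividing by x - z costs at most one factor \<delta>; this is the reason for
      the exponent \<open>card X\<close> in the smallness hypothesis.\<close>
    finally have "av (x - z) * av (poly U x) < \<delta> * \<delta> ^ card X"
      using insert by (simp add: av_mult)
    moreover have "\<delta> * av (poly U x) \<le> av (x - z) * av (poly U x)"
      using d by (intro mult_right_mono) auto
    ultimately have "\<delta> * av (poly U x) < \<delta> * \<delta> ^ card X" by linarith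
    then show "av (poly U x) < \<delta> ^ card X"
      using insert.prems(3) by simp
  next
    fix i assume "i > N'" then show "av (coeff U i) < 1" using Utop N' by simp
  qed (use insert.prems UN Um Ubot U1 in auto)
  then show ?case using insert N' by simp
qed

lemma finite_argmax_coeff:
  fixes c :: "int \<Rightarrow> 'a"
  assumes lim: "\<And>e. e > 0 \<Longrightarrow> finite {n. av (c n) \<ge> e}" and nz: "c k \<noteq> 0"
  obtains n where "\<And>i. av (c i) \<le> av (c n)" "c n \<noteq> 0"
proof -
  let ?A = "{n. av (c n) \<ge> av (c k)}"
  have fin: "finite ((\<lambda>n. av (c n)) ` ?A)" using lim[of "av (c k)"] nz by simp
  have "Max ((\<lambda>n. av (c n)) ` ?A) \<in> (\<lambda>n. av (c n)) ` ?A"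
    by (rule Max_in[OF fin]) auto
  then obtain n where n: "n \<in> ?A" "av (c n) = Max ((\<lambda>n. av (c n)) ` ?A)" by auto
  have "av (c i) \<le> av (c n)" for i
  proof (cases "i \<in> ?A")
    case True then show ?thesis using Max_ge[OF fin] n by auto
  next
    case False then show ?thesis using n by auto
  qed
  moreover have "c n \<noteq> 0" using n(1) nz by (metis av_0 av_pos_iff mem_Collect_eq not_le)
  ultimately show ?thesis using that by blast
qed

lemma poly_argmax:
  fixes Q :: "'a poly"
  assumes "Q \<noteq> 0"
  obtains i where "coeff Q i \<noteq> 0" "\<And>j. av (coeff Q j) \<le> av (coeff Q i)"
proof -
  let ?F = "(\<lambda>n. av (coeff Q n)) ` {..degree Q}"
  have "Max ?F \<in> ?F" by (rule Max_in) auto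
  then obtain n where n: "n \<le> degree Q" "av (coeff Q n) = Max ?F"
    by (metis (no_types, lifting) atMost_iff imageE)
  have mx: "av (coeff Q k) \<le> av (coeff Q n)" for k
  proof (cases "k \<le> degree Q")
    case True then show ?thesis using Max_ge[of ?F "av (coeff Q k)"] n by auto
  next
    case False then show ?thesis by (simp add: coeff_eq_0)
  qed
  have "coeff Q n \<noteq> 0"
  proof
    assume "coeff Q n = 0"
    then have "av (lead_coeff Q) \<le> 0" using mx[of "degree Q"] by simp
    then show False using assms av_nonneg[of "lead_coeff Q"] by simp
  qed
  then show ?thesis using mx that by blast
qed

text \<open>Over the residue field a non-zero polynomial has at most as many roots as its degree. If
  the Gauss norm exceeded \<open>r\<close>, dividing by a largest coefficient would give a
  polynomial of Gauss norm 1 whose reduction vanishes at more points than that;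
  \<open>approx_zeros_bound\<close> with \<delta> = 1 excludes it.\<close>

lemma coeffs_le_if_values_le:
  assumes X: "finite X" "\<And>x. x \<in> X \<Longrightarrow> av x = 1"
    "\<And>x y. x \<in> X \<Longrightarrow> y \<in> X \<Longrightarrow> x \<noteq> y \<Longrightarrow> 1 \<le> av (x - y)"
    and deg: "degree R < card X"
    and r: "\<And>x. x \<in> X \<Longrightarrow> av (poly R x) \<le> r"
  shows "av (coeff R i) \<le> r"
proof (rule ccontr)
  assume nle: "\<not> av (coeff R i) \<le> r"
  have "X \<noteq> {}" using deg by auto
  then have r0: "r \<ge> 0" using r av_nonneg order_trans by blast
  have "R \<noteq> 0" using nle r0 by auto
  then obtain n where n: "coeff R n \<noteq> 0" "\<And>k. av (coeff R k) \<le> av (coeff R n)"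
    using poly_argmax by blast
  note mx = n(2)
  define a where "a = coeff R n"
  have an: "av a > r" using nle mx[of i] by (simp add: a_def)
  then have a0: "a \<noteq> 0" using r0 by auto
  define T where "T = smult (inverse a) R"
  have cT: "coeff T k = coeff R k / a" for k by (simp add: T_def field_simps)
  have le1: "av (coeff T k) \<le> 1" for k
    using mx[of k] a0 by (simp add: cT av_divide a_def divide_le_eq)
  let ?I = "{k. av (coeff T k) = 1}"
  have sub: "?I \<subseteq> {..degree R}"
  proof
    fix k assume "k \<in> ?I"
    then have "coeff R k \<noteq> 0" by (auto simp: cT)
    then show "k \<in> {..degree R}" by (simp add: le_degree)
  qed
  then have fin: "finite ?I" by (rule finite_subset) simp
  have nI: "n \<in> ?I" using a0 by (simp add: cT a_def)
  then have ne: "?I \<noteq> {}" by blast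
  have MI: "Max ?I \<in> ?I" and mI: "Min ?I \<in> ?I"
    using Max_in[OF fin ne] Min_in[OF fin ne] by blast+
  have "card X + Min ?I \<le> Max ?I"
  proof (rule approx_zeros_bound[of X 1 T])
    fix k assume "k > Max ?I" then show "av (coeff T k) < 1"
      using le1[of k] Max_ge[OF fin, of k] by fastforce
  next
    fix k assume "k < Min ?I" then show "av (coeff T k) < 1"
      using le1[of k] Min_le[OF fin, of k] by fastforce
  next
    fix x assume "x \<in> X"
    then have "av (poly R x) < av a" using r an by fastforce
    then show "av (poly T x) < 1 ^ card X" using a0
      by (simp add: T_def av_divide divide_less_eq_1 flip: divide_inverse_commute)
  qed (use X MI mI le1 in auto)
  moreover have "Max ?I \<le> degree R" using MI sub by auto
  ultimately show False using deg by linarith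
qed

end

section \<open>Laurent series on the unit sphere\<close>

text \<open>The convergence condition is separated from membership of the coefficients in
  \<open>K\<close>, because twists by roots of unity leave \<open>K\<close>.\<close>

definition vanishing :: "('a::field \<Rightarrow> real) \<Rightarrow> (int \<Rightarrow> 'a) \<Rightarrow> bool" where
  "vanishing av c \<longleftrightarrow> (\<forall>e>0. \<exists>N. \<forall>n. \<bar>n\<bar> > N \<longrightarrow> av (c n) < e)"

definition laurent_sum :: "(int \<Rightarrow> 'a::field) \<Rightarrow> nat \<Rightarrow> 'a \<Rightarrow> 'a" where
  "laurent_sum c N x = (\<Sum>n\<in>{- int N..int N}. c n * x powi n)"

text \<open>The truncation multiplied by X^N, a factor of absolute value 1 on the unit
  sphere.\<close>

definition laurent_poly :: "(int \<Rightarrow> 'a::field) \<Rightarrow> nat \<Rightarrow> 'a poly" where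
  "laurent_poly c N = (\<Sum>i\<le>2*N. monom (c (int i - int N)) i)"

lemma coeff_laurent_poly:
  "coeff (laurent_poly c N) i = (if i \<le> 2 * N then c (int i - int N) else 0)"
  by (simp add: laurent_poly_def coeff_sum)

lemma poly_laurent_poly:
  assumes "x \<noteq> 0"
  shows "poly (laurent_poly c N) x = x ^ N * laurent_sum c N x"
proof -
  have "x ^ N * laurent_sum c N x = (\<Sum>n\<in>{- int N..int N}. c n * x powi (n + int N))"
    unfolding laurent_sum_def sum_distrib_left
    by (rule sum.cong) (use assms in \<open>auto simp: power_int_add\<close>)
  also have "\<dots> = (\<Sum>i\<le>2*N. c (int i - int N) * x ^ i)"
    by (rule sum.reindex_bij_witness[of _ "\<lambda>i. int i - int N" "\<lambda>n. nat (n + int N)"])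
       (auto simp: power_int_def)
  finally show ?thesis by (simp add: laurent_poly_def poly_sum poly_monom)
qed

context nonarch_field
begin

lemma vanishing_obtain:
  assumes "vanishing av c" "e > 0"
  obtains N :: nat where "\<And>n. \<bar>n\<bar> > int N \<Longrightarrow> av (c n) < e"
proof -
  obtain N where N: "\<forall>n. \<bar>n\<bar> > N \<longrightarrow> av (c n) < e"
    using assms unfolding vanishing_def by blast
  show ?thesis
  proof (rule that[of "nat N"])
    fix n :: int assume "\<bar>n\<bar> > int (nat N)"
    then have "\<bar>n\<bar> > N" by linarith
    then show "av (c n) < e" using N by blast
  qed
qed

lemma vanishing_finite:
  assumes "vanishing av c" "e > 0"
  shows "finite {n. av (c n) \<ge> e}"
proof -
  obtain N :: nat where N: "\<And>n. \<bar>n\<bar> > int N \<Longrightarrow> av (c n) < e"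
    using vanishing_obtain[OF assms] by blast
  have "n \<in> {- int N..int N}" if "av (c n) \<ge> e" for n
  proof -
    have "\<not> \<bar>n\<bar> > int N" using N[of n] that by linarith
    then show ?thesis by auto
  qed
  then have "{n. av (c n) \<ge> e} \<subseteq> {- int N..int N}" by blast
  then show ?thesis by (rule finite_subset) simp
qed

lemma vanishing_le:
  assumes "vanishing av c" "\<And>n. av (d n) \<le> B * av (c n)"
  shows "vanishing av d"
  unfolding vanishing_def
proof (intro allI impI)
  fix e :: real assume e: "e > 0"
  define B' where "B' = max B 1"
  have B': "B' > 0" by (simp add: B'_def)
  have le: "av (d n) \<le> B' * av (c n)" for n
    using assms(2)[of n] mult_right_mono[of B B' "av (c n)"] by (simp add: B'_def)
  obtain N :: nat where N: "\<And>n. \<bar>n\<bar> > int N \<Longrightarrow> av (c n) < e / B'"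
    using vanishing_obtain[OF assms(1), of "e / B'"] divide_pos_pos[OF e B'] by blast
  have "av (d n) < e" if "\<bar>n\<bar> > int N" for n
    using N[OF that] le[of n] B' by (simp add: pos_less_divide_eq mult.commute)
  then show "\<exists>N. \<forall>n. \<bar>n\<bar> > N \<longrightarrow> av (d n) < e" by blast
qed

lemma laurent_sum_diff_le:
  assumes "av x = 1" "\<And>n. \<bar>n\<bar> > int N \<Longrightarrow> av (c n) \<le> e" "e \<ge> 0" "N \<le> M"
  shows "av (laurent_sum c M x - laurent_sum c N x) \<le> e"
proof -
  have "laurent_sum c M x - laurent_sum c N x
      = (\<Sum>n\<in>{- int M..int M} - {- int N..int N}. c n * x powi n)"
    unfolding laurent_sum_def by (rule sum_diff[symmetric]) (use assms(4) in auto)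
  also have "av \<dots> \<le> e"
  proof (rule av_sum_le)
    fix n assume "n \<in> {- int M..int M} - {- int N..int N}"
    then have "\<bar>n\<bar> > int N" by auto
    then show "av (c n * x powi n) \<le> e" using assms by (simp add: av_mult av_powi)
  qed (use assms in auto)
  finally show ?thesis .
qed

lemma laurent_eval_eqI:
  assumes "av_tendsto av (\<lambda>N. laurent_sum c N x) y"
  shows "laurent_eval av c x = y"
  using assms av_tendsto_unique unfolding laurent_eval_def laurent_sum_def by blast

lemma av_tendsto_diff:
  assumes "av_tendsto av s l" "av_tendsto av t m"
  shows "av_tendsto av (\<lambda>n. s n - t n) (l - m)"
  unfolding av_tendsto_def
proof (intro allI impI)
  fix e :: real assume "e > 0"
  obtain N where N: "\<forall>n\<ge>N. av (s n - l) < e"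
    using assms(1) \<open>e > 0\<close> unfolding av_tendsto_def by blast
  obtain N' where N': "\<forall>n\<ge>N'. av (t n - m) < e"
    using assms(2) \<open>e > 0\<close> unfolding av_tendsto_def by blast
  have "av (s n - t n - (l - m)) < e" if "n \<ge> max N N'" for n
  proof -
    have "s n - t n - (l - m) = (s n - l) - (t n - m)" by simp
    moreover have "av (s n - l) < e" "av (t n - m) < e" using N N' that by auto
    ultimately show ?thesis using av_diff[of "s n - l" "t n - m"] by (metis max_less_iff_conj order_le_less_trans)
  qed
  then show "\<exists>N. \<forall>n\<ge>N. av (s n - t n - (l - m)) < e" by blast
qed

lemma av_tendsto_mult_left:
  assumes "av_tendsto av s l"
  shows "av_tendsto av (\<lambda>n. a * s n) (a * l)"
proof (cases "a = 0")
  case True then show ?thesis by (simp add: av_tendsto_def)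
next
  case False
  show ?thesis unfolding av_tendsto_def
  proof (intro allI impI)
    fix e :: real assume "e > 0"
    then have "e / av a > 0" using False by simp
    then obtain N where N: "\<forall>n\<ge>N. av (s n - l) < e / av a"
      using assms unfolding av_tendsto_def by blast
    have "av (a * s n - a * l) < e" if "n \<ge> N" for n
    proof -
      have "av (s n - l) < e / av a" using N that by simp
      then show ?thesis using False
        by (simp add: av_mult pos_less_divide_eq mult.commute flip: right_diff_distrib)
    qed
    then show "\<exists>N. \<forall>n\<ge>N. av (a * s n - a * l) < e" by blast
  qed
qed

end

locale nonarch_complete_field = nonarch_field +
  assumes complete: "av_complete av UNIV"
begin

lemma laurent_sum_tendsto:
  assumes "vanishing av c" "av x = 1"
  shows "av_tendsto av (\<lambda>N. laurent_sum c N x) (laurent_eval av c x)"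
proof -
  have "av_cauchy av (\<lambda>N. laurent_sum c N x)"
    unfolding av_cauchy_def
  proof (intro allI impI)
    fix e :: real assume e: "e > 0"
    obtain N :: nat where N: "\<And>n. \<bar>n\<bar> > int N \<Longrightarrow> av (c n) < e / 2"
      using vanishing_obtain[OF assms(1), of "e / 2"] e by (metis half_gt_zero)
    have "av (laurent_sum c m x - laurent_sum c n x) < e" if "m \<ge> N" "n \<ge> N" for m n
    proof -
      have "av (laurent_sum c k x - laurent_sum c N x) \<le> e / 2" if "k \<ge> N" for k
        by (rule laurent_sum_diff_le) (use assms N e that in \<open>auto intro: less_imp_le\<close>)
      from this[of m] this[of n] show ?thesis
        using av_diff_triangle[of "laurent_sum c m x" "laurent_sum c n x" "laurent_sum c N x"]
          av_diff_commute[of "laurent_sum c n x" "laurent_sum c N x"] that e by simp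
    qed
    then show "\<exists>N. \<forall>m\<ge>N. \<forall>n\<ge>N. av (laurent_sum c m x - laurent_sum c n x) < e" by blast
  qed
  then obtain y where "av_tendsto av (\<lambda>N. laurent_sum c N x) y"
    using complete unfolding av_complete_def by blast
  then show ?thesis using laurent_eval_eqI[of c x y] by simp
qed

lemma laurent_eval_approx:
  assumes "vanishing av c" "av x = 1" "\<And>n. \<bar>n\<bar> > int N \<Longrightarrow> av (c n) \<le> e" "e > 0"
  shows "av (laurent_eval av c x - laurent_sum c N x) \<le> e"
proof -
  obtain M where M: "\<forall>n\<ge>M. av (laurent_sum c n x - laurent_eval av c x) < e"
    using laurent_sum_tendsto[OF assms(1,2)] assms(4) unfolding av_tendsto_def by blast
  let ?k = "max M N"
  have "av (laurent_sum c ?k x - laurent_sum c N x) \<le> e"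
    by (rule laurent_sum_diff_le) (use assms in auto)
  moreover have "av (laurent_sum c ?k x - laurent_eval av c x) < e" using M by simp
  ultimately show ?thesis
    using av_diff_triangle[of "laurent_eval av c x" "laurent_sum c N x" "laurent_sum c ?k x"]
      av_diff_commute[of "laurent_eval av c x" "laurent_sum c ?k x"] by simp
qed

text \<open>Strassmann's argument: the largest absolute value of a coefficient is attained at
  finitely many indices only, and the distance M - m of the extreme ones bounds the number of zeros.
  One zero more, together with a truncation fine enough for the spacing of the chosen zeros,
  contradicts \<open>approx_zeros_bound\<close>.\<close>

lemma laurent_eval_zero_infinite:
  assumes c: "vanishing av c" and Z: "infinite Z"
    and zero: "\<And>x. x \<in> Z \<Longrightarrow> av x = 1" "\<And>x. x \<in> Z \<Longrightarrow> laurent_eval av c x = 0"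
  shows "c k = 0"
proof (rule ccontr)
  assume "c k \<noteq> 0"
  then obtain n0 where n0: "\<And>i. av (c i) \<le> av (c n0)" "c n0 \<noteq> 0"
    using finite_argmax_coeff[of c k] vanishing_finite[OF c] by blast
  define a where "a = c n0"
  have a0: "a \<noteq> 0" "av a > 0" using n0 by (auto simp: a_def)
  define I where "I = {n. av (c n) = av a}"
  have "I \<subseteq> {n. av (c n) \<ge> av a}" by (auto simp: I_def)
  then have fin: "finite I" using vanishing_finite[OF c a0(2)] finite_subset by blast
  have ne: "I \<noteq> {}" by (auto simp: I_def a_def)
  define M m where "M = Max I" and "m = Min I"
  have MI: "M \<in> I" "m \<in> I" using Max_in[OF fin ne] Min_in[OF fin ne] by (auto simp: M_def m_def)
  have "\<exists>X. finite X \<and> card X = nat (M - m) + 1 \<and> X \<subseteq> Z"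
    by (rule infinite_arbitrarily_large[OF Z])
  then obtain X where X: "finite X" "card X = nat (M - m) + 1" "X \<subseteq> Z" by (elim exE conjE)
  \<comment> \<open>The element 1 keeps the set non-empty when only one zero is chosen, and it
    forces \<delta> \<le> 1.\<close>
  define D where "D = insert 1 ((\<lambda>(x, y). av (x - y)) ` {(x, y) \<in> X \<times> X. x \<noteq> y})"
  have "finite {(x, y) \<in> X \<times> X. x \<noteq> y}"
    by (rule finite_subset[of _ "X \<times> X"]) (use X in auto)
  then have finD: "finite D" by (simp add: D_def)
  define \<delta> where "\<delta> = Min D"
  have "\<delta> \<in> D" unfolding \<delta>_def by (rule Min_in[OF finD]) (simp add: D_def)
  then have \<delta>: "\<delta> > 0" by (auto simp: D_def)
  have \<delta>1: "\<delta> \<le> 1" unfolding \<delta>_def by (rule Min_le[OF finD]) (simp add: D_def)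
  have \<delta>d: "\<delta> \<le> av (x - y)" if "x \<in> X" "y \<in> X" "x \<noteq> y" for x y
    unfolding \<delta>_def by (rule Min_le[OF finD]) (use that in \<open>auto simp: D_def intro!: image_eqI[of _ _ "(x, y)"]\<close>)
  \<comment> \<open>After division by \<open>a\<close> the truncation error must stay below
    \<delta>^card X. As e < |a|, the truncation also retains every index in
    \<open>I\<close>.\<close>
  define e where "e = av a * \<delta> ^ card X / 2"
  have e: "e > 0" "e < av a * \<delta> ^ card X" using a0 \<delta> by (auto simp: e_def)
  have "av a * \<delta> ^ card X \<le> av a * 1"
    using \<delta> \<delta>1 by (intro mult_left_mono power_le_one) auto
  then have "e < av a * 1" using e(2) by linarith
  obtain N :: nat where N: "\<And>n. \<bar>n\<bar> > int N \<Longrightarrow> av (c n) < e"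
    using vanishing_obtain[OF c e(1)] by blast
  have IN: "\<bar>n\<bar> \<le> int N" if "n \<in> I" for n
  proof -
    have "\<not> \<bar>n\<bar> > int N" using that N[of n] \<open>e < av a * 1\<close> by (auto simp: I_def)
    then show ?thesis by simp
  qed
  define R where "R = smult (inverse a) (laurent_poly c N)"
  have cR: "coeff R i = (if i \<le> 2 * N then c (int i - int N) / a else 0)" for i
    by (simp add: R_def coeff_laurent_poly divide_inverse mult.commute)
  have le1: "av (c i) / av a \<le> 1" for i using n0(1)[of i] a0 by (simp add: a_def)
  have less1: "av (c i) / av a < 1" if "i \<notin> I" for i
    using n0(1)[of i] a0 that by (auto simp: I_def a_def divide_less_eq_1)
  have "card X + nat (m + int N) \<le> nat (M + int N)"
  proof (rule approx_zeros_bound[of X \<delta> R])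
    fix i show "av (coeff R i) \<le> 1" using le1 by (simp add: cR av_divide)
  next
    show "av (coeff R (nat (M + int N))) = 1" "av (coeff R (nat (m + int N))) = 1"
      using IN[of M] IN[of m] MI a0 by (auto simp: cR av_divide I_def)
  next
    fix i assume "nat (M + int N) < i"
    then have "int i - int N \<notin> I" using Max_ge[OF fin, of "int i - int N"] by (auto simp: M_def)
    then show "av (coeff R i) < 1" using less1 by (simp add: cR av_divide)
  next
    fix i assume "i < nat (m + int N)"
    then have "int i - int N \<notin> I" using Min_le[OF fin, of "int i - int N"] by (auto simp: m_def)
    then show "av (coeff R i) < 1" using less1 by (simp add: cR av_divide)
  next
    fix x assume x: "x \<in> X"
    then have x1: "av x = 1" "laurent_eval av c x = 0" "x \<noteq> 0" using zero X(3) by force+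
    have "av (laurent_eval av c x - laurent_sum c N x) \<le> e"
      by (rule laurent_eval_approx) (use c x1 N e in \<open>auto intro: less_imp_le\<close>)
    then have "av (laurent_sum c N x) < av a * \<delta> ^ card X" using x1 e(2) by simp
    moreover have "av (poly R x) = av (laurent_sum c N x) / av a"
      by (simp add: R_def poly_laurent_poly[OF x1(3)] av_mult av_inverse av_power x1 divide_inverse mult.commute)
    ultimately show "av (poly R x) < \<delta> ^ card X"
      using a0 by (simp add: pos_divide_less_eq mult.commute)
  qed (use X zero \<delta> \<delta>1 \<delta>d in auto)
  then show False using X(2) IN[of M] IN[of m] MI by linarith
qed

end

section \<open>Conjugates over a complete subfield\<close>

definition poly_over :: "'a::field set \<Rightarrow> 'a poly \<Rightarrow> bool" where
  "poly_over K Q \<longleftrightarrow> (\<forall>i. coeff Q i \<in> K)"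

text \<open>Phrased as a transfer of relations, conjugacy of any root of the minimal polynomial is
  immediate from division with remainder.\<close>

definition conjugate_over :: "'a::field set \<Rightarrow> 'a \<Rightarrow> 'a \<Rightarrow> bool" where
  "conjugate_over K x y \<longleftrightarrow> (\<forall>Q. poly_over K Q \<longrightarrow> poly Q x = 0 \<longrightarrow> poly Q y = 0)"

text \<open>The vanishing of coefficients from \<open>degree h\<close> on describes the vector space
  of remainders, with no exception for the zero polynomial. The same form with a bound
  \<open>n\<close> in place of \<open>degree h\<close> allows the induction in
  \<open>coeff_bound\<close> to start at the zero space.\<close>

definition min_poly_over :: "'a::field set \<Rightarrow> 'a \<Rightarrow> 'a poly \<Rightarrow> bool" where
  "min_poly_over K x h \<longleftrightarrow> poly_over K h \<and> lead_coeff h = 1 \<and> poly h x = 0 \<and>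
     (\<forall>R. poly_over K R \<longrightarrow> (\<forall>i\<ge>degree h. coeff R i = 0) \<longrightarrow> poly R x = 0 \<longrightarrow> R = 0)"

locale subfield_of =
  fixes K :: "'a::field set"
  assumes subfield: "is_subfield K"
begin

lemma K_0 [simp]: "0 \<in> K" and K_1 [simp]: "1 \<in> K"
  and K_add: "x \<in> K \<Longrightarrow> y \<in> K \<Longrightarrow> x + y \<in> K"
  and K_mult: "x \<in> K \<Longrightarrow> y \<in> K \<Longrightarrow> x * y \<in> K"
  and K_minus: "x \<in> K \<Longrightarrow> - x \<in> K"
  and K_inverse: "x \<in> K \<Longrightarrow> inverse x \<in> K"
  using subfield by (auto simp: is_subfield_def)

lemma K_diff: "x \<in> K \<Longrightarrow> y \<in> K \<Longrightarrow> x - y \<in> K"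
  using K_add[of x "-y"] K_minus by simp

lemma K_sum: "(\<And>i. i \<in> A \<Longrightarrow> f i \<in> K) \<Longrightarrow> sum f A \<in> K"
  by (induction A rule: infinite_finite_induct) (auto intro: K_add)

lemma K_power: "x \<in> K \<Longrightarrow> x ^ n \<in> K"
  by (induction n) (auto intro: K_mult)

lemma poly_over_0 [simp]: "poly_over K 0"
  by (simp add: poly_over_def)

lemma poly_over_1 [simp]: "poly_over K 1"
  by (simp add: poly_over_def coeff_1)

lemma poly_over_monom: "a \<in> K \<Longrightarrow> poly_over K (monom a n)"
  by (simp add: poly_over_def)

lemma poly_over_add: "poly_over K P \<Longrightarrow> poly_over K Q \<Longrightarrow> poly_over K (P + Q)"
  by (simp add: poly_over_def K_add)

lemma poly_over_diff: "poly_over K P \<Longrightarrow> poly_over K Q \<Longrightarrow> poly_over K (P - Q)"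
  by (simp add: poly_over_def K_diff)

lemma poly_over_mult: "poly_over K P \<Longrightarrow> poly_over K Q \<Longrightarrow> poly_over K (P * Q)"
  by (simp add: poly_over_def coeff_mult K_sum K_mult)

lemma poly_over_power: "poly_over K P \<Longrightarrow> poly_over K (P ^ n)"
  by (induction n) (simp_all add: poly_over_mult)

lemma poly_over_sum: "(\<And>i. i \<in> A \<Longrightarrow> poly_over K (f i)) \<Longrightarrow> poly_over K (sum f A)"
  by (simp add: poly_over_def coeff_sum K_sum)

lemma poly_over_smult: "a \<in> K \<Longrightarrow> poly_over K P \<Longrightarrow> poly_over K (smult a P)"
  by (simp add: poly_over_def K_mult)

lemma poly_over_pCons: "poly_over K (pCons a P) \<longleftrightarrow> a \<in> K \<and> poly_over K P"
  by (auto simp: poly_over_def coeff_pCons split: nat.splits)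

lemma poly_over_pcompose_monom: "poly_over K P \<Longrightarrow> poly_over K (pcompose P (monom 1 k))"
  by (induction P)
     (auto simp: pcompose_pCons poly_over_pCons intro!: poly_over_add poly_over_mult poly_over_monom)

text \<open>\<open>K\<close> is a set and not a type, so the induction carries along that quotient
  and remainder have coefficients in \<open>K\<close>.\<close>

lemma division_by_monic:
  assumes h: "poly_over K h" "lead_coeff h = 1" and Q: "poly_over K Q"
  obtains U R where "poly_over K U" "poly_over K R" "Q = h * U + R" "\<forall>i\<ge>degree h. coeff R i = 0"
proof -
  have "\<exists>U R. poly_over K U \<and> poly_over K R \<and> Q = h * U + R \<and> (\<forall>i\<ge>degree h. coeff R i = 0)"
    using Q
  proof (induction Q)
    case 0
    show ?case by (intro exI[of _ 0]) simp
  next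
    case (pCons a Q)
    then obtain U R where UR: "poly_over K U" "poly_over K R" "Q = h * U + R"
      "\<And>i. i \<ge> degree h \<Longrightarrow> coeff R i = 0"
      by (auto simp: poly_over_pCons)
    \<comment> \<open>Shifting the old remainder by one degree creates at most one excess
      coefficient, at \<open>degree h\<close>; subtracting \<open>b\<close> times the monic
      \<open>h\<close> removes it.\<close>
    define b where "b = coeff (pCons a R) (degree h)"
    have a: "a \<in> K" using pCons.prems by (simp add: poly_over_pCons)
    have aR: "poly_over K (pCons a R)" using a UR by (simp add: poly_over_pCons)
    then have b: "b \<in> K" by (simp add: poly_over_def b_def)
    have "pCons a Q = h * pCons b U + (pCons a R - smult b h)"
      by (simp add: UR(3) algebra_simps)
    moreover have "poly_over K (pCons b U)" using b UR by (simp add: poly_over_pCons)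
    moreover have "poly_over K (pCons a R - smult b h)"
      by (intro poly_over_diff poly_over_smult aR b h)
    moreover have "coeff (pCons a R - smult b h) i = 0" if "i \<ge> degree h" for i
    proof (cases "i = degree h")
      case True then show ?thesis using h by (simp add: b_def)
    next
      case False
      then have "i > degree h" using that by simp
      then show ?thesis using UR(4)[of "i - 1"]
        by (cases i) (auto simp: coeff_eq_0)
    qed
    ultimately show ?case by blast
  qed
  then show ?thesis using that by blast
qed

lemma min_poly_overE:
  assumes "min_poly_over K x h" "poly_over K Q" "poly Q x = 0"
  obtains U where "poly_over K U" "Q = h * U"
proof -
  have h: "poly_over K h" "lead_coeff h = 1" "poly h x = 0"
    "\<And>R. poly_over K R \<Longrightarrow> \<forall>i\<ge>degree h. coeff R i = 0 \<Longrightarrow> poly R x = 0 \<Longrightarrow> R = 0"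
    using assms(1) by (auto simp: min_poly_over_def)
  obtain U R where UR: "poly_over K U" "poly_over K R" "Q = h * U + R" "\<forall>i\<ge>degree h. coeff R i = 0"
    using division_by_monic[OF h(1,2) assms(2)] by blast
  have "R = 0" using h(4)[OF UR(2,4)] UR(3) assms(3) h(3) by simp
  then show ?thesis using that[OF UR(1)] UR(3) by simp
qed

lemma conjugate_over_if_root:
  assumes "min_poly_over K x h" "poly h y = 0"
  shows "conjugate_over K x y"
  unfolding conjugate_over_def
proof (intro allI impI)
  fix Q assume "poly_over K Q" "poly Q x = 0"
  then obtain U where "Q = h * U" using min_poly_overE[OF assms(1)] by blast
  then show "poly Q y = 0" using assms(2) by simp
qed

lemma min_poly_over_exists:
  assumes "poly_over K Q" "Q \<noteq> 0" "poly Q x = 0"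
  obtains h where "min_poly_over K x h"
proof -
  let ?P = "\<lambda>P. poly_over K P \<and> P \<noteq> 0 \<and> poly P x = 0"
  define P where "P = (ARG_MIN degree P. ?P P)"
  have P: "?P P" and min: "\<And>R. ?P R \<Longrightarrow> degree P \<le> degree R"
    using arg_min_natI[of ?P Q degree] arg_min_nat_le[of ?P _ degree] assms by (auto simp: P_def)
  define h where "h = smult (inverse (lead_coeff P)) P"
  have deg: "degree h = degree P" using P by (simp add: h_def)
  have "min_poly_over K x h"
    unfolding min_poly_over_def
  proof (intro conjI allI impI)
    show "poly_over K h" unfolding h_def using P
      by (intro poly_over_smult K_inverse) (auto simp: poly_over_def)
    show "lead_coeff h = 1" "poly h x = 0" using P by (auto simp: h_def)
    fix R assume R: "poly_over K R" "\<forall>i\<ge>degree h. coeff R i = 0" "poly R x = 0"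
    show "R = 0"
    proof (rule ccontr)
      assume "R \<noteq> 0"
      then have "degree h \<le> degree R" using min[of R] R deg by simp
      then show False using R(2) \<open>R \<noteq> 0\<close> by (metis leading_coeff_0_iff)
    qed
  qed
  then show ?thesis by (rule that)
qed

lemma min_poly_over_exists_root_of_unity:
  assumes "x ^ M = 1" "M > 0"
  obtains h where "min_poly_over K x h"
proof (rule min_poly_over_exists[of "monom 1 M - monom 1 0" x])
  have "coeff (monom 1 M - monom 1 0 :: 'a poly) M = 1" using assms by simp
  then show "monom 1 M - monom 1 0 \<noteq> (0 :: 'a poly)" by (metis coeff_0 zero_neq_one)
qed (use assms in \<open>auto simp: poly_monom intro!: poly_over_diff poly_over_monom\<close>)

lemma conjugate_over_power_eq:
  assumes "conjugate_over K x y" "x ^ m = x ^ n"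
  shows "y ^ m = y ^ n"
proof -
  have "poly_over K (monom 1 m - monom 1 n)" by (intro poly_over_diff poly_over_monom) simp_all
  moreover have "poly (monom 1 m - monom 1 n) x = 0" using assms by (simp add: poly_monom)
  ultimately have "poly (monom 1 m - monom 1 n) y = 0"
    using assms unfolding conjugate_over_def by blast
  then show ?thesis by (simp add: poly_monom)
qed

lemma conjugate_over_power_eq_1:
  assumes "conjugate_over K x y" "x ^ n = 1"
  shows "y ^ n = 1"
  using conjugate_over_power_eq[of x y n 0] assms by simp

text \<open>The cyclotomic relation \<open>1 + z + \<dots> + z^(M-1) = 0\<close> for \<open>z = x ^ m \<noteq> 1\<close> passes to conjugates.\<close>
lemma conjugate_over_power_eq_1_rev:
  assumes "conjugate_over K x y" "x ^ (m * M) = 1" "of_nat M \<noteq> (0 :: 'a)" "y ^ m = 1"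
  shows "x ^ m = 1"
proof (rule ccontr)
  assume ne: "x ^ m \<noteq> 1"
  let ?Q = "\<Sum>i<M. monom (1::'a) (m * i)"
  have val: "poly ?Q z = (\<Sum>i<M. (z ^ m) ^ i)" for z
    by (simp add: poly_sum poly_monom power_mult)
  have "poly ?Q x = 0"
    using ne assms(2) by (simp add: val geometric_sum power_mult)
  moreover have "poly_over K ?Q" by (intro poly_over_sum poly_over_monom) simp
  ultimately have "poly ?Q y = 0" using assms(1) by (auto simp: conjugate_over_def)
  then show False using assms(3,4) by (simp add: val)
qed

text \<open>If Q(X) vanishes at x, then by induction Q(X^(k^i)) does too; as this is again a
  polynomial over \<open>K\<close>, it vanishes at x^k. This serves to iterate Frobenius.\<close>

lemma conjugate_over_iterate:
  assumes "conjugate_over K x (x ^ k)"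
  shows "conjugate_over K x (x ^ (k ^ i))"
proof (induction i)
  case 0
  then show ?case by (simp add: conjugate_over_def)
next
  case (Suc i)
  show ?case unfolding conjugate_over_def
  proof (intro allI impI)
    fix Q assume Q: "poly_over K Q" "poly Q x = 0"
    have "poly (pcompose Q (monom 1 (k ^ i))) x = 0"
      using Suc Q by (auto simp: conjugate_over_def poly_pcompose poly_monom)
    then have "poly (pcompose Q (monom 1 (k ^ i))) (x ^ k) = 0"
      using assms poly_over_pcompose_monom[OF Q(1)] unfolding conjugate_over_def by blast
    then show "poly Q (x ^ (k ^ Suc i)) = 0"
      by (simp add: poly_pcompose poly_monom flip: power_mult)
  qed
qed

end

section \<open>Conjugation over a complete subfield preserves values of series\<close>

locale complete_subfield = nonarch_complete_field av + subfield_of K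
  for av :: "'a::field \<Rightarrow> real" and K +
  assumes K_complete: "av_complete av K"
begin

text \<open>All norms on the finite-dimensional space \<open>K[x]\<close> are equivalent, by completeness of \<open>K\<close>.\<close>
lemma coeff_bound:
  assumes h: "min_poly_over K x h" and x: "av x \<le> 1" and n: "n \<le> degree h"
  shows "\<exists>C>0. \<forall>R. poly_over K R \<longrightarrow> (\<forall>i\<ge>n. coeff R i = 0) \<longrightarrow>
           (\<forall>i. av (coeff R i) \<le> C * av (poly R x))"
  using n
proof (induction n)
  case 0
  have "R = 0" if "\<forall>i\<ge>0. coeff R i = 0" for R :: "'a poly" using that by (simp add: poly_eq_iff)
  then show ?case by (intro exI[of _ 1]) auto
next
  case (Suc n)
  then obtain C where C: "C > 0" "\<And>R i. poly_over K R \<Longrightarrow> \<forall>i\<ge>n. coeff R i = 0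
      \<Longrightarrow> av (coeff R i) \<le> C * av (poly R x)"
    using Suc_leD[OF Suc.prems] by blast
  \<comment> \<open>x^n has positive distance from the span of the lower powers. Otherwise the
    coefficients of ever better approximations form Cauchy sequences by the bound for
    \<open>n\<close>, and their limits in \<open>K\<close> give a relation of degree n for
    x.\<close>
  have "\<exists>\<delta>>0. \<forall>R. poly_over K R \<longrightarrow> (\<forall>i\<ge>n. coeff R i = 0) \<longrightarrow> \<delta> \<le> av (x ^ n + poly R x)"
  proof (rule ccontr)
    assume neg: "\<not> ?thesis"
    have "\<exists>R. poly_over K R \<and> (\<forall>i\<ge>n. coeff R i = 0) \<and> av (x ^ n + poly R x) < 1 / real (Suc k)" for k
    proof -
      have "1 / real (Suc k) > 0" by simp
      then have "\<not> (\<forall>R. poly_over K R \<longrightarrow> (\<forall>i\<ge>n. coeff R i = 0) \<longrightarrow> 1 / real (Suc k) \<le> av (x ^ n + poly R x))"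
        using neg by blast
      then show ?thesis by (auto simp: not_le)
    qed
    then obtain S where S: "\<And>k. poly_over K (S k)" "\<And>k. \<forall>i\<ge>n. coeff (S k) i = 0"
      "\<And>k. av (x ^ n + poly (S k) x) < 1 / real (Suc k)"
      by metis
    have small: "\<exists>k0. \<forall>k\<ge>k0. av (x ^ n + poly (S k) x) < e" if e: "e > 0" for e
    proof -
      obtain k0 where k0: "1 / real (Suc k0) < e" by (rule nat_approx_posE[OF e])
      have "av (x ^ n + poly (S k) x) < e" if "k \<ge> k0" for k
      proof -
        have "1 / real (Suc k) \<le> 1 / real (Suc k0)" using that by (simp add: field_simps)
        then show ?thesis using S(3)[of k] k0 by linarith
      qed
      then show ?thesis by blast
    qed
    have "\<exists>l\<in>K. av_tendsto av (\<lambda>k. coeff (S k) i) l" for i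
    proof -
      have "av_cauchy av (\<lambda>k. coeff (S k) i)"
        unfolding av_cauchy_def
      proof (intro allI impI)
        fix e :: real assume "e > 0"
        then obtain k0 where k0: "\<forall>k\<ge>k0. av (x ^ n + poly (S k) x) < e / C"
          using small[of "e / C"] C by auto
        have "av (coeff (S k) i - coeff (S l) i) < e" if "k \<ge> k0" "l \<ge> k0" for k l
        proof -
          have "av (coeff (S k - S l) i) \<le> C * av (poly (S k - S l) x)"
            by (rule C(2)) (use S in \<open>auto intro: poly_over_diff\<close>)
          also have "poly (S k - S l) x = (x ^ n + poly (S k) x) - (x ^ n + poly (S l) x)" by simp
          also have "av \<dots> < e / C"
          proof -
            have "av (x ^ n + poly (S k) x) < e / C" "av (x ^ n + poly (S l) x) < e / C"
              using k0 that by auto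
            then show ?thesis
              using av_diff[of "x ^ n + poly (S k) x" "x ^ n + poly (S l) x"] by linarith
          qed
          then have "C * av ((x ^ n + poly (S k) x) - (x ^ n + poly (S l) x)) < e"
            using C(1) by (simp add: pos_less_divide_eq mult.commute)
          finally show ?thesis by simp
        qed
        then show "\<exists>N. \<forall>m\<ge>N. \<forall>k\<ge>N. av (coeff (S m) i - coeff (S k) i) < e" by blast
      qed
      moreover have "\<forall>k. coeff (S k) i \<in> K" using S(1) by (simp add: poly_over_def)
      ultimately show ?thesis 
        using K_complete[unfolded av_complete_def, THEN spec, of "\<lambda>k. coeff (S k) i"] by simp
    qed
    then obtain l where l: "\<And>i. l i \<in> K" "\<And>i. av_tendsto av (\<lambda>k. coeff (S k) i) (l i)" by metis
    define R where "R = (\<Sum>i<n. monom (l i) i)"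
    have cR: "coeff R i = (if i < n then l i else 0)" for i by (simp add: R_def coeff_sum)
    have RK: "poly_over K R" using l(1) by (simp add: poly_over_def cR)
    have "x ^ n + poly R x = 0"
    proof (rule ccontr)
      assume "x ^ n + poly R x \<noteq> 0"
      then have e0: "av (x ^ n + poly R x) > 0" (is "?e > 0") by simp
      obtain k0 where k0: "\<forall>k\<ge>k0. av (x ^ n + poly (S k) x) < ?e" using small[OF e0] by blast
      have "\<forall>i. \<exists>k1. \<forall>k\<ge>k1. av (coeff (S k) i - l i) < ?e / 2"
        using l(2) e0 unfolding av_tendsto_def by (metis half_gt_zero)
      then obtain k1 where k1: "\<And>i k. k \<ge> k1 i \<Longrightarrow> av (coeff (S k) i - l i) < ?e / 2" by metis
      define k where "k = k0 + (\<Sum>i<n. k1 i)"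
      have "av (coeff (S k - R) i) \<le> ?e / 2" for i
      proof (cases "i < n")
        case True
        then have "k1 i \<le> (\<Sum>i<n. k1 i)" by (intro member_le_sum) auto
        then show ?thesis using k1[of i k] True by (simp add: cR k_def)
      next
        case False then show ?thesis using S(2)[of k] e0 by (simp add: cR)
      qed
      then have "av (poly (S k - R) x) \<le> ?e / 2" by (rule av_poly_le) (rule x)
      moreover have "x ^ n + poly R x = (x ^ n + poly (S k) x) - poly (S k - R) x" by simp
      then have "?e \<le> max (av (x ^ n + poly (S k) x)) (av (poly (S k - R) x))"
        using av_diff by metis
      moreover have "av (x ^ n + poly (S k) x) < ?e" using k0 by (simp add: k_def)
      ultimately show False using e0 by linarith
    qed
    then have "poly (monom 1 n + R) x = 0" by (simp add: poly_monom)
    moreover have "poly_over K (monom 1 n + R)" by (intro poly_over_add poly_over_monom RK) simp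
    moreover have "\<forall>i\<ge>degree h. coeff (monom 1 n + R) i = 0" using Suc.prems by (simp add: cR)
    ultimately have "monom 1 n + R = 0" using h unfolding min_poly_over_def by blast
    moreover have "coeff (monom 1 n + R) n = 1" by (simp add: cR)
    ultimately show False by simp
  qed
  then obtain \<delta> where \<delta>: "\<delta> > 0" "\<And>R. poly_over K R \<Longrightarrow> \<forall>i\<ge>n. coeff R i = 0 \<Longrightarrow> \<delta> \<le> av (x ^ n + poly R x)"
    by blast
  \<comment> \<open>1/\<delta> controls the leading coefficient; the maximum with 1 lets
    \<open>B\<close> bound what remains after its removal as well.\<close>
  define B where "B = max 1 (1 / \<delta>)"
  have B: "B \<ge> 1" "1 / \<delta> \<le> B" by (auto simp: B_def)
  have "av (coeff R i) \<le> (C * B + B) * av (poly R x)"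
    if R: "poly_over K R" "\<forall>i\<ge>Suc n. coeff R i = 0" for R i
  proof -
    define a where "a = coeff R n"
    define R' where "R' = R - monom a n"
    have aK: "a \<in> K" using R by (simp add: a_def poly_over_def)
    have R'K: "poly_over K R'" using R aK by (simp add: R'_def poly_over_diff poly_over_monom)
    have R'0: "\<forall>i\<ge>n. coeff R' i = 0"
      using R(2) by (auto simp: R'_def a_def)
    have Rx: "poly R x = a * x ^ n + poly R' x" by (simp add: R'_def poly_monom)
    have aB: "av a \<le> B * av (poly R x)"
    proof (cases "a = 0")
      case False
      have "\<delta> \<le> av (x ^ n + poly (smult (inverse a) R') x)"
        by (rule \<delta>(2)) (use R'K R'0 aK in \<open>auto intro: poly_over_smult K_inverse\<close>)
      also have "x ^ n + poly (smult (inverse a) R') x = poly R x / a"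
        using False by (simp add: Rx field_simps)
      finally have "av a * \<delta> \<le> av (poly R x)"
        using False by (simp add: av_divide pos_le_divide_eq mult.commute)
      then have "av a \<le> (1 / \<delta>) * av (poly R x)" using \<delta>(1) by (simp add: field_simps)
      also have "\<dots> \<le> B * av (poly R x)" using B by (intro mult_right_mono) auto
      finally show ?thesis .
    qed (use B in simp)
    have "av (poly R' x) \<le> B * av (poly R x)"
    proof -
      have "av (a * x ^ n) \<le> av a * 1" using x
        by (simp add: av_mult av_power mult_left_le power_le_one)
      then have "av (a * x ^ n) \<le> B * av (poly R x)" using aB by simp
      moreover have "av (poly R x) \<le> B * av (poly R x)" using mult_right_mono[of 1 B "av (poly R x)"] B by simp
      moreover have "poly R' x = poly R x - a * x ^ n" using Rx by simp
      ultimately show ?thesis using av_diff[of "poly R x" "a * x ^ n"] by simp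
    qed
    then have R'B: "C * av (poly R' x) \<le> C * (B * av (poly R x))" using C by (intro mult_left_mono) auto
    show ?thesis
    proof (cases "i = n")
      case True
      have "0 \<le> C * B * av (poly R x)" using B C by simp
      then show ?thesis using True aB by (simp add: a_def algebra_simps)
    next
      case False
      then have "av (coeff R i) = av (coeff R' i)" by (simp add: R'_def)
      also have "\<dots> \<le> C * av (poly R' x)" by (rule C(2)[OF R'K R'0])
      also have "\<dots> \<le> C * B * av (poly R x)" using R'B by (simp add: mult.assoc)
      also have "\<dots> \<le> (C * B + B) * av (poly R x)" using B by (intro mult_right_mono) auto
      finally show ?thesis .
    qed
  qed
  moreover have "C * B + B > 0" using C B by (simp add: add_pos_pos)
  ultimately show ?case by blast
qed

text \<open>By norm equivalence the ratio of the two sides is bounded; apply this to all powers of \<open>Q\<close>.\<close>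
lemma conjugate_over_av_le:
  assumes h: "min_poly_over K x h" and conj: "conjugate_over K x y"
    and x: "av x \<le> 1" and y: "av y \<le> 1" and Q: "poly_over K Q"
  shows "av (poly Q y) \<le> av (poly Q x)"
proof -
  obtain C where C: "C > 0" "\<And>R i. poly_over K R \<Longrightarrow> \<forall>i\<ge>degree h. coeff R i = 0
      \<Longrightarrow> av (coeff R i) \<le> C * av (poly R x)"
    using coeff_bound[OF h x order_refl] by blast
  have hK: "poly_over K h" "lead_coeff h = 1" "poly h x = 0" using h by (auto simp: min_poly_over_def)
  then have hy: "poly h y = 0" using conj by (auto simp: conjugate_over_def)
  have bound: "av (poly T y) \<le> C * av (poly T x)" if T: "poly_over K T" for T
  proof -
    obtain U R where UR: "poly_over K U" "poly_over K R" "T = h * U + R" "\<forall>i\<ge>degree h. coeff R i = 0"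
      using division_by_monic[OF hK(1,2) T] by blast
    have "av (poly R y) \<le> C * av (poly R x)"
      by (rule av_poly_le[OF C(2)[OF UR(2,4)] y])
    then show ?thesis using UR(3) hy hK(3) by simp
  qed
  have pow: "av (poly Q y) ^ n \<le> C * av (poly Q x) ^ n" for n
    using bound[OF poly_over_power[OF Q], of n] by (simp add: av_power)
  show ?thesis
  proof (rule ccontr)
    assume "\<not> ?thesis"
    then have less: "av (poly Q x) < av (poly Q y)" by simp
    show False
    proof (cases "av (poly Q x) = 0")
      case True
      have "av (poly Q y) \<le> C * 0" using pow[of 1] by (simp only: power_one_right True)
      then show False using less True by linarith
    next
      case False
      then have pos: "av (poly Q x) > 0" by simp
      define r where "r = av (poly Q y) / av (poly Q x)"
      have "r > 1" using less pos by (simp add: r_def)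
      then obtain n where "C < r ^ n" using real_arch_pow by blast
      moreover have "r ^ n \<le> C" using pow[of n] pos by (simp add: r_def power_divide divide_le_eq)
      ultimately show False by simp
    qed
  qed
qed

text \<open>A truncation minus the expected value is a polynomial over \<open>K\<close> in x. It is
  small at x, hence at y by \<open>conjugate_over_av_le\<close>, and the truncation error is uniform
  on the sphere.\<close>

lemma laurent_eval_conjugate:
  assumes c: "vanishing av c" "\<And>n. c n \<in> K"
    and M: "x ^ M = 1" "M > 0" and conj: "conjugate_over K x y"
    and val: "laurent_eval av c (x ^ s) = x ^ t"
  shows "laurent_eval av c (y ^ s) = y ^ t"
proof (rule ccontr)
  assume "\<not> ?thesis"
  then have e0: "av (laurent_eval av c (y ^ s) - y ^ t) > 0" (is "?e > 0") by simp
  have yM: "y ^ M = 1" using conjugate_over_power_eq_1[OF conj M(1)] .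
  have av1: "av x = 1" "av y = 1" using M yM av_eq_1_if_power_eq_1 by blast+
  then have nz: "x \<noteq> 0" "y \<noteq> 0" by auto
  obtain N :: nat where N: "\<And>n. \<bar>n\<bar> > int N \<Longrightarrow> av (c n) < ?e / 2"
    using vanishing_obtain[OF c(1), of "?e / 2"] e0 half_gt_zero by blast
  have approx: "av (laurent_eval av c (z ^ s) - laurent_sum c N (z ^ s)) \<le> ?e / 2" if "av z = 1" for z
    by (rule laurent_eval_approx) (use c N e0 that in \<open>auto simp: av_power intro: less_imp_le\<close>)
  \<comment> \<open>Since z^M = 1 for z = x and z = y, exponents may be reduced modulo
    \<open>M\<close>; this makes the negative ones non-negative.\<close>
  define Q where "Q = (\<Sum>n\<in>{- int N..int N}. monom (c n) (nat ((int s * n) mod int M))) - monom 1 t"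
  have QK: "poly_over K Q" unfolding Q_def
    by (intro poly_over_diff poly_over_sum poly_over_monom c) simp
  have Qz: "poly Q z = laurent_sum c N (z ^ s) - z ^ t" if z: "z ^ M = 1" "z \<noteq> 0" for z
  proof -
    have "z ^ nat ((int s * n) mod int M) = (z ^ s) powi n" for n
    proof -
      have "(z ^ s) powi n = z powi (int s * n)"
        by (metis power_int_mult power_int_of_nat)
      also have "\<dots> = z powi ((int s * n) mod int M + int M * ((int s * n) div int M))" by simp
      also have "\<dots> = z powi ((int s * n) mod int M) * z powi (int M * ((int s * n) div int M))"
        using z(2) by (intro power_int_add) auto
      also have "z powi (int M * ((int s * n) div int M)) = (z ^ M) powi ((int s * n) div int M)"
        by (metis power_int_mult power_int_of_nat)
      also have "z powi ((int s * n) mod int M) * \<dots> = z powi ((int s * n) mod int M)"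
        using z(1) by simp
      also have "\<dots> = z ^ nat ((int s * n) mod int M)" using M(2) by (simp add: power_int_def)
      finally show ?thesis by simp
    qed
    then show ?thesis by (simp add: Q_def laurent_sum_def poly_sum poly_monom)
  qed
  obtain h where h: "min_poly_over K x h" using min_poly_over_exists_root_of_unity[OF M] .
  have "av (poly Q y) \<le> av (poly Q x)"
    by (rule conjugate_over_av_le[OF h conj]) (use av1 QK in auto)
  also have "\<dots> \<le> ?e / 2"
    using approx[OF av1(1)] Qz[OF M(1) nz(1)] val av_diff_commute by metis
  finally have "av (laurent_sum c N (y ^ s) - y ^ t) \<le> ?e / 2" using Qz[OF yM nz(2)] by simp
  then show False
    using av_diff_triangle[of "laurent_eval av c (y ^ s)" "y ^ t" "laurent_sum c N (y ^ s)"]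
      approx[OF av1(2)] e0 by linarith
qed

end

section \<open>Roots of unity\<close>

lemma power_eq_if_cong:
  fixes x :: "'a::monoid_mult"
  assumes "x ^ n = 1" "[a = b] (mod n)"
  shows "x ^ a = x ^ b"
proof -
  have "x ^ k = x ^ (k mod n)" for k
    by (metis assms(1) div_mult_mod_eq power_add power_mult power_one mult_1 mult.commute)
  then show ?thesis using assms(2) unfolding cong_def by metis
qed

lemma power_gcd_eq_1:
  fixes x :: "'a::monoid_mult"
  assumes "x ^ a = 1" "x ^ b = 1"
  shows "x ^ gcd a b = 1"
proof (cases "a = 0")
  case False
  then obtain u v where "a * u = b * v + gcd a b" using bezout_nat by blast
  then have "(x ^ a) ^ u = (x ^ b) ^ v * x ^ gcd a b"
    by (simp flip: power_mult power_add)
  then show ?thesis using assms by simp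
qed (use assms in simp)

definition primitive_root_of_unity :: "nat \<Rightarrow> 'a::field \<Rightarrow> bool" where
  "primitive_root_of_unity n x \<longleftrightarrow> x ^ n = 1 \<and> (\<forall>k. x ^ k = 1 \<longrightarrow> n dvd k)"

lemma primitive_root_of_unity_prime_power:
  fixes x :: "'a::field"
  assumes "prime p" "x ^ (p ^ Suc k) = 1" "x ^ (p ^ k) \<noteq> 1"
  shows "primitive_root_of_unity (p ^ Suc k) x"
  unfolding primitive_root_of_unity_def
proof (intro conjI allI impI assms)
  fix j assume "x ^ j = 1"
  then have 1: "x ^ gcd j (p ^ Suc k) = 1" using assms(2) by (intro power_gcd_eq_1)
  obtain i where i: "i \<le> Suc k" "gcd j (p ^ Suc k) = p ^ i"
    using divides_primepow_nat[OF assms(1), of "gcd j (p ^ Suc k)" "Suc k"] by auto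
  have "i = Suc k"
  proof (rule ccontr)
    assume "i \<noteq> Suc k"
    then have "p ^ i dvd p ^ k" using i(1) by (intro le_imp_power_dvd) simp
    then show False using 1 i(2) assms(3) by (metis dvdE power_mult power_one)
  qed
  then show "p ^ Suc k dvd j" using i(2) by (metis gcd_dvd1)
qed

lemma primitive_root_of_unity_mult:
  fixes x y :: "'a::field"
  assumes x: "primitive_root_of_unity m x" and y: "primitive_root_of_unity n y" and mn: "coprime m n"
  shows "primitive_root_of_unity (m * n) (x * y)"
  unfolding primitive_root_of_unity_def
proof (intro conjI allI impI)
  have x1: "x ^ m = 1" and y1: "y ^ n = 1" using x y by (auto simp: primitive_root_of_unity_def)
  have "(x * y) ^ (m * n) = (x ^ m) ^ n * (y ^ n) ^ m"
    by (simp add: power_mult_distrib mult.commute flip: power_mult)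
  then show "(x * y) ^ (m * n) = 1" by (simp add: x1 y1)
  fix k assume k: "(x * y) ^ k = 1"
  have "(x * y) ^ (k * n) = 1" "(x * y) ^ (k * m) = 1" by (simp_all add: power_mult k)
  moreover have "y ^ (k * n) = 1" by (metis y1 mult.commute power_mult power_one)
  moreover have "x ^ (k * m) = 1" by (metis x1 mult.commute power_mult power_one)
  ultimately have "x ^ (k * n) = 1" "y ^ (k * m) = 1" by (simp_all add: power_mult_distrib)
  then have "m dvd k * n" "n dvd k * m" using x y by (auto simp: primitive_root_of_unity_def)
  then have "m dvd k" "n dvd k"
    using mn by (simp_all add: coprime_dvd_mult_left_iff coprime_commute)
  then show "m * n dvd k" using mn by (rule divides_mult)
qed

lemma card_power_eq_1_le:
  assumes "n > 0"
  shows "finite {x::'a::field. x ^ n = 1}" "card {x::'a::field. x ^ n = 1} \<le> n"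
proof -
  let ?P = "monom 1 n - 1 :: 'a poly"
  have c: "coeff ?P n = 1" using assms by (simp add: coeff_1)
  then have "?P \<noteq> 0" by (metis coeff_0 zero_neq_one)
  moreover have "degree ?P \<le> n" by (intro degree_diff_le) (auto simp: degree_monom_le)
  moreover have "{x. poly ?P x = 0} = {x. x ^ n = 1}" by (simp add: poly_monom)
  ultimately show "finite {x::'a. x ^ n = 1}" "card {x::'a. x ^ n = 1} \<le> n"
    using poly_roots_finite[of ?P] card_poly_roots_bound[of ?P] by auto
qed

lemma card_roots_eq_degree:
  fixes P :: "'a::field poly"
  assumes "alg_closed_field TYPE('a)" "P \<noteq> 0" "\<And>x. poly P x = 0 \<Longrightarrow> poly (pderiv P) x \<noteq> 0"
  shows "card {x. poly P x = 0} = degree P"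
  using assms(2,3)
proof (induction "degree P" arbitrary: P)
  case 0
  then show ?case using card_poly_roots_bound[of P] by simp
next
  case (Suc n)
  then obtain a where a: "poly P a = 0"
    using assms(1) unfolding alg_closed_field_def by (metis zero_less_Suc)
  then obtain U where U: "P = [:-a, 1:] * U" by (auto simp: poly_eq_0_iff_dvd)
  have U0: "U \<noteq> 0" using Suc.prems(1) U by auto
  then have deg: "degree P = Suc (degree U)" unfolding U by (subst degree_mult_eq) auto
  have "pderiv P = [:-a, 1:] * pderiv U + U * pderiv [:-a, 1:]"
    unfolding U by (rule pderiv_mult)
  then have "poly (pderiv P) x = (x - a) * poly (pderiv U) x + poly U x * poly (pderiv [:-a, 1:]) x" for x
    by (simp only: poly_add poly_mult) simp
  then have der: "poly (pderiv P) x = poly U x + (x - a) * poly (pderiv U) x" for x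
    by (simp add: pderiv_pCons)
  have Ua: "poly U a \<noteq> 0" using Suc.prems(2)[OF a] der[of a] by simp
  have "card {x. poly U x = 0} = degree U"
  proof (rule Suc.hyps(1))
    fix x assume x: "poly U x = 0"
    then have "poly P x = 0" by (simp add: U)
    then show "poly (pderiv U) x \<noteq> 0" using Suc.prems(2)[of x] der[of x] x by auto
  qed (use deg Suc.hyps(2) U0 in auto)
  moreover have "{x. poly P x = 0} = insert a {x. poly U x = 0}" by (auto simp: U)
  ultimately show ?case using deg Ua poly_roots_finite[OF U0] by simp
qed

lemma card_power_eq_1:
  assumes "alg_closed_field TYPE('a::field)" "of_nat n \<noteq> (0 :: 'a::field)"
  shows "card {x::'a::field. x ^ n = 1} = n"
proof -
  have n: "n > 0" using assms(2) by (intro gr0I) simp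
  let ?P = "monom 1 n - 1 :: 'a poly"
  have c: "coeff ?P n = 1" using n by (simp add: coeff_1)
  then have P0: "?P \<noteq> 0" by (metis coeff_0 zero_neq_one)
  have "degree ?P \<le> n" by (intro degree_diff_le) (auto simp: degree_monom_le)
  moreover have "degree ?P \<ge> n" by (rule le_degree) (use c in simp)
  ultimately have deg: "degree ?P = n" by simp
  have eq: "{x. poly ?P x = 0} = {x. x ^ n = 1}" by (simp add: poly_monom)
  have "card {x. poly ?P x = 0} = degree ?P"
  proof (rule card_roots_eq_degree[OF assms(1) P0])
    fix x assume "poly ?P x = 0"
    then have "x ^ n = 1" by (simp add: poly_monom)
    then have "x \<noteq> 0" using n by (auto simp: power_0_left)
    moreover have "poly (pderiv ?P) x = of_nat n * x ^ (n - 1)"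
      by (simp add: pderiv_diff pderiv_monom poly_monom)
    ultimately show "poly (pderiv ?P) x \<noteq> 0" using assms(2) by simp
  qed
  then show ?thesis using deg eq by simp
qed

text \<open>Strong induction splits off the full power l^k of a prime l. An element of exact order
  l^k exists because X^(l^k) - 1 is separable and so has more roots than X^(l^(k-1)) - 1.\<close>

lemma primitive_root_of_unity_exists:
  assumes ac: "alg_closed_field TYPE('a::field)" and "of_nat n \<noteq> (0 :: 'a::field)"
  obtains x :: "'a::field" where "primitive_root_of_unity n x"
proof -
  have "\<exists>x::'a. primitive_root_of_unity n x"
    using assms(2)
  proof (induction n rule: less_induct)
    case (less n)
    have n0: "n \<noteq> 0" using less.prems by (intro notI) simp
    show ?case
    proof (cases "n = 1")
      case True
      then show ?thesis by (intro exI[of _ 1]) (simp add: primitive_root_of_unity_def)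
    next
      case False
      then obtain l where l: "prime l" "l dvd n" using prime_factor_nat by blast
      define k where "k = multiplicity l n"
      obtain m where m: "n = l ^ k * m" "\<not> l dvd m"
        using multiplicity_decompose'[of n l] n0 l(1) unfolding k_def by (metis not_prime_unit)
      have k0: "k > 0" using m l by (intro gr0I) auto
      then obtain j where j: "k = Suc j" using gr0_implies_Suc by blast
      have m0: "m > 0" using m n0 by (intro gr0I) auto
      have "l ^ k \<ge> 2 ^ k" using l(1) prime_ge_2_nat by (intro power_mono) auto
      then have "l ^ k > 1" using k0 by (metis less_le_trans one_less_numeral_iff one_less_power semiring_norm(76))
      then have mn: "m < n" using m(1) m0 by simp
      have nz: "of_nat (l ^ k) \<noteq> (0::'a)" "of_nat m \<noteq> (0::'a)" using less.prems m(1) by auto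
      obtain y :: 'a where y: "primitive_root_of_unity m y" using less.IH[OF mn nz(2)] by blast
      have "card {x::'a. x ^ (l ^ j) = 1} < card {x::'a. x ^ (l ^ k) = 1}"
      proof -
        have "card {x::'a. x ^ (l ^ j) = 1} \<le> l ^ j"
          using l(1) by (intro card_power_eq_1_le) (simp add: prime_gt_0_nat)
        also have "\<dots> < l ^ k" using prime_gt_1_nat[OF l(1)] by (simp add: j)
        also have "\<dots> = card {x::'a. x ^ (l ^ k) = 1}" using card_power_eq_1[OF ac nz(1)] by simp
        finally show ?thesis .
      qed
      moreover have "finite {x::'a. x ^ (l ^ j) = 1}"
        using l(1) by (intro card_power_eq_1_le) (simp add: prime_gt_0_nat)
      ultimately have "\<not> {x::'a. x ^ (l ^ k) = 1} \<subseteq> {x::'a. x ^ (l ^ j) = 1}"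
        using card_mono not_le by blast
      then obtain x :: 'a where x: "x ^ (l ^ Suc j) = 1" "x ^ (l ^ j) \<noteq> 1" using j by auto
      have "coprime (l ^ k) m" using l(1) m(2) by (simp add: prime_imp_coprime)
      then have "primitive_root_of_unity n (x * y)"
        unfolding m(1) using primitive_root_of_unity_prime_power[OF l(1) x] y j
        by (intro primitive_root_of_unity_mult) auto
      then show ?thesis by blast
    qed
  qed
  then show ?thesis using that by blast
qed

text \<open>The powers of x already give n distinct roots of X^n - 1, so there are no
  others.\<close>

lemma primitive_root_of_unity_generates:
  fixes x y :: "'a::field"
  assumes x: "primitive_root_of_unity n x" and n: "n > 0" and y: "y ^ n = 1"
  obtains k where "y = x ^ k"
proof -
  have x1: "x ^ n = 1" using x by (simp add: primitive_root_of_unity_def)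
  have x0: "x \<noteq> 0" using x1 n by (auto simp: power_0_left)
  have "inj_on (\<lambda>i. x ^ i) {..<n}"
  proof (rule linorder_inj_onI)
    fix i j :: nat assume ij: "i < j" "i \<in> {..<n}" "j \<in> {..<n}"
    show "x ^ i \<noteq> x ^ j"
    proof
      assume "x ^ i = x ^ j"
      moreover have "x ^ j = x ^ i * x ^ (j - i)" using ij by (simp flip: power_add)
      ultimately have "x ^ (j - i) = 1" using x0 by simp
      then have "n dvd j - i" using x by (simp add: primitive_root_of_unity_def)
      then show False using ij by (auto dest: dvd_imp_le)
    qed
  qed auto
  then have "card ((\<lambda>i. x ^ i) ` {..<n}) = n" by (simp add: card_image)
  moreover have sub: "(\<lambda>i. x ^ i) ` {..<n} \<subseteq> {z. z ^ n = 1}"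
    by (auto simp: x1 power_mult[symmetric] mult.commute[of _ n]) (simp add: power_mult x1)
  ultimately have "(\<lambda>i. x ^ i) ` {..<n} = {z. z ^ n = 1}"
    using card_power_eq_1_le[OF n, where ?'a = 'a] by (intro card_subset_eq) (auto dest: card_mono)
  then show ?thesis using that y by blast
qed

text \<open>X^n - 1 has n distinct roots and the degrees of its factors add up to n, so no factor
  has fewer roots than its degree. The product formula makes |h(y)| the product of the distances |y
  - z|, so |h(y)| < 1 yields a root near y.\<close>

lemma monic_eq_prod_roots:
  fixes h :: "'a::field poly"
  assumes ac: "alg_closed_field TYPE('a)" and n: "of_nat n \<noteq> (0 :: 'a)"
    and h: "lead_coeff h = 1" "h * U = monom 1 n - 1"
  shows "card {x. poly h x = 0} = degree h" "h = (\<Prod>z\<in>{x. poly h x = 0}. [:- z, 1:])"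
proof -
  let ?P = "monom 1 n - 1 :: 'a poly"
  have n0: "n > 0" using n by (intro gr0I) simp
  have c: "coeff ?P n = 1" using n0 by (simp add: coeff_1)
  then have P0: "?P \<noteq> 0" by (metis coeff_0 zero_neq_one)
  have "degree ?P \<le> n" by (intro degree_diff_le) (auto simp: degree_monom_le)
  moreover have "degree ?P \<ge> n" by (rule le_degree) (use c in simp)
  ultimately have deg: "degree ?P = n" by simp
  have nz: "h \<noteq> 0" "U \<noteq> 0" using h(2) P0 by auto
  have fin: "finite {x. poly h x = 0}" "finite {x. poly U x = 0}"
    using poly_roots_finite nz by auto
  have "{x. x ^ n = 1} = {x. poly (h * U) x = 0}" unfolding h(2) by (simp add: poly_monom)
  also have "\<dots> = {x. poly h x = 0} \<union> {x. poly U x = 0}" by auto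
  finally have "n \<le> card {x. poly h x = 0} + card {x. poly U x = 0}"
    using card_power_eq_1[OF ac n] card_Un_le by metis
  moreover have "degree h + degree U = n" using h(2) deg nz degree_mult_eq by metis
  ultimately show cd: "card {x. poly h x = 0} = degree h"
    using card_poly_roots_bound[OF nz(1)] card_poly_roots_bound[OF nz(2)] by linarith
  let ?Z = "{x. poly h x = 0}" and ?H = "\<Prod>z\<in>{x. poly h x = 0}. [:- z, 1:]"
  have degH: "degree ?H = degree h" using cd by (subst degree_prod_sum_eq) auto
  have lcH: "lead_coeff ?H = 1" by (simp add: lead_coeff_prod)
  show "h = ?H"
  proof (rule ccontr)
    assume "h \<noteq> ?H"
    then have ne: "h - ?H \<noteq> 0" by simp
    have "?Z \<subseteq> {x. poly (h - ?H) x = 0}" using fin by (auto simp: poly_prod)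
    then have "card ?Z \<le> card {x. poly (h - ?H) x = 0}"
      using poly_roots_finite[OF ne] by (intro card_mono)
    then have "degree h \<le> degree (h - ?H)" using card_poly_roots_bound[OF ne] cd by simp
    moreover have "degree (h - ?H) \<le> degree h" by (rule degree_diff_le) (use degH in auto)
    ultimately have "lead_coeff (h - ?H) = 0" using h(1) lcH degH by simp
    then show False using ne by (simp only: leading_coeff_0_iff)
  qed
qed

context nonarch_field
begin

lemma integral_mult:
  assumes "\<And>i. av (coeff P i) \<le> 1" "\<And>i. av (coeff Q i) \<le> 1"
  shows "av (coeff (P * Q) i) \<le> 1"
  unfolding coeff_mult
  by (rule av_sum_le) (use assms in \<open>auto simp: av_mult intro!: mult_le_one\<close>)

lemma integral_prod_linear:
  assumes "\<And>z. z \<in> Z \<Longrightarrow> av z \<le> 1"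
  shows "av (coeff (\<Prod>z\<in>Z. [:- z, 1:]) i) \<le> 1"
  using assms
proof (induction Z arbitrary: i rule: infinite_finite_induct)
  case (insert z Z)
  have "av (coeff [:- z, 1:] j) \<le> 1" for j
    using insert.prems by (auto simp: coeff_pCons split: nat.splits)
  then have "av (coeff ([:- z, 1:] * (\<Prod>z\<in>Z. [:- z, 1:])) i) \<le> 1"
    by (rule integral_mult) (use insert in auto)
  then show ?case by (simp only: prod.insert[OF insert.hyps] )
qed (auto simp: coeff_1)

lemma av_power_diff_le:
  assumes "av x \<le> 1" "av y \<le> 1"
  shows "av (x ^ n - y ^ n) \<le> av (x - y)"
  using av_poly_diff_le[of "monom 1 n" 1 x y] assms by (simp add: poly_monom)

end

section \<open>Residue characteristic and the position of roots of unity\<close>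

locale residue_char = nonarch_field +
  fixes p :: nat
  assumes p: "prime p" "av (of_nat p) < 1"
begin

lemma p_gt_0: "p > 0" and p_gt_1: "p > 1"
  using p prime_gt_0_nat prime_gt_1_nat by auto

lemma av_of_nat_coprime:
  assumes "\<not> p dvd m"
  shows "av (of_nat m) = 1"
proof -
  have "coprime m p" using prime_imp_coprime[OF p(1) assms] by (simp add: coprime_commute)
  then obtain x where "[m * x = Suc 0] (mod p)" using cong_solve_coprime_nat by blast
  then have "m * x mod p = 1" using p_gt_1 by (simp add: cong_def)
  then have "m * x = p * (m * x div p) + 1" by (metis mult_div_mod_eq)
  then have "of_nat m * of_nat x = (1 + of_nat p * of_nat (m * x div p) :: 'a)"
    by (metis of_nat_1 of_nat_add of_nat_mult add.commute)
  moreover have "av (of_nat p * of_nat (m * x div p)) < av 1"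
    using p(2) av_of_nat_le_1[of "m * x div p"]
    by (metis av_1 av_mult av_nonneg mult_left_le order_le_less_trans)
  then have "av (1 + of_nat p * of_nat (m * x div p)) = 1" using av_add_eq by fastforce
  ultimately have "av (of_nat m) * av (of_nat x) = 1" by (metis av_mult)
  moreover have "av (of_nat m) * av (of_nat x) \<le> av (of_nat m) * 1"
    using av_of_nat_le_1 by (intro mult_left_mono) auto
  ultimately show ?thesis using av_of_nat_le_1[of m] by linarith
qed

lemma of_nat_coprime_neq_0: "\<not> p dvd m \<Longrightarrow> of_nat m \<noteq> (0 :: 'a)"
  using av_of_nat_coprime by force

text \<open>The inner binomial coefficients are divisible by \<open>p\<close>. The factor |y| is
  kept because \<open>p_power_root_of_unity_lower_bound\<close> needs an error strictly below |p|
  when y = x - 1.\<close>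

lemma av_add_power_p:
  assumes x: "av x \<le> 1" and y: "av y \<le> 1"
  shows "av ((x + y) ^ p - x ^ p - y ^ p) \<le> av (of_nat p) * av y"
proof -
  have "(x + y) ^ p = (\<Sum>k\<le>p. of_nat (p choose k) * x ^ k * y ^ (p - k))"
    by (rule binomial_ring)
  also have "{..p} = insert 0 (insert p {1..<p})" using p_gt_0 by auto
  finally have "(x + y) ^ p - x ^ p - y ^ p
      = (\<Sum>k\<in>{1..<p}. of_nat (p choose k) * x ^ k * y ^ (p - k))"
    using p_gt_0 by simp
  also have "av \<dots> \<le> av (of_nat p) * av y"
  proof (rule av_sum_le)
    fix k assume k: "k \<in> {1..<p}"
    then have "p dvd p choose k" using p by (intro dvd_choose_prime) auto
    then obtain m where m: "p choose k = p * m" by blast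
    have "av (of_nat (p choose k)) \<le> av (of_nat p) * 1"
      unfolding m of_nat_mult av_mult using av_of_nat_le_1 by (intro mult_left_mono) auto
    moreover have "av (x ^ k) \<le> 1" using x by (simp add: av_power power_le_one)
    moreover have "av (y ^ (p - k)) \<le> av y"
    proof -
      have "av y ^ (p - k) \<le> av y ^ 1" using y k by (intro power_decreasing) auto
      then show ?thesis by (simp add: av_power)
    qed
    ultimately have "(av (of_nat (p choose k)) * av (x ^ k)) * av (y ^ (p - k)) \<le> (av (of_nat p) * 1) * av y"
      by (intro mult_mono) auto
    then show "av (of_nat (p choose k) * x ^ k * y ^ (p - k)) \<le> av (of_nat p) * av y"
      by (simp add: av_mult)
  qed simp
  finally show ?thesis .
qed

lemma av_add_power_p_power:
  assumes x: "av x \<le> 1" and y: "av y \<le> 1"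
  shows "av ((x + y) ^ (p ^ k) - x ^ (p ^ k) - y ^ (p ^ k)) < 1"
proof (induction k)
  case (Suc k)
  let ?q = "p ^ k"
  have 1: "av (x ^ ?q) \<le> 1" "av (y ^ ?q) \<le> 1" using x y by (auto simp: av_power power_le_one)
  have "av (x + y) \<le> 1" using av_add[of x y] x y by simp
  then have 2: "av ((x + y) ^ ?q) \<le> 1" by (simp add: av_power power_le_one)
  have 3: "av (x ^ ?q + y ^ ?q) \<le> 1" using av_add[of "x ^ ?q" "y ^ ?q"] 1 by simp
  have "av (((x + y) ^ ?q) ^ p - (x ^ ?q + y ^ ?q) ^ p) < 1"
    using av_power_diff_le[OF 2 3, of p] Suc by (simp add: diff_diff_eq)
  moreover have "av ((x ^ ?q + y ^ ?q) ^ p - ((x ^ ?q) ^ p + (y ^ ?q) ^ p)) < 1"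
  proof -
    have "av (of_nat p) * av (y ^ ?q) \<le> av (of_nat p) * 1" using 1 by (intro mult_left_mono) auto
    then show ?thesis using av_add_power_p[OF 1] p(2) by (simp add: diff_diff_eq)
  qed
  ultimately have "av (((x + y) ^ ?q) ^ p - ((x ^ ?q) ^ p + (y ^ ?q) ^ p)) < 1"
    using av_diff_triangle[of "((x + y) ^ ?q) ^ p" "(x ^ ?q) ^ p + (y ^ ?q) ^ p" "(x ^ ?q + y ^ ?q) ^ p"]
    by linarith
  then show ?case by (simp add: diff_diff_eq mult.commute flip: power_mult)
qed simp

text \<open>Modulo elements of absolute value below 1, the \<open>p ^ k\<close>-th power is
  additive, and its kernel is trivial.\<close>

lemma av_diff_less_1_if_power:
  assumes x: "av x \<le> 1" and y: "av y \<le> 1" and "av (x ^ (p ^ k) - y ^ (p ^ k)) < 1"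
  shows "av (x - y) < 1"
proof -
  let ?q = "p ^ k"
  have xy: "av (x - y) \<le> 1" using av_diff[of x y] x y by simp
  have "av (x ^ ?q - (x - y) ^ ?q - y ^ ?q) < 1"
    using av_add_power_p_power[OF xy y, of k] by simp
  moreover have "(x - y) ^ ?q = (x ^ ?q - y ^ ?q) - (x ^ ?q - (x - y) ^ ?q - y ^ ?q)" by simp
  ultimately have "av ((x - y) ^ ?q) < 1"
    using av_diff[of "x ^ ?q - y ^ ?q" "x ^ ?q - (x - y) ^ ?q - y ^ ?q"] assms(3) by simp
  then show ?thesis using xy by (metis av_power le_less power_one less_irrefl)
qed

lemma av_p_power_root_of_unity:
  assumes "x ^ (p ^ k) = 1"
  shows "av (x - 1) < 1"
proof (rule av_diff_less_1_if_power[of _ _ k])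
  show "av x \<le> 1" using av_eq_1_if_power_eq_1[OF assms] p_gt_0 by simp
qed (use assms in auto)

text \<open>For z = x/y \<noteq> 1 the sum 1 + z + ... + z^(m-1) vanishes, but modulo z - 1 it
  equals m, which is a unit.\<close>

lemma coprime_roots_of_unity_eq:
  assumes m: "\<not> p dvd m" and x: "x ^ m = 1" "y ^ m = 1" and d: "av (x - y) < 1"
  shows "x = y"
proof (rule ccontr)
  assume "x \<noteq> y"
  have m0: "m > 0" using m by (intro gr0I) simp
  have av1: "av x = 1" "av y = 1" using x m0 av_eq_1_if_power_eq_1 by blast+
  have y0: "y \<noteq> 0" using av1 by auto
  define z where "z = x / y"
  have z: "z ^ m = 1" "z \<noteq> 1" using x \<open>x \<noteq> y\<close> y0 by (auto simp: z_def power_divide)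
  have z1: "av (z - 1) < 1"
  proof -
    have "z - 1 = (x - y) / y" using y0 by (simp add: z_def field_simps)
    then show ?thesis using d av1 by (simp add: av_divide)
  qed
  have avz: "av z = 1" using z m0 av_eq_1_if_power_eq_1 by blast
  have s: "(\<Sum>i<m. z ^ i) = 0" using z by (simp add: geometric_sum)
  have "of_nat m = (\<Sum>i<m. 1 - z ^ i) + (\<Sum>i<m. z ^ i)" by (simp add: sum_subtractf)
  then have "av (of_nat m) = av (\<Sum>i<m. 1 - z ^ i)" using s by simp
  also have "\<dots> \<le> av (z - 1)"
  proof (rule av_sum_le)
    fix i show "av (1 - z ^ i) \<le> av (z - 1)"
      using av_power_diff_le[of 1 z i] avz av_diff_commute[of z 1] by simp
  qed simp
  finally show False using av_of_nat_coprime[OF m] z1 by simp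
qed

lemma coprime_roots_of_unity_dist:
  assumes "\<not> p dvd m" "x ^ m = 1" "y ^ m = 1" "x \<noteq> y"
  shows "1 \<le> av (x - y)"
  using coprime_roots_of_unity_eq[OF assms(1-3)] assms(4) by (meson not_le)

text \<open>The source of ramification: |x - 1| tends to 1 as the order p^(k+1) grows. In
  characteristic 0 the (p - 1)-st power of the right-hand side equals |p|; the cruder bound suffices
  and follows by induction along x, x^p.\<close>

lemma p_power_root_of_unity_lower_bound:
  assumes "x ^ (p ^ Suc k) = 1" "x ^ (p ^ k) \<noteq> 1"
  shows "av (of_nat p) \<le> av (x - 1) ^ (p ^ k)"
  using assms
proof (induction k arbitrary: x)
  case 0
  have avx: "av x = 1" using 0 av_eq_1_if_power_eq_1[of x "p ^ Suc 0"] p_gt_0 by simp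
  have s: "(\<Sum>i<p. x ^ i) = 0" using 0 by (simp add: geometric_sum)
  have "of_nat p = (\<Sum>i<p. 1 - x ^ i) + (\<Sum>i<p. x ^ i)" by (simp add: sum_subtractf)
  then have "av (of_nat p) = av (\<Sum>i<p. 1 - x ^ i)" using s by simp
  also have "\<dots> \<le> av (x - 1)"
  proof (rule av_sum_le)
    fix i show "av (1 - x ^ i) \<le> av (x - 1)"
      using av_power_diff_le[of 1 x i] avx av_diff_commute[of x 1] by simp
  qed simp
  finally show ?case by simp
next
  case (Suc k)
  have x1: "av (x - 1) < 1" by (rule av_p_power_root_of_unity[OF Suc.prems(1)])
  have IH: "av (of_nat p) \<le> av (x ^ p - 1) ^ (p ^ k)"
    by (rule Suc.IH) (use Suc.prems in \<open>simp_all flip: power_mult\<close>)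
  have xp1: "av (x ^ p - 1) \<le> 1"
  proof -
    have "av x = 1" using Suc.prems av_eq_1_if_power_eq_1[of x "p ^ Suc (Suc k)"] p_gt_0 by simp
    then show ?thesis using av_diff[of "x ^ p" 1] by (simp add: av_power)
  qed
  have "av (x ^ p - 1) \<le> av (x - 1) ^ p"
  proof (rule ccontr)
    assume gt: "\<not> ?thesis"
    have pne: "x \<noteq> 1" using Suc.prems by auto
    have "av (x ^ p - 1 ^ p - (x - 1) ^ p) \<le> av (of_nat p) * av (x - 1)"
      using av_add_power_p[of 1 "x - 1"] x1 by simp
    then have "av (x ^ p - 1) \<le> max (av ((x - 1) ^ p)) (av (of_nat p) * av (x - 1))"
      using av_add[of "(x - 1) ^ p" "x ^ p - 1 ^ p - (x - 1) ^ p"] by simp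
    then have *: "av (x ^ p - 1) \<le> av (of_nat p) * av (x - 1)" using gt by (simp add: av_power max_def split: if_splits)
    \<comment> \<open>In this case |p| \<le> |x^p - 1| \<le> |p| |x - 1| with |x - 1| < 1. Hence |p|
      = 0 and x^p = 1, against the order of x.\<close>
    have "av (x ^ p - 1) ^ (p ^ k) \<le> av (x ^ p - 1) ^ 1"
      using xp1 p_gt_0 by (intro power_decreasing) auto
    then have "av (of_nat p) \<le> av (of_nat p) * av (x - 1)" using IH * by simp
    then have "av (of_nat p) = 0"
      using x1 by (metis av_nonneg leD le_less mult.right_neutral mult_strict_left_mono)
    then have "av (x ^ p - 1) = 0" using * av_nonneg[of "x ^ p - 1"] by simp
    then have "x ^ (p ^ Suc k) = 1" by (simp add: power_mult)
    then show False using Suc.prems(2) by simp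
  qed
  then have "av (x ^ p - 1) ^ (p ^ k) \<le> (av (x - 1) ^ p) ^ (p ^ k)" by (intro power_mono) auto
  then show ?case using IH by (simp flip: power_mult)
qed

lemma root_of_unity_decompose:
  assumes x: "x ^ (p ^ N * m) = (1::'a)" and m: "\<not> p dvd m"
  obtains a b where "x = x ^ a * x ^ b" "(x ^ a) ^ (p ^ N) = 1" "(x ^ b) ^ m = 1"
    "[a = 1] (mod p ^ N)" "[b = 0] (mod p ^ N)" "[a = 0] (mod m)" "[b = 1] (mod m)"
proof -
  have cop: "coprime (p ^ N) m" using p m by (simp add: prime_imp_coprime)
  obtain a where a: "[a = 1] (mod p ^ N)" "[a = 0] (mod m)"
    using binary_chinese_remainder_nat[OF cop] by blast
  obtain b where b: "[b = 0] (mod p ^ N)" "[b = 1] (mod m)"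
    using binary_chinese_remainder_nat[OF cop] by blast
  have "[a + b = 1] (mod p ^ N)" "[a + b = 1] (mod m)"
    using cong_add[OF a(1) b(1)] cong_add[OF a(2) b(2)] by simp_all
  then have "[a + b = 1] (mod p ^ N * m)" using cop by (rule coprime_cong_mult_nat)
  then have "x ^ (a + b) = x ^ 1" by (rule power_eq_if_cong[OF x])
  moreover obtain a' where "a = m * a'" using a(2) by (auto simp: cong_0_iff)
  then have "(x ^ a) ^ (p ^ N) = (x ^ (p ^ N * m)) ^ a'" by (simp add: ac_simps flip: power_mult)
  moreover obtain b' where "b = p ^ N * b'" using b(1) by (auto simp: cong_0_iff)
  then have "(x ^ b) ^ m = (x ^ (p ^ N * m)) ^ b'" by (simp add: ac_simps flip: power_mult)
  ultimately show ?thesis using that[of a b] a b x by (simp add: power_add)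
qed

end

section \<open>Conjugates with large \<open>p\<close>-part\<close>

lemma pigeonhole_fibre:
  assumes "f \<in> A \<rightarrow> B" "finite A" "finite B" "card B > 0" "card B * J \<le> card A"
  obtains b where "b \<in> B" "J \<le> card {a \<in> A. f a = b}"
proof -
  have "B \<noteq> {}" using assms(4) by auto
  then obtain b where b: "b \<in> B" "card A \<le> card (f -` {b} \<inter> A) * card B"
    using pigeonhole_card[OF assms(1-3)] by blast
  moreover have "f -` {b} \<inter> A = {a \<in> A. f a = b}" by auto
  ultimately have "card A \<le> card B * card {a \<in> A. f a = b}" by (simp add: mult.commute)
  with assms(5) have "card B * J \<le> card B * card {a \<in> A. f a = b}" by (rule order_trans)
  then have "J \<le> card {a \<in> A. f a = b}" using assms(4) by (metis mult_le_cancel1)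
  then show ?thesis by (rule that[OF b(1)])
qed

lemma roots_of_unity_common_exponent:
  assumes "finite X" "X \<subseteq> (roots_of_unity :: 'a::field set)"
  obtains n where "n > 0" "\<And>x. x \<in> X \<Longrightarrow> x ^ n = 1"
proof -
  have "\<exists>n>0. \<forall>x\<in>X. x ^ n = 1"
    using assms
  proof (induction X rule: finite_induct)
    case (insert x X)
    then obtain n where n: "n > 0" "\<forall>x\<in>X. x ^ n = 1" by auto
    obtain k where k: "k > 0" "x ^ k = 1" using insert.prems by (auto simp: roots_of_unity_def)
    have "y ^ (k * n) = 1" if "y \<in> insert x X" for y
    proof (cases "y = x")
      case True then show ?thesis using k by (simp add: power_mult)
    next
      case False
      then have "y ^ (n * k) = 1" using that n(2) by (simp add: power_mult)
      then show ?thesis by (simp add: mult.commute)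
    qed
    then show ?case using n k by (intro exI[of _ "k * n"]) simp
  qed auto
  then show ?thesis using that by blast
qed

text \<open>The finite residue field is represented here only by its characteristic;
  \<open>local_field_frobenius\<close> adds the rest.\<close>

locale local_field_closure = complete_subfield av K + residue_char av p
  for av :: "'a::field \<Rightarrow> real" and K and p +
  fixes \<pi> :: 'a
  assumes alg_closed: "alg_closed_field TYPE('a)"
    and \<pi>: "\<pi> \<in> K" "0 < av \<pi>" "av \<pi> < 1"
    and discrete: "\<And>x. x \<in> K \<Longrightarrow> x \<noteq> 0 \<Longrightarrow> \<exists>k::int. av x = av \<pi> powi k"
begin

text \<open>Both factors of X^n - 1 are products of X - z over roots of unity z, hence integral.
  Integrality of the cofactor \<open>U\<close> later turns a lower bound for |\<rho>^m - 1| into one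
  for |h(\<rho>)|.\<close>

lemma min_poly_root_of_unity:
  assumes h: "min_poly_over K x h" and x: "x ^ n = 1" and n: "of_nat n \<noteq> (0 :: 'a)"
  obtains U where "monom 1 n - 1 = h * U" "\<And>i. av (coeff h i) \<le> 1" "\<And>i. av (coeff U i) \<le> 1"
    "card {z. poly h z = 0} = degree h" "h = (\<Prod>z\<in>{z. poly h z = 0}. [:- z, 1:])"
    "\<And>z. poly h z = 0 \<Longrightarrow> z ^ n = 1" "degree h > 0"
proof -
  let ?P = "monom 1 n - 1 :: 'a poly"
  have n0: "n > 0" using n by (intro gr0I) simp
  have c: "coeff ?P n = 1" using n0 by (simp add: coeff_1)
  have "degree ?P \<le> n" by (intro degree_diff_le) (auto simp: degree_monom_le)
  moreover have "degree ?P \<ge> n" by (rule le_degree) (use c in simp)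
  ultimately have lc: "lead_coeff ?P = 1" using c by simp
  have "poly_over K ?P" by (intro poly_over_diff poly_over_monom) simp_all
  then obtain U where U: "?P = h * U"
    using min_poly_overE[OF h, of ?P] x by (auto simp: poly_monom)
  have hm: "lead_coeff h = 1" "poly h x = 0" using h by (auto simp: min_poly_over_def)
  then have Um: "lead_coeff U = 1" using lc unfolding U by (simp add: lead_coeff_mult)
  have rh: "z ^ n = 1" if "poly h z = 0 \<or> poly U z = 0" for z
  proof -
    have "poly ?P z = 0" unfolding U using that by auto
    then show ?thesis by (simp add: poly_monom)
  qed
  note h' = monic_eq_prod_roots[OF alg_closed n hm(1) U[symmetric]]
  have "U * h = ?P" using U by (simp add: mult.commute)
  note U' = monic_eq_prod_roots[OF alg_closed n Um this]
  have av1: "av z \<le> 1" if "z ^ n = 1" for z using av_eq_1_if_power_eq_1[OF that n0] by simp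
  have ih: "av (coeff h i) \<le> 1" for i
    by (subst h'(2), rule integral_prod_linear) (use rh av1 in auto)
  have iU: "av (coeff U i) \<le> 1" for i
    by (subst U'(2), rule integral_prod_linear) (use rh av1 in auto)
  have "degree h > 0"
  proof (rule ccontr)
    assume "\<not> ?thesis"
    then obtain a where a: "h = [:a:]" by (metis degree_eq_zeroE gr0I)
    then show False using hm by simp
  qed
  then show ?thesis using that[OF U ih iU h'] rh by blast
qed

text \<open>\<open>K(\<omega>)\<close> is unramified: the conjugates of \<open>\<omega>\<close> have distinct reductions, so
  the value at \<open>\<omega>\<close> of a polynomial of small degree has its Gauss norm as absolute value.\<close>
lemma unramified_value:
  assumes \<omega>: "\<omega> ^ m = 1" "\<not> p dvd m" and h: "min_poly_over K \<omega> h"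
    and Q: "poly_over K Q" "\<forall>i\<ge>degree h. coeff Q i = 0" "Q \<noteq> 0"
    and x: "av x \<le> 1" "av (x - \<omega>) < 1"
  shows "\<exists>k::int. av (poly Q x) = av \<pi> powi k"
proof -
  have m0: "m > 0" using \<omega>(2) by (intro gr0I) simp
  obtain U where U: "card {z. poly h z = 0} = degree h"
    "\<And>z. poly h z = 0 \<Longrightarrow> z ^ m = 1" "degree h > 0"
    using min_poly_root_of_unity[OF h \<omega>(1) of_nat_coprime_neq_0[OF \<omega>(2)]] by metis
  obtain i where i: "coeff Q i \<noteq> 0" "\<And>j. av (coeff Q j) \<le> av (coeff Q i)"
    using poly_argmax[OF Q(3)] by blast
  have av\<omega>: "av \<omega> = 1" using av_eq_1_if_power_eq_1[OF \<omega>(1) m0] .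
  have "av (poly Q x) = av (coeff Q i)"
  proof (rule ccontr)
    assume "av (poly Q x) \<noteq> av (coeff Q i)"
    moreover have "av (poly Q x) \<le> av (coeff Q i)" by (rule av_poly_le[OF i(2) x(1)])
    ultimately have 1: "av (poly Q x) < av (coeff Q i)" by simp
    have "av (poly Q x - poly Q \<omega>) \<le> av (coeff Q i) * av (x - \<omega>)"
      by (rule av_poly_diff_le[OF i(2)]) (use x av\<omega> in auto)
    also have "\<dots> < av (coeff Q i) * 1" using x(2) i(1) by (intro mult_strict_left_mono) auto
    finally have "av (poly Q \<omega>) < av (coeff Q i)"
      using 1 av_diff[of "poly Q x" "poly Q x - poly Q \<omega>"] by simp
    \<comment> \<open>At every conjugate of \<omega> the value of \<open>Q\<close> is at most
      |Q(\<omega>)|. There are more conjugates than \<open>degree Q\<close>, at mutual distance at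
      least 1, so the Gauss norm obeys the same bound.\<close>
    moreover have "av (coeff Q i) \<le> av (poly Q \<omega>)"
    proof (rule coeffs_le_if_values_le[of "{z. poly h z = 0}"])
      show "finite {z. poly h z = 0}" using U(1,3) card_gt_0_iff by metis
      show "degree Q < card {z. poly h z = 0}"
        using U(1) Q(2) Q(3) by (metis leading_coeff_0_iff not_le)
    next
      fix z assume "z \<in> {z. poly h z = 0}"
      then have z: "poly h z = 0" by simp
      then show z1: "av z = 1" using U(2) m0 av_eq_1_if_power_eq_1 by blast
      show "av (poly Q z) \<le> av (poly Q \<omega>)"
        by (rule conjugate_over_av_le[OF h conjugate_over_if_root[OF h z]]) (use z1 av\<omega> Q in auto)
    next
      fix y z assume "y \<in> {z. poly h z = 0}" "z \<in> {z. poly h z = 0}" "y \<noteq> z"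
      then show "1 \<le> av (y - z)" using U(2) coprime_roots_of_unity_dist[OF \<omega>(2)] by blast
    qed
    ultimately show False by simp
  qed
  then show ?thesis using discrete[of "coeff Q i"] i(1) Q(1) by (simp add: poly_over_def)
qed

lemma powi_between:
  assumes "b < 1" "av \<pi> < b"
  shows "b \<noteq> av \<pi> powi k"
proof
  assume eq: "b = av \<pi> powi k"
  show False
  proof (cases "k \<le> 0")
    case True
    then have "1 \<le> inverse (av \<pi>) ^ nat (- k)"
      using \<pi> by (intro one_le_power) (simp add: one_le_inverse)
    then have "1 \<le> av \<pi> powi k" using True by (cases "k = 0") (simp_all add: power_int_def)
    then show False using eq assms by simp
  next
    case False
    then have "av \<pi> ^ nat k \<le> av \<pi> ^ 1" using \<pi> by (intro power_decreasing) auto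
    then show False using False eq assms by (simp add: power_int_def)
  qed
qed

text \<open>In the \<open>h\<close>-adic expansion of \<open>P\<close> the summands have distinct absolute values at \<open>x\<close>.\<close>
lemma totally_ramified_value:
  assumes \<omega>: "\<omega> ^ m = 1" "\<not> p dvd m" and h: "min_poly_over K \<omega> h"
    and x: "av x \<le> 1" "av (x - \<omega>) < 1"
    and r: "poly h x \<noteq> 0" "av (poly h x) < 1"
    and J: "\<And>i. 0 < i \<Longrightarrow> i < J \<Longrightarrow> av \<pi> < av (poly h x) ^ i"
    and P: "poly_over K P" "P \<noteq> 0" "degree P < degree h * J"
  shows "\<exists>k::int. \<exists>j<J. av (poly P x) = av \<pi> powi k * av (poly h x) ^ j"
  using J P
proof (induction J arbitrary: P)
  case 0
  then show ?case by simp
next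
  case (Suc J)
  let ?r = "av (poly h x)"
  have hK: "poly_over K h" "lead_coeff h = 1" using h by (auto simp: min_poly_over_def)
  then have h0: "h \<noteq> 0" by auto
  obtain U R where UR: "poly_over K U" "poly_over K R" "P = h * U + R" "\<forall>i\<ge>degree h. coeff R i = 0"
    using division_by_monic[OF hK Suc.prems(2)] by blast
  have Rval: "\<exists>k::int. av (poly R x) = av \<pi> powi k" if "R \<noteq> 0"
    by (rule unramified_value[OF \<omega> h UR(2,4) that x])
  show ?case
  proof (cases "U = 0")
    case True
    then have "P = R" using UR(3) by simp
    then show ?thesis using Rval Suc.prems(3) by (metis mult.right_neutral power_0 zero_less_Suc)
  next
    case False
    have dhU: "degree (h * U) = degree h + degree U" using h0 False by (rule degree_mult_eq)
    have "degree P = degree h + degree U"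
    proof (cases "R = 0")
      case True then show ?thesis using UR(3) dhU by simp
    next
      case R0: False
      then have "degree R < degree h" using UR(4) by (metis leading_coeff_0_iff not_le)
      then show ?thesis unfolding UR(3) using dhU by (subst degree_add_eq_left) auto
    qed
    then have "degree U < degree h * J" using Suc.prems(4) by simp
    then obtain k j where kj: "j < J" "av (poly U x) = av \<pi> powi k * ?r ^ j"
      using Suc.IH[OF _ UR(1) False] Suc.prems(1) by force
    then have hUval: "av (poly (h * U) x) = av \<pi> powi k * ?r ^ Suc j" by (simp add: av_mult)
    show ?thesis
    proof (cases "R = 0")
      case True
      then show ?thesis using UR(3) hUval kj(1) by (metis Suc_less_eq add.right_neutral)
    next
      case R0: False
      then obtain l where l: "av (poly R x) = av \<pi> powi l" using Rval by blast
      \<comment> \<open>Equality would make a power |h(x)|^(j+1) an integral power of |\<pi>| lying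
        strictly between |\<pi>| and 1.\<close>
      have ne: "av (poly (h * U) x) \<noteq> av (poly R x)"
      proof
        assume "av (poly (h * U) x) = av (poly R x)"
        then have "?r ^ Suc j = av \<pi> powi (l - k)"
          using hUval l \<pi> by (simp add: power_int_diff field_simps)
        moreover have "?r ^ Suc j < 1" using r by (intro power_Suc_less_one) auto
        moreover have "av \<pi> < ?r ^ Suc j" by (rule Suc.prems(1)) (use kj(1) in auto)
        ultimately show False using powi_between by blast
      qed
      have Px: "poly P x = poly (h * U) x + poly R x" by (simp add: UR(3))
      show ?thesis
      proof (cases "av (poly R x) < av (poly (h * U) x)")
        case True
        then have "av (poly P x) = av (poly (h * U) x)" unfolding Px by (rule av_add_eq)
        then show ?thesis using hUval kj(1) by (metis Suc_less_eq)
      next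
        case False
        then have "av (poly (h * U) x) < av (poly R x)" using ne by simp
        then have "av (poly P x) = av (poly R x)" unfolding Px
          by (subst add.commute) (rule av_add_eq)
        then show ?thesis using l by (metis mult.right_neutral power_0 zero_less_Suc)
      qed
    qed
  qed
qed

text \<open>Over \<open>K(\<omega>)\<close>, with \<open>\<omega>\<close> the prime-to-\<open>p\<close> part of \<open>\<rho>\<close>, the ramification is large because
  \<open>|\<rho> - \<omega>|\<close> is close to 1 for large \<open>N\<close>; conjugates are then distributed over the
  conjugates of \<open>\<omega>\<close>. The loss \<open>c\<close> depends only on \<open>K\<close>.\<close>
lemma many_conjugates:
  assumes p0: "of_nat p \<noteq> (0 :: 'a)"
    and c: "av \<pi> ^ (p ^ c) \<le> av (of_nat p)" "Suc c \<le> N"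
    and \<rho>: "\<rho> ^ (p ^ N * m) = 1" "\<rho> ^ (p ^ (N - 1) * m) \<noteq> 1" and m: "\<not> p dvd m"
  obtains \<omega> where "\<omega> ^ m = 1"
    "p ^ (N - Suc c) \<le> card {z. z ^ (p ^ N) = 1 \<and> conjugate_over K \<rho> (\<omega> * z)}"
proof -
  let ?M = "p ^ N * m" and ?J = "p ^ (N - Suc c)"
  have m0: "m > 0" using m by (intro gr0I) simp
  have M0: "?M > 0" using m0 p_gt_0 by simp
  have m1: "of_nat m \<noteq> (0 :: 'a)" using of_nat_coprime_neq_0[OF m] .
  have M1: "of_nat ?M \<noteq> (0 :: 'a)" using p0 m1 by simp
  obtain a b where ab: "\<rho> = \<rho> ^ a * \<rho> ^ b" "(\<rho> ^ a) ^ (p ^ N) = 1" "(\<rho> ^ b) ^ m = 1"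
    using root_of_unity_decompose[OF \<rho>(1) m] by metis
  define \<omega> where "\<omega> = \<rho> ^ b"
  have av\<rho>: "av \<rho> = 1" by (rule av_eq_1_if_power_eq_1[OF \<rho>(1) M0])
  have \<omega>m: "\<omega> ^ m = 1" using ab by (simp add: \<omega>_def)
  have av\<omega>: "av \<omega> = 1" by (rule av_eq_1_if_power_eq_1[OF \<omega>m m0])
  have near: "av (\<rho> - \<omega>) < 1"
  proof -
    have "\<rho> - \<omega> = (\<rho> ^ a - 1) * \<omega>" using ab(1) by (simp add: \<omega>_def algebra_simps)
    then show ?thesis using av_p_power_root_of_unity[OF ab(2)] av\<omega> by (simp add: av_mult)
  qed
  obtain h where h: "min_poly_over K \<omega> h" using min_poly_over_exists_root_of_unity[OF \<omega>m m0] .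
  have hK: "poly_over K h" "poly h \<omega> = 0" using h by (auto simp: min_poly_over_def)
  obtain U where U: "monom 1 m - 1 = h * U" "\<And>i. av (coeff h i) \<le> 1" "\<And>i. av (coeff U i) \<le> 1"
    "card {z. poly h z = 0} = degree h" "h = (\<Prod>z\<in>{z. poly h z = 0}. [:- z, 1:])"
    "\<And>z. poly h z = 0 \<Longrightarrow> z ^ m = 1" "degree h > 0"
    using min_poly_root_of_unity[OF h \<omega>m m1] by metis
  let ?Z = "{z. poly h z = 0}"
  have finZ: "finite ?Z" using U(4,7) card_gt_0_iff by metis
  define r where "r = av (poly h \<rho>)"
  have r1: "r < 1"
  proof -
    have "av (poly h \<rho> - poly h \<omega>) \<le> 1 * av (\<rho> - \<omega>)"
      by (rule av_poly_diff_le[OF U(2)]) (use av\<rho> av\<omega> in auto)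
    then show ?thesis using near hK(2) by (simp add: r_def)
  qed
  \<comment> \<open>From X^m - 1 = h U with \<open>U\<close> integral at \<rho>.\<close>
  have rge: "av (\<rho> ^ m - 1) \<le> r"
  proof -
    have "poly (monom 1 m - 1) \<rho> = poly h \<rho> * poly U \<rho>" by (simp only: U(1) poly_mult)
    then have "\<rho> ^ m - 1 = poly h \<rho> * poly U \<rho>" by (simp add: poly_monom)
    then have "av (\<rho> ^ m - 1) = r * av (poly U \<rho>)" by (simp add: r_def av_mult)
    also have "\<dots> \<le> r * 1"
      using av_poly_le[OF U(3), of \<rho>] av\<rho> by (intro mult_left_mono) (auto simp: r_def)
    finally show ?thesis by simp
  qed
  obtain N' where N': "N = Suc N'" using c(2) by (cases N) auto
  have "av (of_nat p) \<le> av (\<rho> ^ m - 1) ^ (p ^ N')"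
    by (rule p_power_root_of_unity_lower_bound)
       (use \<rho> N' in \<open>simp_all add: mult.commute flip: power_mult\<close>)
  also have "\<dots> \<le> r ^ (p ^ N')" using rge by (intro power_mono) auto
  finally have rp: "av (of_nat p) \<le> r ^ (p ^ N')" .
  have r0: "r > 0"
  proof (rule ccontr)
    assume "\<not> r > 0"
    then have "r = 0" by (simp add: r_def)
    then have "av (of_nat p) \<le> 0" using rp p_gt_0 by (simp add: power_0_left)
    then have "av (of_nat p) = 0" using av_nonneg[of "of_nat p"] by linarith
    then show False using p0 by simp
  qed
  \<comment> \<open>\<open>?J\<close> is chosen so that its product with p^c is p^(N-1), the
    exponent in the lower bound for |\<rho>^m - 1|. The constant c absorbs the ramification of
    \<open>K\<close> itself.\<close>
  have rJ: "av \<pi> \<le> r ^ ?J"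
  proof (rule ccontr)
    assume "\<not> ?thesis"
    then have "(r ^ ?J) ^ (p ^ c) < av \<pi> ^ (p ^ c)"
      using r0 p_gt_0 by (intro power_strict_mono) auto
    moreover have "?J * p ^ c = p ^ N'" using c(2) N' by (simp flip: power_add)
    ultimately show False using rp c(1) by (simp flip: power_mult)
  qed
  have J: "av \<pi> < r ^ i" if "0 < i" "i < ?J" for i
    using rJ power_strict_decreasing[OF that(2) r0 r1] by simp
  obtain P where P: "min_poly_over K \<rho> P" using min_poly_over_exists_root_of_unity[OF \<rho>(1) M0] .
  have PK: "poly_over K P" "P \<noteq> 0" "poly P \<rho> = 0" using P by (auto simp: min_poly_over_def)
  obtain V where V: "card {z. poly P z = 0} = degree P" "\<And>z. poly P z = 0 \<Longrightarrow> z ^ ?M = 1"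
    "degree P > 0"
    using min_poly_root_of_unity[OF P \<rho>(1) M1] by metis
  let ?Y = "{z. poly P z = 0}"
  have finY: "finite ?Y" using V(1,3) card_gt_0_iff by metis
  \<comment> \<open>Non-zero polynomials of smaller degree have non-zero absolute value at \<rho>,
    whereas P(\<rho>) = 0.\<close>
  have degP: "degree h * ?J \<le> degree P"
  proof (rule ccontr)
    assume "\<not> ?thesis"
    then have "\<exists>k::int. \<exists>j<?J. av (poly P \<rho>) = av \<pi> powi k * av (poly h \<rho>) ^ j"
      by (intro totally_ramified_value[OF \<omega>m m h _ near _ _ _ PK(1,2)])
         (use av\<rho> r0 r1 J in \<open>auto simp: r_def\<close>)
    then show False using PK(3) \<pi>(2) r0 by (auto simp: r_def)
  qed
  \<comment> \<open>|h(y)| \<le> |h(\<rho>)| < 1 is the product of the distances from y to the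
    conjugates of \<omega>, so one of them is below 1.\<close>
  have "\<exists>z\<in>?Z. av (y - z) < 1" if "y \<in> ?Y" for y
  proof (rule ccontr)
    assume "\<not> ?thesis"
    then have "1 \<le> (\<Prod>z\<in>?Z. av (y - z))" by (intro prod_ge_1) auto
    also have "\<dots> = av (poly h y)" by (subst (2) U(5)) (simp add: poly_prod av_prod)
    also have "\<dots> \<le> av (poly h \<rho>)"
    proof (rule conjugate_over_av_le[OF P conjugate_over_if_root[OF P] _ _ hK(1)])
      show "av y \<le> 1" using V(2)[of y] that av_eq_1_if_power_eq_1[OF _ M0, of y] by simp
    qed (use that av\<rho> in auto)
    finally show False using r1 by (simp add: r_def)
  qed
  then obtain g where g: "\<And>y. y \<in> ?Y \<Longrightarrow> g y \<in> ?Z \<and> av (y - g y) < 1" by metis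
  obtain z where z: "z \<in> ?Z" "?J \<le> card {y \<in> ?Y. g y = z}"
    by (rule pigeonhole_fibre[of g ?Y ?Z ?J]) (use g finY finZ U(4,7) V(1) degP in auto)
  have zm: "z ^ m = 1" using z U(6) by simp
  then have avz: "av z = 1" using av_eq_1_if_power_eq_1 m0 by blast
  then have z0: "z \<noteq> 0" by auto
  let ?T = "{w. w ^ (p ^ N) = 1 \<and> conjugate_over K \<rho> (z * w)}"
  have "(\<lambda>y. y / z) ` {y \<in> ?Y. g y = z} \<subseteq> ?T"
  proof safe
    fix y assume y: "poly P y = 0" "z = g y"
    define w where "w = y / z"
    have "w - 1 = (y - z) / z" using z0 by (simp add: w_def field_simps)
    then have w1: "av (w - 1) < 1" using g[of y] y avz by (simp add: av_divide)
    have "z ^ ?M = (z ^ m) ^ (p ^ N)" by (simp add: mult.commute flip: power_mult)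
    then have wM: "w ^ ?M = 1"
      using V(2)[OF y(1)] zm by (simp add: w_def power_divide)
    have avw: "av w = 1" by (rule av_eq_1_if_power_eq_1[OF wM M0])
    \<comment> \<open>w is close to 1, so the m-th root of unity w^(p^N) is close to 1 and therefore
      equal to it.\<close>
    have "w ^ (p ^ N) = 1"
    proof (rule coprime_roots_of_unity_eq[OF m])
      show "(w ^ (p ^ N)) ^ m = 1" using wM by (simp add: power_mult)
      show "av (w ^ (p ^ N) - 1) < 1"
        using av_power_diff_le[of w 1 "p ^ N"] avw w1 by simp
    qed simp
    then show "(y / g y) ^ (p ^ N) = 1" using y by (simp add: w_def)
    show "conjugate_over K \<rho> (g y * (y / g y))"
      using conjugate_over_if_root[OF P y(1)] z0 y(2) by simp
  qed
  moreover have "finite ?T"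
    by (rule finite_subset[OF _ card_power_eq_1_le(1)[of "p ^ N", where ?'a = 'a]]) (use p_gt_0 in auto)
  moreover have "inj_on (\<lambda>y. y / z) {y \<in> ?Y. g y = z}" using z0 by (auto simp: inj_on_def)
  ultimately have "card {y \<in> ?Y. g y = z} \<le> card ?T" by (intro card_inj_on_le)
  then show ?thesis using that[OF zm] z(2) by simp
qed

text \<open>With j = c + i + 2, raising to the power p^j sends the p^(N-c-1) elements from
  \<open>many_conjugates\<close> to at most p^(N-j) values, so some fibre has at least p^(i+1)
  elements. Quotients within it are killed by p^j, and they are too many to be all killed by
  p^i.\<close>

lemma conjugate_pair:
  assumes p0: "of_nat p \<noteq> (0 :: 'a)"
    and c: "av \<pi> ^ (p ^ c) \<le> av (of_nat p)" "Suc (Suc (c + i)) \<le> N"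
    and \<rho>: "\<rho> ^ (p ^ N * m) = 1" "\<rho> ^ (p ^ (N - 1) * m) \<noteq> 1" and m: "\<not> p dvd m"
  obtains \<rho>' \<delta> where "conjugate_over K \<rho> \<rho>'" "conjugate_over K \<rho> (\<delta> * \<rho>')"
    "\<delta> ^ (p ^ Suc (Suc (c + i))) = 1" "\<delta> ^ (p ^ i) \<noteq> 1"
proof -
  let ?j = "Suc (Suc (c + i))"
  obtain \<omega> where \<omega>: "\<omega> ^ m = 1"
    "p ^ (N - Suc c) \<le> card {z. z ^ (p ^ N) = 1 \<and> conjugate_over K \<rho> (\<omega> * z)}"
    by (rule many_conjugates[OF p0 c(1) _ \<rho> m]) (use c(2) in auto)
  let ?T = "{z. z ^ (p ^ N) = 1 \<and> conjugate_over K \<rho> (\<omega> * z)}"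
    and ?B = "{w::'a. w ^ (p ^ (N - ?j)) = 1}"
  have pp: "p ^ k > 0" for k using p_gt_0 by simp
  have finT: "finite ?T"
    by (rule finite_subset[OF _ card_power_eq_1_le(1)[OF pp, of N, where ?'a = 'a]]) auto
  obtain b where b: "b \<in> ?B" "p ^ Suc i \<le> card {z \<in> ?T. z ^ (p ^ ?j) = b}"
  proof (rule pigeonhole_fibre[of "\<lambda>z. z ^ (p ^ ?j)" ?T ?B "p ^ Suc i"])
    have "p ^ ?j * p ^ (N - ?j) = p ^ N" using c(2) by (simp only: le_add_diff_inverse flip: power_add)
    then have "(z ^ (p ^ ?j)) ^ (p ^ (N - ?j)) = z ^ (p ^ N)" for z :: 'a
      by (metis power_mult)
    then show "(\<lambda>z. z ^ (p ^ ?j)) \<in> ?T \<rightarrow> ?B" by (simp only: Pi_iff mem_Collect_eq) blast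
    show "finite ?B" using card_power_eq_1_le(1)[OF pp] .
    then show "card ?B > 0" by (auto simp: card_gt_0_iff intro!: exI[of _ 1])
    have "card ?B * p ^ Suc i \<le> p ^ (N - ?j) * p ^ Suc i"
      using card_power_eq_1_le(2)[OF pp] by (intro mult_right_mono) auto
    also have "\<dots> = p ^ (N - ?j + Suc i)" by (rule power_add[symmetric])
    also have "N - ?j + Suc i = N - Suc c" using c(2) by simp
    finally show "card ?B * p ^ Suc i \<le> card ?T" using \<omega>(2) by simp
  qed (use finT in auto)
  let ?F = "{z \<in> ?T. z ^ (p ^ ?j) = b}"
  have "card ?F > 0" using b(2) pp[of "Suc i"] by linarith
  then obtain z where z: "z \<in> ?F" by (metis (no_types, lifting) card_gt_0_iff ex_in_conv)
  then have "z ^ (p ^ N) = 1" by simp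
  then have z0: "z \<noteq> 0" using p_gt_0 by (auto simp: power_0_left)
  have "\<not> (\<lambda>y. y / z) ` ?F \<subseteq> {w. w ^ (p ^ i) = 1}"
  proof
    assume "(\<lambda>y. y / z) ` ?F \<subseteq> {w. w ^ (p ^ i) = 1}"
    then have "card ((\<lambda>y. y / z) ` ?F) \<le> card {w::'a. w ^ (p ^ i) = 1}"
      by (intro card_mono card_power_eq_1_le(1)[OF pp])
    also have "\<dots> \<le> p ^ i" by (rule card_power_eq_1_le(2)[OF pp])
    also have "\<dots> < p ^ Suc i" using p_gt_1 by simp
    also have "p ^ Suc i \<le> card ?F" by (rule b(2))
    also have "card ?F = card ((\<lambda>y. y / z) ` ?F)"
      using z0 by (intro card_image[symmetric]) (auto simp: inj_on_def)
    finally show False by simp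
  qed
  then obtain y where y: "y \<in> ?F" "(y / z) ^ (p ^ i) \<noteq> 1" by blast
  show ?thesis
  proof (rule that[of "\<omega> * z" "y / z"])
    have yb: "y ^ (p ^ ?j) = b" "z ^ (p ^ ?j) = b" using y z by auto
    moreover have "b \<noteq> 0" using b(1) p_gt_0 by (auto simp: power_0_left)
    ultimately show "(y / z) ^ (p ^ ?j) = 1" by (simp only: power_divide) simp
    show "conjugate_over K \<rho> (y / z * (\<omega> * z))" using y(1) z0 by (simp add: mult.commute)
  qed (use y z in auto)
qed

text \<open>The series with coefficients c_n (a^n - b) has infinitely many zeros on the sphere,
  hence is zero.\<close>

lemma laurent_eval_proportional:
  assumes c: "vanishing av c" and X: "infinite X" and a: "av a = 1"
    and x: "\<And>x. x \<in> X \<Longrightarrow> av x = 1"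
      "\<And>x. x \<in> X \<Longrightarrow> laurent_eval av c (a * x) = b * laurent_eval av c x"
    and k: "c k \<noteq> 0"
  shows "a powi k = b"
proof -
  define d where "d = (\<lambda>n. c n * (a powi n - b))"
  have d: "vanishing av d"
  proof (rule vanishing_le[OF c, of _ "max 1 (av b)"])
    fix n
    have "av (a powi n - b) \<le> max 1 (av b)"
      using av_diff[of "a powi n" b] a by (simp add: av_powi)
    then have "av (c n) * av (a powi n - b) \<le> av (c n) * max 1 (av b)"
      by (intro mult_left_mono) auto
    then show "av (d n) \<le> max 1 (av b) * av (c n)" by (simp add: d_def av_mult mult.commute)
  qed
  have "d k = 0"
  proof (rule laurent_eval_zero_infinite[OF d X x(1)])
    fix y assume y: "y \<in> X"
    have "av (a * y) = 1" using a x(1)[OF y] by (simp add: av_mult)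
    then have "av_tendsto av (\<lambda>N. laurent_sum c N (a * y) - b * laurent_sum c N y)
        (laurent_eval av c (a * y) - b * laurent_eval av c y)"
      using c x(1)[OF y] by (intro av_tendsto_diff av_tendsto_mult_left laurent_sum_tendsto)
    moreover have "laurent_sum c N (a * y) - b * laurent_sum c N y = laurent_sum d N y" for N
      by (simp add: laurent_sum_def d_def sum_distrib_left power_int_mult_distrib algebra_simps
          flip: sum_subtractf)
    ultimately show "laurent_eval av d y = 0" using x(2)[OF y] by (intro laurent_eval_eqI) simp
  qed
  then show ?thesis using k by (simp add: d_def)
qed

text \<open>Conjugate pairs \<open>\<rho>'\<close>, \<open>\<delta> \<rho>'\<close> give \<open>c(a x) = b c(x)\<close> at infinitely many \<open>x\<close> with one fixed \<open>a\<close>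
  of large \<open>p\<close>-power order, which forces the exponents of \<open>c\<close> into one residue class.\<close>
lemma monomial_if_p_orders_unbounded:
  assumes char0: "\<And>n. n > 0 \<Longrightarrow> of_nat n \<noteq> (0 :: 'a)"
    and c: "vanishing av c" "\<And>n. c n \<in> K"
    and inf: "\<And>j. infinite {\<xi> \<in> roots_of_unity. laurent_eval av c \<xi> \<in> roots_of_unity \<and>
      (\<forall>M>0. \<xi> ^ M = 1 \<longrightarrow> laurent_eval av c \<xi> ^ M = 1 \<longrightarrow> p ^ j dvd M)}"
    and kl: "c k \<noteq> 0" "c l \<noteq> 0"
  shows "k = l"
proof (rule ccontr)
  assume "k \<noteq> l"
  define D where "D = nat \<bar>k - l\<bar>"
  have D: "D > 0" using \<open>k \<noteq> l\<close> by (simp add: D_def)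
  have p0: "of_nat p \<noteq> (0 :: 'a)" using char0 p_gt_0 by blast
  obtain c0 where c0': "av \<pi> ^ c0 < av (of_nat p)"
    using real_arch_pow_inv[of "av (of_nat p)" "av \<pi>"] p0 \<pi> by auto
  have "c0 \<le> p ^ c0" using power_gt_expt[of p c0] p_gt_1 by simp
  then have "av \<pi> ^ (p ^ c0) \<le> av \<pi> ^ c0" using \<pi> by (intro power_decreasing) auto
  then have c0: "av \<pi> ^ (p ^ c0) \<le> av (of_nat p)" using c0' by simp
  obtain i where Di: "D < p ^ i" using power_gt_expt[of p D] p_gt_1 by auto
  define j where "j = Suc (Suc (c0 + i))"
  let ?f = "laurent_eval av c"
  define S where "S = {\<xi> \<in> roots_of_unity. ?f \<xi> \<in> roots_of_unity \<and>
      (\<forall>M>0. \<xi> ^ M = 1 \<longrightarrow> ?f \<xi> ^ M = 1 \<longrightarrow> p ^ j dvd M)}"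
  have infS: "infinite S" unfolding S_def by (rule inf)
  \<comment> \<open>\<open>(a, b)\<close> is the twist obtained from \<xi> and \<open>x\<close> the
    point where it acts. The last clause says that the order of \<xi> divides that of
    \<open>x\<close>; it prevents infinitely many \<xi> from sharing finitely many points.\<close>
  define G where "G = (\<lambda>\<xi> (a::'a, b::'a) x. a ^ (p ^ j) = 1 \<and> (a ^ (p ^ i) \<noteq> 1 \<or> b ^ (p ^ i) \<noteq> 1) \<and>
     x \<in> roots_of_unity \<and> ?f (a * x) = b * ?f x \<and> (\<forall>n>0. x ^ n = 1 \<longrightarrow> \<xi> ^ n = (1::'a)))"
  let ?E = "{a::'a. a ^ (p ^ j) = 1}"
  have finE: "finite ?E" by (rule card_power_eq_1_le) (use p_gt_0 in simp)
  have "\<exists>e\<in>?E \<times> ?E. \<exists>x. G \<xi> e x" if "\<xi> \<in> S" for \<xi>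
  proof -
    define \<eta> where "\<eta> = ?f \<xi>"
    have "\<xi> \<in> roots_of_unity" "\<eta> \<in> roots_of_unity" using that by (auto simp: S_def \<eta>_def)
    then obtain M1 M2 where M12: "M1 > 0" "\<xi> ^ M1 = 1" "M2 > 0" "\<eta> ^ M2 = 1"
      unfolding roots_of_unity_def by blast
    let ?Q = "\<lambda>M. M > 0 \<and> \<xi> ^ M = 1 \<and> \<eta> ^ M = 1"
    have "\<xi> ^ (M1 * M2) = (\<xi> ^ M1) ^ M2" "\<eta> ^ (M1 * M2) = (\<eta> ^ M2) ^ M1"
      by (simp_all add: mult.commute flip: power_mult)
    then have QM: "?Q (M1 * M2)" using M12 by simp
    define M where "M = (LEAST M. ?Q M)"
    have M: "?Q M" unfolding M_def by (rule LeastI[of ?Q, OF QM])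
    have Mmin: "M \<le> M'" if "?Q M'" for M' unfolding M_def by (rule Least_le[of ?Q, OF that])
    have jM: "p ^ j dvd M" using M that by (auto simp: S_def \<eta>_def)
    define N where "N = multiplicity p M"
    have M0: "M \<noteq> 0" using M by simp
    obtain m where m: "M = p ^ N * m" "\<not> p dvd m"
      using multiplicity_decompose'[of M p] M0 p(1) unfolding N_def by (metis not_prime_unit)
    have jN: "j \<le> N" unfolding N_def by (rule multiplicity_geI) (use jM M0 p(1) in auto)
    obtain N' where N': "N = Suc N'" using jN by (cases N) (auto simp: j_def)
    obtain \<rho> :: 'a where \<rho>: "primitive_root_of_unity M \<rho>"
      by (rule primitive_root_of_unity_exists[OF alg_closed char0]) (use M in auto)
    then have \<rho>1: "\<rho> ^ M = 1" by (simp add: primitive_root_of_unity_def)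
    obtain s where s: "\<xi> = \<rho> ^ s" by (rule primitive_root_of_unity_generates[OF \<rho>, of \<xi>]) (use M in auto)
    obtain t where t: "\<eta> = \<rho> ^ t" by (rule primitive_root_of_unity_generates[OF \<rho>, of \<eta>]) (use M in auto)
    have Mdiv: "M = p * (p ^ N' * m)" using m N' by simp
    have m0: "m > 0" using m M0 by (intro gr0I) auto
    have less: "p ^ N' * m < M" "p ^ N' * m > 0" unfolding Mdiv using m0 p_gt_1 by auto
    \<comment> \<open>Minimality of \<open>M\<close> ensures that at least one of \<delta>^s,
      \<delta>^t is still not killed by p^i.\<close>
    have st: "\<not> p dvd s \<or> \<not> p dvd t"
    proof (rule ccontr)
      assume "\<not> ?thesis"
      then obtain s' t' where "s = p * s'" "t = p * t'" unfolding dvd_def by blast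
      then have "\<xi> ^ (p ^ N' * m) = (\<rho> ^ M) ^ s'" "\<eta> ^ (p ^ N' * m) = (\<rho> ^ M) ^ t'"
        unfolding s t Mdiv by (simp_all add: ac_simps flip: power_mult)
      then have "M \<le> p ^ N' * m" using Mmin[of "p ^ N' * m"] less \<rho>1 by simp
      then show False using less by simp
    qed
    have ne: "\<rho> ^ (p ^ (N - 1) * m) \<noteq> 1"
    proof
      assume "\<rho> ^ (p ^ (N - 1) * m) = 1"
      then have "M dvd p ^ N' * m" using \<rho> N' by (simp add: primitive_root_of_unity_def)
      then show False using less by (auto dest: dvd_imp_le)
    qed
    obtain \<rho>' \<delta> where \<delta>: "conjugate_over K \<rho> \<rho>'" "conjugate_over K \<rho> (\<delta> * \<rho>')"
      "\<delta> ^ (p ^ j) = 1" "\<delta> ^ (p ^ i) \<noteq> 1"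
      by (rule conjugate_pair[OF p0 c0 _ _ ne m(2), of i]) (use jN \<rho>1 m(1) in \<open>auto simp: j_def\<close>)
    have val: "?f (y ^ s) = y ^ t" if "conjugate_over K \<rho> y" for y
      by (rule laurent_eval_conjugate[OF c \<rho>1 _ that]) (use M s t in \<open>auto simp: \<eta>_def\<close>)
    have pow: "\<delta> ^ (p ^ i) = 1" if "(\<delta> ^ u) ^ (p ^ i) = 1" "\<not> p dvd u" for u
    proof -
      have "\<delta> ^ gcd (u * p ^ i) (p ^ j) = 1"
        by (rule power_gcd_eq_1) (use that \<delta>(3) in \<open>simp_all add: power_mult\<close>)
      moreover have "gcd (u * p ^ i) (p ^ j) = p ^ i"
      proof -
        have "coprime u p" using prime_imp_coprime[OF p(1) that(2)] by (simp add: coprime_commute)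
        then have "gcd u (p ^ (j - i)) = 1" by simp
        moreover have "p ^ j = p ^ i * p ^ (j - i)" by (simp add: j_def add.commute flip: power_add)
        moreover have "gcd (p ^ i * u) (p ^ i * p ^ (j - i)) = p ^ i * gcd u (p ^ (j - i))"
          by (rule gcd_mult_distrib_nat[symmetric])
        ultimately show ?thesis by (simp only: mult.commute[of u] mult_1_right)
      qed
      ultimately show ?thesis by simp
    qed
    have powj: "(\<delta> ^ u) ^ (p ^ j) = 1" for u
    proof -
      have "(\<delta> ^ u) ^ (p ^ j) = (\<delta> ^ (p ^ j)) ^ u" by (simp add: mult.commute flip: power_mult)
      then show ?thesis using \<delta>(3) by simp
    qed
    let ?x = "\<rho>' ^ s"
    have \<rho>'M: "\<rho>' ^ M = 1" by (rule conjugate_over_power_eq_1[OF \<delta>(1) \<rho>1])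
    have "G \<xi> (\<delta> ^ s, \<delta> ^ t) ?x"
      unfolding G_def prod.case
    proof (intro conjI allI impI)
      show "(\<delta> ^ s) ^ (p ^ j) = 1" using powj by blast
      show "(\<delta> ^ s) ^ (p ^ i) \<noteq> 1 \<or> (\<delta> ^ t) ^ (p ^ i) \<noteq> 1" using pow \<delta>(4) st by blast
      have "?x ^ M = (\<rho>' ^ M) ^ s" by (simp add: mult.commute flip: power_mult)
      then show "?x \<in> roots_of_unity" using \<rho>'M M unfolding roots_of_unity_def by auto
      show "?f (\<delta> ^ s * ?x) = \<delta> ^ t * ?f ?x"
        using val[OF \<delta>(1)] val[OF \<delta>(2)] by (simp add: power_mult_distrib)
      fix n :: nat assume "?x ^ n = 1" "n > 0"
      then have "\<rho>' ^ (s * n) = 1" by (simp add: power_mult)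
      moreover have "\<rho> ^ (s * n * M) = (\<rho> ^ M) ^ (s * n)" by (simp add: mult.commute flip: power_mult)
      then have "\<rho> ^ (s * n * M) = 1" using \<rho>1 by simp
      ultimately have "\<rho> ^ (s * n) = 1"
        using conjugate_over_power_eq_1_rev[OF \<delta>(1)] char0 M by blast
      then show "\<xi> ^ n = 1" by (simp add: s power_mult)
    qed
    moreover have "(\<delta> ^ s, \<delta> ^ t) \<in> ?E \<times> ?E"
      using powj by simp
    ultimately show ?thesis by blast
  qed
  then have "\<exists>e\<in>?E \<times> ?E. infinite {\<xi> \<in> S. \<exists>x. G \<xi> e x}"
    using finE by (intro pigeonhole_infinite_rel[OF infS]) auto
  then obtain a b where ab: "infinite {\<xi> \<in> S. \<exists>x. G \<xi> (a, b) x}" (is "infinite ?T") by auto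
  have "\<forall>\<xi>\<in>?T. \<exists>x. G \<xi> (a, b) x" by blast
  then obtain x where x: "\<And>\<xi>. \<xi> \<in> ?T \<Longrightarrow> G \<xi> (a, b) (x \<xi>)" by metis
  \<comment> \<open>Finitely many points would have a common exponent n, and then every \<xi> would
    be an n-th root of unity.\<close>
  have infX: "infinite (x ` ?T)"
  proof
    assume fin: "finite (x ` ?T)"
    have "x ` ?T \<subseteq> roots_of_unity" using x unfolding G_def by blast
    from roots_of_unity_common_exponent[OF fin this] obtain n
      where n: "n > 0" "\<And>y. y \<in> x ` ?T \<Longrightarrow> y ^ n = 1" by metis
    have "?T \<subseteq> {\<xi>. \<xi> ^ n = 1}" using x n unfolding G_def by blast
    then show False using ab card_power_eq_1_le(1)[OF n(1)] finite_subset by blast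
  qed
  obtain \<xi>0 where "\<xi>0 \<in> ?T" using ab by (metis ex_in_conv finite.emptyI)
  then have "G \<xi>0 (a, b) (x \<xi>0)" by (rule x)
  then have a: "a ^ (p ^ j) = 1" "a ^ (p ^ i) \<noteq> 1 \<or> b ^ (p ^ i) \<noteq> 1" by (auto simp: G_def)
  have ava: "av a = 1" using av_eq_1_if_power_eq_1[OF a(1)] p_gt_0 by simp
  then have a0: "a \<noteq> 0" by auto
  have powi: "a powi n = b" if "c n \<noteq> 0" for n
  proof (rule laurent_eval_proportional[OF c(1) infX ava _ _ that])
    fix y assume "y \<in> x ` ?T"
    then obtain \<xi> where "G \<xi> (a, b) y" using x by blast
    then have y: "y \<in> roots_of_unity" "?f (a * y) = b * ?f y" by (auto simp: G_def)
    then show "?f (a * y) = b * ?f y" by simp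
    show "av y = 1" using y(1) av_eq_1_if_power_eq_1 by (auto simp: roots_of_unity_def)
  qed
  \<comment> \<open>\<open>G\<close> gives this only for \<open>a\<close> or \<open>b\<close>; but b
    = a^k, so \<open>b\<close> is killed by p^i whenever \<open>a\<close> is.\<close>
  have ai: "a ^ (p ^ i) \<noteq> 1"
  proof
    assume *: "a ^ (p ^ i) = 1"
    have "b ^ (p ^ i) = (a powi k) powi int (p ^ i)" using powi[OF kl(1)] by (simp only: power_int_of_nat)
    also have "\<dots> = (a powi int (p ^ i)) powi k" by (metis mult.commute power_int_mult)
    also have "\<dots> = 1" using * by (simp only: power_int_of_nat power_int_1_left)
    finally show False using a(2) * by simp
  qed
  have "a powi (k - l) = 1" "a powi (l - k) = 1"
    using powi[OF kl(1)] powi[OF kl(2)] a0 by (auto simp: power_int_diff)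
  then have aD: "a ^ D = 1" unfolding D_def
    by (metis abs_of_nonneg abs_of_nonpos linorder_linear minus_diff_eq nat_0_le abs_ge_zero power_int_of_nat)
  have "a ^ gcd D (p ^ j) = 1" by (rule power_gcd_eq_1[OF aD a(1)])
  moreover obtain e where e: "gcd D (p ^ j) = p ^ e"
    using divides_primepow_nat[OF p(1), of "gcd D (p ^ j)" j] by auto
  moreover have "p ^ e \<le> D" using D e by (metis gcd_le1_nat less_nat_zero_code)
  then have "p ^ e < p ^ i" using Di by simp
  then have "e < i" using p_gt_1 by (simp add: power_strict_increasing_iff)
  then have "p ^ e dvd p ^ i" by (simp add: le_imp_power_dvd)
  ultimately have "a ^ (p ^ i) = 1" by (metis dvdE power_mult power_one)
  then show False using ai by simp
qed

end

section \<open>Frobenius\<close>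

lemma power_power_eq_1:
  fixes x :: "'a::monoid_mult"
  assumes "x ^ n = 1"
  shows "(x ^ i) ^ n = 1"
proof -
  have "(x ^ i) ^ n = (x ^ n) ^ i" by (simp add: mult.commute flip: power_mult)
  then show ?thesis using assms by simp
qed

text \<open>Two of the powers k^0, ..., k^n agree modulo n, so the order of k is at most n and
  divides \<open>fact n\<close>. Factorials provide one exponent that works for all smaller moduli
  at once.\<close>

lemma power_fact_cong_1:
  fixes k n :: nat
  assumes "coprime k n" "n > 0"
  shows "[k ^ fact n = 1] (mod n)"
proof -
  have "card ((\<lambda>i. k ^ i mod n) ` {0..n}) \<le> card {0..<n}"
    using assms(2) by (intro card_mono) auto
  then have "\<not> inj_on (\<lambda>i. k ^ i mod n) {0..n}" by (intro pigeonhole) simp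
  then obtain i j where ij: "i < j" "j \<le> n" "k ^ i mod n = k ^ j mod n"
    unfolding inj_on_def by (metis atLeastAtMost_iff linorder_neqE_nat)
  have "[k ^ i * k ^ (j - i) = k ^ i * 1] (mod n)"
    using ij by (simp add: cong_def flip: power_add)
  moreover have "coprime (k ^ i) n" using assms(1) by simp
  ultimately have e: "[k ^ (j - i) = 1] (mod n)" using cong_mult_lcancel_nat by blast
  have "j - i dvd fact n" using ij by (intro dvd_fact) auto
  then obtain d where d: "fact n = (j - i) * d" by blast
  have "[(k ^ (j - i)) ^ d = 1 ^ d] (mod n)" by (rule cong_pow[OF e])
  then show ?thesis by (simp add: d power_mult)
qed

section \<open>Bounds and twists of series, and the equation g(x^Q) = g(x)^Q\<close>

context nonarch_field
begin

lemma vanishing_bounded: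
  assumes "vanishing av c"
  obtains B where "B \<ge> 1" "\<And>n. av (c n) \<le> B"
proof (cases "\<exists>k. c k \<noteq> 0")
  case True
  then obtain k where "c k \<noteq> 0" by blast
  then obtain n where n: "\<And>i. av (c i) \<le> av (c n)"
    using finite_argmax_coeff[of c k] vanishing_finite[OF assms] by blast
  then have "av (c i) \<le> max 1 (av (c n))" for i by (rule max.coboundedI2)
  then show ?thesis using that[of "max 1 (av (c n))"] by simp
next
  case False
  then have "av (c n) \<le> 1" for n by simp
  then show ?thesis using that[of 1] by simp
qed

lemma av_laurent_sum_le:
  assumes "\<And>n. av (c n) \<le> B" "av x = 1"
  shows "av (laurent_sum c N x) \<le> B"
  unfolding laurent_sum_def
proof (rule av_sum_le)
  fix n show "av (c n * x powi n) \<le> B" using assms by (simp add: av_mult av_powi)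
next
  show "0 \<le> B" using assms(1)[of 0] av_nonneg order_trans by blast
qed

lemma av_power_diff_le_bound:
  assumes "av u \<le> B" "av v \<le> B" "B \<ge> 1"
  shows "av (u ^ n - v ^ n) \<le> B ^ n * av (u - v)"
proof (induction n)
  case (Suc n)
  have e: "u ^ Suc n - v ^ Suc n = u * (u ^ n - v ^ n) + (u - v) * v ^ n"
    by (simp add: algebra_simps)
  have "av u * av (u ^ n - v ^ n) \<le> B * (B ^ n * av (u - v))"
    using assms Suc by (intro mult_mono) auto
  moreover have "av (u - v) * av v ^ n \<le> av (u - v) * B ^ Suc n"
  proof (intro mult_left_mono)
    have "av v ^ n \<le> B ^ n" using assms by (intro power_mono) auto
    also have "\<dots> \<le> B ^ Suc n" using assms by (intro power_increasing) auto
    finally show "av v ^ n \<le> B ^ Suc n" .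
  qed simp
  ultimately show ?case unfolding e
    using av_add[of "u * (u ^ n - v ^ n)" "(u - v) * v ^ n"]
    by (simp add: av_mult av_power mult.commute mult.left_commute)
qed simp

end

context nonarch_complete_field
begin

lemma
  assumes c: "vanishing av c" and a: "av a = 1"
  shows vanishing_scale: "vanishing av (\<lambda>n. b * c n * a powi n)"
    and laurent_eval_scale:
      "av x = 1 \<Longrightarrow> laurent_eval av (\<lambda>n. b * c n * a powi n) x = b * laurent_eval av c (a * x)"
proof -
  show "vanishing av (\<lambda>n. b * c n * a powi n)"
    by (rule vanishing_le[OF c, of _ "av b"]) (simp add: av_mult av_powi a)
  assume x: "av x = 1"
  have "av_tendsto av (\<lambda>N. b * laurent_sum c N (a * x)) (b * laurent_eval av c (a * x))"
    by (intro av_tendsto_mult_left laurent_sum_tendsto c) (simp add: av_mult a x)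
  moreover have "b * laurent_sum c N (a * x) = laurent_sum (\<lambda>n. b * c n * a powi n) N x" for N
    by (simp add: laurent_sum_def sum_distrib_left power_int_mult_distrib ac_simps)
  ultimately show "laurent_eval av (\<lambda>n. b * c n * a powi n) x = b * laurent_eval av c (a * x)"
    by (intro laurent_eval_eqI) simp
qed

lemma av_laurent_eval_le:
  assumes "vanishing av c" "\<And>n. av (c n) \<le> B" "av x = 1"
  shows "av (laurent_eval av c x) \<le> B"
proof (rule ccontr)
  assume "\<not> ?thesis"
  then have less: "B < av (laurent_eval av c x)" by simp
  have "B \<ge> 0" using assms(2)[of 0] av_nonneg order_trans by blast
  then have "av (laurent_eval av c x) > 0" using less by linarith
  then obtain N where "\<forall>n\<ge>N. av (laurent_sum c n x - laurent_eval av c x) < av (laurent_eval av c x)"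
    using laurent_sum_tendsto[OF assms(1,3)] unfolding av_tendsto_def by blast
  then have "av (laurent_eval av c x - laurent_sum c N x) < av (laurent_eval av c x)"
    using av_diff_commute by (metis order_refl)
  then have "av (laurent_sum c N x) = av (laurent_eval av c x)" by (rule av_eq_of_diff_less)
  moreover have "av (laurent_sum c N x) \<le> B" by (rule av_laurent_sum_le) (use assms in auto)
  ultimately show False using less by simp
qed

text \<open>Truncate and compare Gauss norms: a polynomial of small absolute value at many points
  with distinct reductions has small coefficients.\<close>
lemma laurent_power_identity:
  assumes c: "vanishing av c" and W: "infinite W" "\<And>w. w \<in> W \<Longrightarrow> av w = 1"
    "\<And>w w'. w \<in> W \<Longrightarrow> w' \<in> W \<Longrightarrow> w \<noteq> w' \<Longrightarrow> 1 \<le> av (w - w')"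
    and eq: "\<And>w. w \<in> W \<Longrightarrow> laurent_eval av c (w ^ Q) = laurent_eval av c w ^ Q"
    and x: "av x = 1"
  shows "laurent_eval av c (x ^ Q) = laurent_eval av c x ^ Q"
proof (rule ccontr)
  let ?g = "laurent_eval av c"
  assume "\<not> ?thesis"
  then have E0: "av (?g (x ^ Q) - ?g x ^ Q) > 0" (is "?E > 0") by simp
  obtain B where B: "B \<ge> 1" "\<And>n. av (c n) \<le> B" using vanishing_bounded[OF c] by blast
  \<comment> \<open>B^Q bounds the Lipschitz constant of the \<open>Q\<close>-th power on the ball
    of radius B, so an error \<open>e\<close> in the truncation costs at most half of
    \<open>?E\<close>.\<close>
  define e where "e = ?E / (2 * B ^ Q)"
  have BQ: "B ^ Q \<ge> 1" using B by simp
  have e0: "e > 0" using E0 BQ by (simp add: e_def)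
  have "B ^ Q \<noteq> 0" using BQ by linarith
  then have eE: "B ^ Q * e = ?E / 2" by (simp add: e_def)
  have "1 * e \<le> B ^ Q * e" using BQ e0 by (intro mult_right_mono) auto
  then have eE': "e \<le> ?E / 2" using eE by simp
  obtain N :: nat where N: "\<And>n. \<bar>n\<bar> > int N \<Longrightarrow> av (c n) < e"
    using vanishing_obtain[OF c e0] by blast
  let ?s = "laurent_sum c N"
  have approx: "av (?g y - ?s y) \<le> e" if "av y = 1" for y
    by (rule laurent_eval_approx) (use c that N e0 in \<open>auto intro: less_imp_le\<close>)
  have near: "av ((?g (y ^ Q) - ?g y ^ Q) - (?s (y ^ Q) - ?s y ^ Q)) \<le> ?E / 2" if y: "av y = 1" for y
  proof -
    have "av (?g (y ^ Q) - ?s (y ^ Q)) \<le> ?E / 2"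
      using approx[of "y ^ Q"] y eE' by (simp add: av_power)
    moreover have "av (?g y ^ Q - ?s y ^ Q) \<le> ?E / 2"
    proof -
      have "av (?g y ^ Q - ?s y ^ Q) \<le> B ^ Q * av (?g y - ?s y)"
      using av_laurent_eval_le[OF c B(2) y] av_laurent_sum_le[OF B(2) y] B(1)
        by (intro av_power_diff_le_bound)
      also have "\<dots> \<le> B ^ Q * e"
        using approx[OF y] BQ by (intro mult_left_mono) auto
      finally show ?thesis by (simp only: eE)
    qed
    moreover have "(?g (y ^ Q) - ?g y ^ Q) - (?s (y ^ Q) - ?s y ^ Q)
      = (?g (y ^ Q) - ?s (y ^ Q)) - (?g y ^ Q - ?s y ^ Q)" by simp
    moreover have "av ((?g (y ^ Q) - ?s (y ^ Q)) - (?g y ^ Q - ?s y ^ Q)) \<le> ?E / 2"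
      by (rule order_trans[OF av_diff max.boundedI]) fact+
    ultimately show ?thesis by (simp only:)
  qed
  define T where "T = laurent_poly c N"
  define R where "R = pcompose T (monom 1 Q) - T ^ Q"
  have Rval: "av (poly R y) = av (?s (y ^ Q) - ?s y ^ Q)" if y: "av y = 1" for y
  proof -
    have y0: "y \<noteq> 0" using y by auto
    have "poly R y = (y ^ Q) ^ N * ?s (y ^ Q) - (y ^ N * ?s y) ^ Q"
      using y0 by (simp add: R_def T_def poly_pcompose poly_monom poly_laurent_poly)
    also have "\<dots> = y ^ (N * Q) * (?s (y ^ Q) - ?s y ^ Q)"
      by (simp add: power_mult_distrib right_diff_distrib mult.commute flip: power_mult)
    finally show ?thesis using y by (simp add: av_mult av_power)
  qed
  obtain X where X: "finite X" "card X = Suc (degree R)" "X \<subseteq> W"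
    using infinite_arbitrarily_large[OF W(1)] by metis
  have "av (coeff R i) \<le> ?E / 2" for i
  proof (rule coeffs_le_if_values_le[OF X(1)])
    fix y assume "y \<in> X"
    then have y: "y \<in> W" "av y = 1" using X(3) W(2) by auto
    then have "av (0 - (?s (y ^ Q) - ?s y ^ Q)) \<le> ?E / 2" using near[of y] eq[of y] by simp
    then show "av (poly R y) \<le> ?E / 2" using Rval[OF y(2)] av_minus by (metis diff_0)
  next
    fix y z assume "y \<in> X" "z \<in> X" "y \<noteq> z"
    then show "1 \<le> av (y - z)" using X(3) W(3) by blast
  qed (use X W in auto)
  then have "av (poly R x) \<le> ?E / 2" by (rule av_poly_le) (simp add: x)
  then have "av (?s (x ^ Q) - ?s x ^ Q) \<le> ?E / 2" using Rval[OF x] by simp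
  then have "?E \<le> ?E / 2"
    using near[OF x] av_add[of "(?g (x ^ Q) - ?g x ^ Q) - (?s (x ^ Q) - ?s x ^ Q)" "?s (x ^ Q) - ?s x ^ Q"]
    by simp
  then show False using E0 by simp
qed

end

text \<open>\<open>q\<close> is any power of \<open>p\<close> whose power map fixes the residue
  field of \<open>K\<close>, not necessarily the cardinality of that field.\<close>

locale local_field_frobenius = local_field_closure +
  fixes q f :: nat
  assumes q: "q = p ^ f" "f > 0"
    and frob: "\<And>x. x \<in> K \<Longrightarrow> av x \<le> 1 \<Longrightarrow> av (x ^ q - x) < 1"
begin

lemma poly_frobenius:
  assumes "poly_over K R" "\<And>i. av (coeff R i) \<le> 1" "av x \<le> 1"
  shows "av (poly R x ^ q - poly R (x ^ q)) < 1"
  using assms(1,2)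
proof (induction R)
  case 0
  then show ?case using q p_gt_0 by (simp add: power_0_left)
next
  case (pCons a R)
  have R: "poly_over K R" "\<And>i. av (coeff R i) \<le> 1"
    using pCons.prems(1) pCons.prems(2)[of "Suc i" for i] by (auto simp: poly_over_pCons)
  have a: "a \<in> K" "av a \<le> 1" using pCons.prems(1) pCons.prems(2)[of 0] by (auto simp: poly_over_pCons)
  have Rx: "av (x * poly R x) \<le> 1"
    using av_poly_le[OF R(2) assms(3)] assms(3) by (simp add: av_mult mult_le_one)
  have 1: "av ((a + x * poly R x) ^ q - a ^ q - (x * poly R x) ^ q) < 1"
    unfolding q(1) by (rule av_add_power_p_power[OF a(2) Rx])
  have 2: "av (a ^ q - a) < 1" by (rule frob[OF a])
  have "av x ^ q * av (poly R x ^ q - poly R (x ^ q)) \<le> 1 * av (poly R x ^ q - poly R (x ^ q))"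
    using assms(3) by (intro mult_right_mono power_le_one) auto
  then have 3: "av (x ^ q * (poly R x ^ q - poly R (x ^ q))) < 1"
    using pCons.IH[OF R] by (simp add: av_mult av_power)
  have "poly (pCons a R) x ^ q - poly (pCons a R) (x ^ q)
      = ((a + x * poly R x) ^ q - a ^ q - (x * poly R x) ^ q)
        + ((a ^ q - a) + x ^ q * (poly R x ^ q - poly R (x ^ q)))"
    by (simp add: algebra_simps power_mult_distrib)
  also have "av \<dots> < 1"
    using 1 2 3 av_add[of "(a + x * poly R x) ^ q - a ^ q - (x * poly R x) ^ q"
        "(a ^ q - a) + x ^ q * (poly R x ^ q - poly R (x ^ q))"]
      av_add[of "a ^ q - a" "x ^ q * (poly R x ^ q - poly R (x ^ q))"] by linarith
  finally show ?case .
qed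

text \<open>The congruence of h(x^q) with h(x)^q = 0 gives |h(x^q)| < 1, and the product formula for
  \<open>h\<close> then provides a root near x^q. This replaces a Frobenius automorphism.\<close>

lemma frobenius_conjugate:
  assumes x: "x ^ M = 1" and M: "of_nat M \<noteq> (0 :: 'a)"
  obtains y where "conjugate_over K x y" "av (x ^ q - y) < 1"
proof -
  have M0: "M > 0" using M by (intro gr0I) simp
  obtain h where h: "min_poly_over K x h" using min_poly_over_exists_root_of_unity[OF x M0] .
  obtain U where U: "\<And>i. av (coeff h i) \<le> 1" "h = (\<Prod>z\<in>{z. poly h z = 0}. [:- z, 1:])"
    using min_poly_root_of_unity[OF h x M] by metis
  have hK: "poly_over K h" "poly h x = 0" using h by (auto simp: min_poly_over_def)
  have avx: "av x = 1" by (rule av_eq_1_if_power_eq_1[OF x M0])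
  have "av (poly h x ^ q - poly h (x ^ q)) < 1" by (rule poly_frobenius[OF hK(1) U(1)]) (simp add: avx)
  then have less: "av (poly h (x ^ q)) < 1" using hK(2) q p_gt_0 by (simp add: power_0_left)
  have "\<exists>y\<in>{z. poly h z = 0}. av (x ^ q - y) < 1"
  proof (rule ccontr)
    assume "\<not> ?thesis"
    then have "1 \<le> (\<Prod>z\<in>{z. poly h z = 0}. av (x ^ q - z))" by (intro prod_ge_1) auto
    also have "\<dots> = av (poly h (x ^ q))" by (subst (2) U(2)) (simp add: poly_prod av_prod)
    finally show False using less by simp
  qed
  then show ?thesis using conjugate_over_if_root[OF h] that by blast
qed

text \<open>The conjugate \<rho>^k is known only through its reduction, which is that of \<rho>^q.
  Reductions determine m-th roots of unity, so k acts on these as q. On the \<open>p\<close>-part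
  they say nothing; there only coprimality is obtained, since conjugation does not lower the
  order.\<close>

lemma frobenius_exponent:
  assumes \<rho>: "primitive_root_of_unity (p ^ N * m) \<rho>" and m: "\<not> p dvd m"
    and M: "of_nat (p ^ N * m) \<noteq> (0 :: 'a)"
  obtains k where "conjugate_over K \<rho> (\<rho> ^ k)" "\<And>x::'a. x ^ m = 1 \<Longrightarrow> x ^ k = x ^ q" "coprime k (p ^ N)"
proof -
  let ?M = "p ^ N * m"
  have M0: "?M > 0" using M by (metis gr0I of_nat_0)
  have \<rho>1: "\<rho> ^ ?M = 1" using \<rho> by (simp add: primitive_root_of_unity_def)
  obtain y where y: "conjugate_over K \<rho> y" "av (\<rho> ^ q - y) < 1"
    using frobenius_conjugate[OF \<rho>1 M] .
  have "y ^ ?M = 1" by (rule conjugate_over_power_eq_1[OF y(1) \<rho>1])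
  then obtain k where k: "y = \<rho> ^ k" using primitive_root_of_unity_generates[OF \<rho> M0] by metis
  have av1: "av (\<rho> ^ q) \<le> 1" "av y \<le> 1"
    using av_eq_1_if_power_eq_1[OF \<rho>1 M0] by (simp_all add: k av_power)
  have eq: "(\<rho> ^ (p ^ N)) ^ k = (\<rho> ^ (p ^ N)) ^ q"
  proof (rule coprime_roots_of_unity_eq[OF m])
    have "((\<rho> ^ (p ^ N)) ^ i) ^ m = (\<rho> ^ ?M) ^ i" for i by (simp add: ac_simps flip: power_mult)
    then show "((\<rho> ^ (p ^ N)) ^ k) ^ m = 1" "((\<rho> ^ (p ^ N)) ^ q) ^ m = 1" using \<rho>1 by simp_all
    have "(\<rho> ^ (p ^ N)) ^ k - (\<rho> ^ (p ^ N)) ^ q = y ^ (p ^ N) - (\<rho> ^ q) ^ (p ^ N)"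
      unfolding k by (simp add: mult.commute flip: power_mult)
    then show "av ((\<rho> ^ (p ^ N)) ^ k - (\<rho> ^ (p ^ N)) ^ q) < 1"
      using av_power_diff_le[OF av1(2,1), of "p ^ N"] y(2) av_diff_commute[of y] by simp
  qed
  have "x ^ k = x ^ q" if x: "x ^ m = 1" for x :: 'a
  proof -
    have "x ^ ?M = 1" using power_power_eq_1[OF x, of "p ^ N"] by (simp add: power_mult)
    then obtain u where u: "x = \<rho> ^ u" using primitive_root_of_unity_generates[OF \<rho> M0] by metis
    have "\<rho> ^ (u * m) = 1" using x by (simp add: u power_mult)
    then have "p ^ N * m dvd u * m" using \<rho> by (simp add: primitive_root_of_unity_def)
    then have "p ^ N dvd u" using M0 by simp
    then obtain v where v: "u = p ^ N * v" by blast
    have "x ^ i = ((\<rho> ^ (p ^ N)) ^ i) ^ v" for i unfolding u v by (simp add: ac_simps flip: power_mult)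
    then show ?thesis using eq by simp
  qed
  moreover have "coprime k (p ^ N)"
  proof (cases N)
    case (Suc N')
    have p0: "of_nat p \<noteq> (0 :: 'a)" using M Suc by auto
    have Mdiv: "?M = (p ^ N' * m) * p" using Suc by simp
    have "\<not> p dvd k"
    proof
      assume "p dvd k"
      then obtain k' where "k = p * k'" by blast
      then have "y ^ (p ^ N' * m) = (\<rho> ^ ?M) ^ k'" unfolding k Mdiv by (simp add: ac_simps flip: power_mult)
      then have "\<rho> ^ (p ^ N' * m) = 1"
        using conjugate_over_power_eq_1_rev[OF y(1) _ p0, of "p ^ N' * m"] \<rho>1 Mdiv by simp
      then have "?M dvd p ^ N' * m" using \<rho> by (simp add: primitive_root_of_unity_def)
      then have "?M \<le> p ^ N' * m" using M0 Suc by (intro dvd_imp_le) auto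
      then show False using M0 Suc p_gt_1 by simp
    qed
    then show ?thesis using prime_imp_coprime[OF p(1)] by (simp add: coprime_commute)
  qed simp
  ultimately show ?thesis using that y(1) k by blast
qed

text \<open>The exponent k may move the \<open>p\<close>-part, but its iterate of order
  \<open>fact (p ^ j)\<close> fixes it whenever N \<le> j. Thus one power of q serves for all points
  with bounded \<open>p\<close>-part.\<close>

lemma frobenius_transfer:
  assumes c: "vanishing av c" "\<And>n. c n \<in> K"
    and M: "\<xi> ^ M = 1" "laurent_eval av c \<xi> ^ M = 1" "\<not> p ^ j dvd M" "of_nat M \<noteq> (0 :: 'a)"
  obtains \<zeta> \<zeta>' \<omega> \<omega>' m where "\<zeta> ^ (p ^ j) = 1" "\<zeta>' ^ (p ^ j) = 1" "\<omega> ^ m = 1" "\<omega>' ^ m = 1" "\<not> p dvd m"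
    "\<xi> = \<zeta> * \<omega>" "laurent_eval av c \<xi> = \<zeta>' * \<omega>'"
    "laurent_eval av c (\<zeta> * \<omega> ^ (q ^ fact (p ^ j))) = \<zeta>' * \<omega>' ^ (q ^ fact (p ^ j))"
proof -
  let ?L = "fact (p ^ j) :: nat"
  let ?f = "laurent_eval av c"
  have M0: "M > 0" using M(4) by (intro gr0I) simp
  define N where "N = multiplicity p M"
  obtain m where m: "M = p ^ N * m" "\<not> p dvd m"
    by (rule multiplicity_decompose'[of M p]) (use M0 p(1) in \<open>auto simp: N_def\<close>)
  have Nj: "N \<le> j"
  proof (rule ccontr)
    assume "\<not> N \<le> j"
    then have "p ^ j dvd p ^ N" by (intro le_imp_power_dvd) simp
    then show False using M(3) m(1) by simp
  qed
  obtain \<rho> :: 'a where \<rho>: "primitive_root_of_unity M \<rho>"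
    using primitive_root_of_unity_exists[OF alg_closed M(4)] .
  then have \<rho>1: "\<rho> ^ M = 1" by (simp add: primitive_root_of_unity_def)
  obtain s where s: "\<xi> = \<rho> ^ s" using primitive_root_of_unity_generates[OF \<rho> M0 M(1)] .
  obtain t where t: "?f \<xi> = \<rho> ^ t" using primitive_root_of_unity_generates[OF \<rho> M0 M(2)] .
  obtain k where k: "conjugate_over K \<rho> (\<rho> ^ k)" "\<And>x::'a. x ^ m = 1 \<Longrightarrow> x ^ k = x ^ q" "coprime k (p ^ N)"
    by (rule frobenius_exponent[of N m \<rho>]) (use \<rho> m M(4) in auto)
  have conj: "conjugate_over K \<rho> (\<rho> ^ (k ^ ?L))" by (rule conjugate_over_iterate[OF k(1)])
  have km: "x ^ (k ^ i) = x ^ (q ^ i)" if "x ^ m = 1" for x :: 'a and i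
  proof (induction i)
    case (Suc i)
    have "(x ^ (q ^ i)) ^ m = 1" by (rule power_power_eq_1[OF that])
    then have "(x ^ (q ^ i)) ^ k = (x ^ (q ^ i)) ^ q" by (rule k(2))
    moreover have "x ^ (k ^ Suc i) = (x ^ (k ^ i)) ^ k" "x ^ (q ^ Suc i) = (x ^ (q ^ i)) ^ q"
      by (simp_all only: power_Suc2 power_mult)
    ultimately show ?case using Suc.IH by simp
  qed simp
  have kp: "z ^ (k ^ ?L) = z" if "z ^ (p ^ N) = 1" for z :: 'a
  proof -
    have "p ^ N > 0" using p_gt_0 by simp
    then have "[k ^ fact (p ^ N) = 1] (mod p ^ N)" by (rule power_fact_cong_1[OF k(3)])
    moreover have "fact (p ^ N) dvd ?L" using Nj p_gt_0 by (intro fact_dvd power_increasing) auto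
    then obtain d where d: "?L = fact (p ^ N) * d" by blast
    ultimately have "[(k ^ fact (p ^ N)) ^ d = 1 ^ d] (mod p ^ N)" by (intro cong_pow)
    then have "[k ^ ?L = 1] (mod p ^ N)" by (simp add: d power_mult)
    then show ?thesis using power_eq_if_cong[OF that] by fastforce
  qed
  obtain a b where ab: "\<rho> = \<rho> ^ a * \<rho> ^ b" "(\<rho> ^ a) ^ (p ^ N) = 1" "(\<rho> ^ b) ^ m = 1"
    by (rule root_of_unity_decompose[of \<rho> N m]) (use \<rho>1 m in auto)
  define u v where "u = \<rho> ^ a" and "v = \<rho> ^ b"
  have uv: "\<rho> = u * v" "u ^ (p ^ N) = 1" "v ^ m = 1" using ab by (auto simp: u_def v_def)
  have u1: "(u ^ i) ^ (p ^ N) = 1" and v1: "(v ^ i) ^ m = 1" for i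
    using power_power_eq_1 uv(2,3) by blast+
  have uj: "(u ^ i) ^ (p ^ j) = 1" for i
  proof -
    have "p ^ j = p ^ N * p ^ (j - N)" using Nj by (simp flip: power_add)
    then show ?thesis using u1 by (simp add: power_mult[of _ "p ^ N"])
  qed
  have pow: "(\<rho> ^ (k ^ ?L)) ^ i = u ^ i * (v ^ i) ^ (q ^ ?L)" for i
  proof -
    have "(\<rho> ^ (k ^ ?L)) ^ i = (u ^ i) ^ (k ^ ?L) * (v ^ i) ^ (k ^ ?L)"
      unfolding uv(1) by (simp add: power_mult_distrib mult.commute flip: power_mult)
    then show ?thesis using kp[OF u1] km[OF v1] by simp
  qed
  have "?f ((\<rho> ^ (k ^ ?L)) ^ s) = (\<rho> ^ (k ^ ?L)) ^ t"
    by (rule laurent_eval_conjugate[OF c \<rho>1 M0 conj]) (use s t in simp)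
  then have "?f (u ^ s * (v ^ s) ^ (q ^ ?L)) = u ^ t * (v ^ t) ^ (q ^ ?L)" by (simp only: pow)
  moreover have "\<xi> = u ^ s * v ^ s" "?f \<xi> = u ^ t * v ^ t"
    using s t uv(1) by (simp_all add: power_mult_distrib)
  ultimately show ?thesis using that[OF uj uj v1 v1 m(2)] by blast
qed

end

text \<open>Two natural numbers share a representative in the finite set \<open>S\<close>, so some
  positive integer has absolute value below 1. The least one is prime by multiplicativity.\<close>

lemma (in nonarch_field) residue_characteristic_exists:
  assumes K: "is_subfield K" and S: "finite S"
    "\<And>x. x \<in> K \<Longrightarrow> av x \<le> 1 \<Longrightarrow> \<exists>s\<in>S. av (x - s) < 1"
  obtains p :: nat where "prime p" "av (of_nat p) < 1"
proof -
  have nK: "of_nat n \<in> K" for n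
    using K by (induction n) (auto simp: is_subfield_def)
  have "\<exists>s\<in>S. av (of_nat n - s) < 1" for n by (rule S(2)[OF nK av_of_nat_le_1])
  then obtain s where s: "\<And>n. s n \<in> S" "\<And>n. av (of_nat n - s n) < 1" by metis
  have "\<not> inj_on s UNIV" using s(1) S(1) finite_imageD[of s UNIV] finite_subset[of "range s" S] by auto
  then obtain i j where ij: "i < j" "s i = s j" unfolding inj_on_def by (metis linorder_neqE_nat)
  have "av (of_nat j - of_nat i) < 1"
    using av_diff_triangle[of "of_nat j" "of_nat i" "s i"] s(2)[of i] s(2)[of j] ij(2)
      av_diff_commute[of "of_nat i" "s i"] by simp
  then have ex: "0 < j - i \<and> av (of_nat (j - i)) < 1" using ij(1) by (simp add: of_nat_diff)
  let ?Q = "\<lambda>n. 0 < n \<and> av (of_nat n) < 1"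
  define p where "p = (LEAST n. ?Q n)"
  have p: "?Q p" unfolding p_def by (rule LeastI[of ?Q, OF ex])
  have min: "\<not> ?Q n" if "n < p" for n using not_less_Least[of n ?Q] that by (simp add: p_def)
  have "p \<noteq> 1" using p by auto
  then have p1: "1 < p" using p by simp
  have "prime p"
  proof (rule ccontr)
    assume "\<not> prime p"
    then obtain m where m: "m dvd p" "m \<noteq> 1" "m \<noteq> p" using p1 by (auto simp: prime_nat_iff)
    then obtain k where mk: "p = m * k" by blast
    have "m > 0" "k > 0" using p mk by (auto intro!: gr0I)
    then have mk: "p = m * k" "m > 0" "k > 0" "m < p" "k < p" using mk m(2,3) by (auto simp: nat_neq_iff)
    then have "av (of_nat m) = 1" "av (of_nat k) = 1"
      using min[of m] min[of k] av_of_nat_le_1[of m] av_of_nat_le_1[of k] by (auto simp del: One_nat_def)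
    then show False using p mk(1) by (simp add: av_mult)
  qed
  then show ?thesis using that p by blast
qed

text \<open>The iterated \<open>p\<close>-th powers of a representative repeat in the finite residue
  field, and injectivity of the \<open>p\<close>-th power makes the sequence purely periodic. The
  product of the periods serves for all representatives.\<close>

lemma (in local_field_closure) frobenius_power_exists:
  assumes S: "finite S" "S \<subseteq> {x \<in> K. av x \<le> 1}"
    "\<And>x. x \<in> K \<Longrightarrow> av x \<le> 1 \<Longrightarrow> \<exists>s\<in>S. av (x - s) < 1"
  obtains f :: nat where "f > 0" "\<And>x. x \<in> K \<Longrightarrow> av x \<le> 1 \<Longrightarrow> av (x ^ (p ^ f) - x) < 1"
proof -
  have ex: "\<exists>e>0. av (s ^ (p ^ e) - s) < 1" if "s \<in> S" for s
  proof -
    have sK: "s \<in> K" "av s \<le> 1" using that S(2) by auto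
    have pow1: "av (s ^ n) \<le> 1" for n using sK by (simp add: av_power power_le_one)
    have "\<exists>t\<in>S. av (s ^ (p ^ i) - t) < 1" for i
      by (rule S(3)) (use sK pow1 in \<open>auto intro: K_power\<close>)
    then obtain t where t: "\<And>i. t i \<in> S" "\<And>i. av (s ^ (p ^ i) - t i) < 1" by metis
    have "\<not> inj_on t UNIV" using t(1) S(1) finite_imageD[of t UNIV] finite_subset[of "range t" S] by auto
    then obtain i j where ij: "i < j" "t i = t j" unfolding inj_on_def by (metis linorder_neqE_nat)
    have "av (s ^ (p ^ j) - s ^ (p ^ i)) < 1"
      using av_diff_triangle[of "s ^ (p ^ j)" "s ^ (p ^ i)" "t i"] t(2)[of i] t(2)[of j] ij(2)
        av_diff_commute[of "s ^ (p ^ i)" "t i"] by simp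
    moreover have "s ^ (p ^ j) = (s ^ (p ^ (j - i))) ^ (p ^ i)"
      using ij(1) by (simp flip: power_mult power_add)
    ultimately have "av ((s ^ (p ^ (j - i))) ^ (p ^ i) - s ^ (p ^ i)) < 1" by simp
    then have "av (s ^ (p ^ (j - i)) - s) < 1"
      by (rule av_diff_less_1_if_power[OF pow1 sK(2)])
    then show ?thesis using ij(1) by (intro exI[of _ "j - i"]) simp
  qed
  then obtain e where e: "\<And>s. s \<in> S \<Longrightarrow> e s > 0 \<and> av (s ^ (p ^ e s) - s) < 1" by metis
  define f where "f = (\<Prod>s\<in>S. e s)"
  have f0: "f > 0" unfolding f_def by (rule prod_pos) (use e in auto)
  have fS: "av (s ^ (p ^ f) - s) < 1" if s: "s \<in> S" for s
  proof -
    have sK: "av s \<le> 1" using s S(2) by auto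
    have "av (s ^ (p ^ (e s * n)) - s) < 1" for n
    proof (induction n)
      case (Suc n)
      let ?a = "s ^ (p ^ (e s * n))"
      have a1: "av ?a \<le> 1" using sK by (simp add: av_power power_le_one)
      have "s ^ (p ^ (e s * Suc n)) = ?a ^ (p ^ e s)"
        by (simp add: power_add mult.commute flip: power_mult)
      moreover have "av (?a ^ (p ^ e s) - s ^ (p ^ e s)) < 1"
        using av_power_diff_le[OF a1 sK, of "p ^ e s"] Suc by simp
      moreover have "av (s ^ (p ^ e s) - s) < 1" using e[OF s] by blast
      ultimately show ?case
        using av_diff_triangle[of "?a ^ (p ^ e s)" s "s ^ (p ^ e s)"] by simp
    qed simp
    moreover have "e s dvd f" unfolding f_def using S(1) s by (rule dvd_prodI)
    then obtain n where "f = e s * n" by blast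
    ultimately show ?thesis by simp
  qed
  have "av (x ^ (p ^ f) - x) < 1" if x: "x \<in> K" "av x \<le> 1" for x
  proof -
    obtain s where s: "s \<in> S" "av (x - s) < 1" using S(3)[OF x] by blast
    have "av s \<le> 1" using s S(2) by auto
    then have "av (x ^ (p ^ f) - s ^ (p ^ f)) < 1"
      using av_power_diff_le[OF x(2), of s "p ^ f"] s(2) by simp
    then have "av (x ^ (p ^ f) - s) < 1"
      using av_diff_triangle[of "x ^ (p ^ f)" s "s ^ (p ^ f)"] fS[OF s(1)] by simp
    then show ?thesis
      using av_diff_triangle[of "x ^ (p ^ f)" x s] s(2) av_diff_commute[of x s] by simp
  qed
  then show ?thesis using that f0 by blast
qed

lemma algebraic_over_prime_field_if_power_eq:
  fixes x :: "'a::field"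
  assumes "x ^ Q = x" "Q > 1"
  shows "algebraic_over_prime_field x"
  unfolding algebraic_over_prime_field_def
proof (intro exI conjI)
  let ?q = "monom 1 Q - monom 1 1 :: int poly"
  have e: "map_poly of_int ?q = (monom 1 Q - monom 1 1 :: 'a poly)"
    by (rule poly_eqI) (simp add: coeff_map_poly)
  have "coeff (monom 1 Q - monom 1 1 :: 'a poly) Q = 1" using assms(2) by simp
  then show "map_poly of_int ?q \<noteq> (0 :: 'a poly)" unfolding e by (metis coeff_0 zero_neq_one)
  show "poly (map_poly of_int ?q) x = 0" unfolding e using assms(1) by (simp add: poly_monom)
qed

section \<open>The three cases and their combination\<close>

context local_field_frobenius
begin

lemma special_if_char_pos:
  assumes char: "CHAR('a) > 0" and c: "vanishing av c" "\<And>n. c n \<in> K"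
    and inf: "infinite {\<xi> \<in> roots_of_unity. laurent_eval av c \<xi> \<in> roots_of_unity}"
  shows "special c"
proof -
  let ?f = "laurent_eval av c"
  let ?S = "{\<xi> \<in> roots_of_unity. ?f \<xi> \<in> roots_of_unity}"
  have prime: "prime CHAR('a)" using char by (rule prime_CHAR_semidom)
  have pC: "CHAR('a) = p"
  proof (rule ccontr)
    assume "CHAR('a) \<noteq> p"
    then have "\<not> p dvd CHAR('a)" using prime p(1) primes_dvd_imp_eq by blast
    then show False using av_of_nat_coprime[of "CHAR('a)"] by simp
  qed
  have dream: "(x - y) ^ (p ^ k) = x ^ (p ^ k) - y ^ (p ^ k)" for x y :: 'a and k
    using freshmans_dream'[OF prime, of "p ^ k" k "x - y" y] pC by (simp add: algebra_simps)
  have inj: "x = y" if "x ^ (p ^ k) = y ^ (p ^ k)" for x y :: 'a and k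
  proof -
    have "(x - y) ^ (p ^ k) = 0" using dream that by simp
    then show ?thesis by simp
  qed
  define L where "L = (fact (p ^ 1) :: nat)"
  define Q where "Q = q ^ L"
  have Q: "Q = p ^ (f * L)" by (simp add: Q_def q(1) power_mult)
  have "f * L > 0" using q(2) by (simp add: L_def)
  then have Q1: "Q > 1" unfolding Q using p_gt_1 by (rule one_less_power[rotated])
  have fQ: "?f (\<xi> ^ Q) = ?f \<xi> ^ Q" if \<xi>: "\<xi> \<in> ?S" for \<xi>
  proof -
    obtain M1 M2 where M12: "M1 > 0" "\<xi> ^ M1 = 1" "M2 > 0" "?f \<xi> ^ M2 = 1"
      using \<xi> unfolding roots_of_unity_def by blast
    define M where "M = M1 * M2"
    have M0: "M \<noteq> 0" using M12 by (simp add: M_def)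
    have M: "\<xi> ^ M = 1" "?f \<xi> ^ M = 1"
      using power_power_eq_1[OF M12(4), of M1] M12(2) by (simp_all add: M_def power_mult)
    obtain m where m: "M = p ^ multiplicity p M * m" "\<not> p dvd m"
      by (rule multiplicity_decompose'[of M p]) (use M0 p(1) in auto)
    have red: "x ^ m = 1" if "x ^ M = 1" for x :: 'a
    proof -
      have "M = m * p ^ multiplicity p M" by (subst m(1)) simp
      then have "(x ^ m) ^ (p ^ multiplicity p M) = 1 ^ (p ^ multiplicity p M)"
        using that by (metis power_mult power_one)
      then show ?thesis by (rule inj)
    qed
    obtain \<zeta> \<zeta>' \<omega> \<omega>' where t: "\<zeta> ^ (p ^ 1) = 1" "\<zeta>' ^ (p ^ 1) = 1"
      "\<xi> = \<zeta> * \<omega>" "?f \<xi> = \<zeta>' * \<omega>'" "?f (\<zeta> * \<omega> ^ (q ^ fact (p ^ 1))) = \<zeta>' * \<omega>' ^ (q ^ fact (p ^ 1))"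
      by (rule frobenius_transfer[OF c red[OF M(1)] red[OF M(2)], of 1])
         (use m(2) of_nat_coprime_neq_0 in auto)
    have "\<zeta> = 1" "\<zeta>' = 1" using t(1,2) by (auto intro: inj[of _ 1])
    then show ?thesis using t by (simp add: Q_def L_def)
  qed
  \<comment> \<open>Its value at y = \<xi>^Q is f(\<xi>^Q) - f(\<xi>)^Q, which is zero by
    \<open>fQ\<close>.\<close>
  define d where "d = (\<lambda>n. c n - c n ^ Q)"
  have d: "vanishing av d" unfolding vanishing_def
  proof (intro allI impI)
    fix e :: real assume "e > 0"
    then have "min e 1 > 0" by simp
    then obtain N :: nat where N: "\<And>n. \<bar>n\<bar> > int N \<Longrightarrow> av (c n) < min e 1"
      using vanishing_obtain[OF c(1)] by blast
    have "av (d n) < e" if "\<bar>n\<bar> > int N" for n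
    proof -
      have "av (c n) ^ Q \<le> av (c n) ^ 1" using N[OF that] Q1 by (intro power_decreasing) auto
      then show ?thesis using av_diff[of "c n" "c n ^ Q"] N[OF that] by (simp add: d_def av_power)
    qed
    then show "\<exists>N. \<forall>n. \<bar>n\<bar> > N \<longrightarrow> av (d n) < e" by blast
  qed
  have "infinite ((\<lambda>\<xi>. \<xi> ^ Q) ` ?S)"
    using inf inj[of _ "f * L"] by (subst finite_image_iff) (auto simp: inj_on_def Q)
  then have d0: "d n = 0" for n
  proof (rule laurent_eval_zero_infinite[OF d])
    fix y assume "y \<in> (\<lambda>\<xi>. \<xi> ^ Q) ` ?S"
    then obtain \<xi> where \<xi>: "\<xi> \<in> ?S" "y = \<xi> ^ Q" by blast
    obtain M where "M > 0" "\<xi> ^ M = 1" using \<xi>(1) by (auto simp: roots_of_unity_def)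
    then have av\<xi>: "av \<xi> = 1" using av_eq_1_if_power_eq_1 by blast
    then show avy: "av y = 1" by (simp add: \<xi>(2) av_power)
    have pow: "av_tendsto av (\<lambda>N. laurent_sum c N \<xi> ^ Q) (?f \<xi> ^ Q)"
      unfolding av_tendsto_def
    proof (intro allI impI)
      fix e :: real assume "e > 0"
      then have "min e 1 > 0" by simp
      then obtain N where N: "\<forall>n\<ge>N. av (laurent_sum c n \<xi> - ?f \<xi>) < min e 1"
        using laurent_sum_tendsto[OF c(1) av\<xi>] unfolding av_tendsto_def by blast
      have "av (laurent_sum c n \<xi> ^ Q - ?f \<xi> ^ Q) < e" if "n \<ge> N" for n
      proof -
        let ?u = "laurent_sum c n \<xi> - ?f \<xi>"
        have u: "av ?u < min e 1" using N that by blast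
        then have "av ?u ^ Q \<le> av ?u ^ 1" using Q1 by (intro power_decreasing) auto
        moreover have "laurent_sum c n \<xi> ^ Q - ?f \<xi> ^ Q = ?u ^ Q" unfolding Q by (rule dream[symmetric])
        ultimately show ?thesis using u by (simp add: av_power)
      qed
      then show "\<exists>N. \<forall>n\<ge>N. av (laurent_sum c n \<xi> ^ Q - ?f \<xi> ^ Q) < e" by blast
    qed
    have "laurent_sum c N \<xi> ^ Q = (\<Sum>n\<in>{- int N..int N}. (c n * \<xi> powi n) ^ Q)" for N
      unfolding laurent_sum_def by (rule freshmans_dream_sum'[OF prime]) (simp add: pC Q)
    moreover have "(\<xi> powi n) ^ Q = y powi n" for n
      unfolding \<xi>(2) by (metis mult.commute power_int_mult power_int_of_nat)
    ultimately have "laurent_sum c N y - laurent_sum c N \<xi> ^ Q = laurent_sum d N y" for N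
      by (simp add: laurent_sum_def d_def power_mult_distrib left_diff_distrib sum_subtractf)
    moreover have "av_tendsto av (\<lambda>N. laurent_sum c N y - laurent_sum c N \<xi> ^ Q) (?f y - ?f \<xi> ^ Q)"
      by (intro av_tendsto_diff laurent_sum_tendsto c(1) avy pow)
    ultimately show "laurent_eval av d y = 0"
      using fQ[OF \<xi>(1)] \<xi>(2) by (intro laurent_eval_eqI) simp
  qed
  then have cQ: "c n ^ Q = c n" for n using d0[of n] by (simp add: d_def)
  have av1: "av (c n) \<ge> 1" if "c n \<noteq> 0" for n
  proof -
    have "c n ^ (Q - 1) * c n = 1 * c n"
      using cQ[of n] Q1 by (simp flip: power_Suc2)
    then have "c n ^ (Q - 1) = 1" using mult_right_cancel[OF that] by blast
    then show ?thesis using av_eq_1_if_power_eq_1[of "c n" "Q - 1"] Q1 by simp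
  qed
  then have "finite {n. c n \<noteq> 0}"
    using vanishing_finite[OF c(1), of 1] by (auto elim: rev_finite_subset)
  then show ?thesis
    unfolding special_def using char algebraic_over_prime_field_if_power_eq[OF cQ Q1] by blast
qed

text \<open>Once the series is a monomial, a single point suffices for its coefficient, the quotient
  of f(\<xi>) by \<xi>^m.\<close>

lemma special_if_p_orders_unbounded:
  assumes char0: "CHAR('a) = 0"
    and c: "vanishing av c" "\<And>n. c n \<in> K"
    and inf: "\<And>j. infinite {\<xi> \<in> roots_of_unity. laurent_eval av c \<xi> \<in> roots_of_unity \<and>
      (\<forall>M>0. \<xi> ^ M = 1 \<longrightarrow> laurent_eval av c \<xi> ^ M = 1 \<longrightarrow> p ^ j dvd M)}"
  shows "special c"
proof -
  let ?f = "laurent_eval av c"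
  have nz: "of_nat n \<noteq> (0 :: 'a)" if "n > 0" for n using char0 that by (simp add: CHAR_eq0_iff)
  have uniq: "k = l" if "c k \<noteq> 0" "c l \<noteq> 0" for k l
    by (rule monomial_if_p_orders_unbounded[OF nz c inf that])
  obtain \<xi> where \<xi>: "\<xi> \<in> roots_of_unity" "?f \<xi> \<in> roots_of_unity"
    using infinite_imp_nonempty[OF inf[of 0]] by blast
  obtain M where M: "M > 0" "\<xi> ^ M = 1" using \<xi>(1) by (auto simp: roots_of_unity_def)
  obtain M' where M': "M' > 0" "?f \<xi> ^ M' = 1" using \<xi>(2) by (auto simp: roots_of_unity_def)
  have av\<xi>: "av \<xi> = 1" by (rule av_eq_1_if_power_eq_1[OF M(2,1)])
  have tend: "av_tendsto av (\<lambda>N. laurent_sum c N \<xi>) (?f \<xi>)" by (rule laurent_sum_tendsto[OF c(1) av\<xi>])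
  obtain m where m: "c m \<noteq> 0"
  proof (rule ccontr)
    assume "\<not> thesis"
    then have "c n = 0" for n using that by blast
    then have "laurent_sum c N \<xi> = 0" for N by (simp add: laurent_sum_def)
    then have "?f \<xi> = 0" by (intro laurent_eval_eqI) (simp add: av_tendsto_def)
    then show False using M' by (simp add: power_0_left)
  qed
  have zero: "c n = 0" if "n \<noteq> m" for n using uniq[OF m, of n] that by auto
  then have single: "\<forall>n. c n = (if n = m then c m else 0)" by simp
  have "laurent_sum c N \<xi> = c m * \<xi> powi m" if "N \<ge> nat \<bar>m\<bar>" for N
  proof -
    have "laurent_sum c N \<xi> = (\<Sum>n\<in>{- int N..int N}. if n = m then c m * \<xi> powi m else 0)"
      unfolding laurent_sum_def by (rule sum.cong) (auto simp: zero)
    also have "\<dots> = c m * \<xi> powi m" using that by simp linarith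
    finally show ?thesis .
  qed
  then have "av_tendsto av (\<lambda>N. laurent_sum c N \<xi>) (c m * \<xi> powi m)"
    unfolding av_tendsto_def by (intro allI impI exI[of _ "nat \<bar>m\<bar>"]) simp
  then have fval: "?f \<xi> = c m * \<xi> powi m" by (rule laurent_eval_eqI)
  have "(\<xi> powi m) powi int M = (\<xi> powi int M) powi m"
    by (simp only: mult.commute flip: power_int_mult)
  then have "(\<xi> powi m) ^ M = 1" using M(2) by (simp only: power_int_of_nat power_int_1_left)
  then have "(\<xi> powi m) ^ (M * M') = 1" by (simp add: power_mult)
  moreover have "?f \<xi> ^ (M * M') = 1" using power_power_eq_1[OF M'(2), of M] by (simp add: power_mult)
  ultimately have "c m ^ (M * M') = 1" using fval by (simp add: power_mult_distrib)
  then have "c m \<in> roots_of_unity" using M M' unfolding roots_of_unity_def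
    using nat_0_less_mult_iff by blast
  then show ?thesis unfolding special_def using char0 single by blast
qed

text \<open>Then \<open>g(x ^ Q) = g(x) ^ Q\<close> on the whole sphere for a twist \<open>g\<close> of \<open>c\<close>, so \<open>g\<close> takes roots of
  unity of \<open>p\<close>-power order to roots of unity, and the \<open>p\<close>-orders are unbounded after all.\<close>
lemma special_if_p_orders_bounded:
  assumes char0: "CHAR('a) = 0"
    and c: "vanishing av c" "\<And>n. c n \<in> K"
    and inf: "infinite {\<xi> \<in> roots_of_unity. \<exists>M>0. \<xi> ^ M = 1 \<and> laurent_eval av c \<xi> ^ M = 1 \<and> \<not> p ^ j dvd M}"
  shows "special c"
proof -
  let ?f = "laurent_eval av c"
  let ?S = "{\<xi> \<in> roots_of_unity. \<exists>M>0. \<xi> ^ M = 1 \<and> ?f \<xi> ^ M = 1 \<and> \<not> p ^ j dvd M}"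
  let ?E = "{a::'a. a ^ (p ^ j) = 1}"
  have nz: "of_nat n \<noteq> (0 :: 'a)" if "n > 0" for n using char0 that by (simp add: CHAR_eq0_iff)
  have pp: "p ^ k > 0" for k using p_gt_0 by simp
  have finE: "finite ?E" by (rule card_power_eq_1_le(1)[OF pp])
  define Q where "Q = q ^ fact (p ^ j)"
  define e0 where "e0 = f * fact (p ^ j)"
  have Q: "Q = p ^ e0" by (simp add: Q_def e0_def q(1) power_mult)
  have e00: "e0 > 0" using q(2) by (simp add: e0_def)
  have Q1: "Q > 1" unfolding Q using p_gt_1 e00 by (rule one_less_power)
  \<comment> \<open>\<open>a\<close> and \<open>b\<close> are the \<open>p\<close>-parts of \<xi>
    and f(\<xi>), of which there are finitely many; \<omega> and \<omega>' are the parts of order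
    prime to \<open>p\<close>.\<close>
  define G where "G = (\<lambda>\<xi> (a, b) \<omega>. \<exists>m \<omega>'. \<omega> ^ m = 1 \<and> \<omega>' ^ m = 1 \<and> \<not> p dvd m \<and> \<xi> = a * \<omega> \<and>
     ?f (a * \<omega>) = b * \<omega>' \<and> ?f (a * \<omega> ^ Q) = b * \<omega>' ^ Q)"
  have "\<exists>e\<in>?E \<times> ?E. \<exists>\<omega>. G \<xi> e \<omega>" if "\<xi> \<in> ?S" for \<xi>
  proof -
    have "\<exists>M>0. \<xi> ^ M = 1 \<and> ?f \<xi> ^ M = 1 \<and> \<not> p ^ j dvd M"
      using that unfolding mem_Collect_eq by (rule conjunct2)
    then obtain M where M: "M > 0" "\<xi> ^ M = 1" "?f \<xi> ^ M = 1" "\<not> p ^ j dvd M"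
      by (elim exE conjE)
    obtain \<zeta> \<zeta>' \<omega> \<omega>' m where t: "\<zeta> ^ (p ^ j) = 1" "\<zeta>' ^ (p ^ j) = 1" "\<omega> ^ m = 1" "\<omega>' ^ m = 1"
      "\<not> p dvd m" "\<xi> = \<zeta> * \<omega>" "?f \<xi> = \<zeta>' * \<omega>'"
      "?f (\<zeta> * \<omega> ^ (q ^ fact (p ^ j))) = \<zeta>' * \<omega>' ^ (q ^ fact (p ^ j))"
      by (rule frobenius_transfer[OF c M(2-4) nz[OF M(1)]])
    have "G \<xi> (\<zeta>, \<zeta>') \<omega>" unfolding G_def prod.case Q_def
      by (rule exI[of _ m], rule exI[of _ \<omega>'], intro conjI)
         (fact t(3-6) t(8) | simp only: t(7) flip: t(6))+
    moreover have "(\<zeta>, \<zeta>') \<in> ?E \<times> ?E" using t(1,2) by simp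
    ultimately show ?thesis by blast
  qed
  then have "\<exists>e\<in>?E \<times> ?E. infinite {\<xi> \<in> ?S. \<exists>\<omega>. G \<xi> e \<omega>}"
    using finE by (intro pigeonhole_infinite_rel[OF inf]) auto
  then obtain e where e: "e \<in> ?E \<times> ?E" "infinite {\<xi> \<in> ?S. \<exists>\<omega>. G \<xi> e \<omega>}" by (rule bexE)
  obtain a b where "e = (a, b)" by (cases e)
  with e have ab: "a ^ (p ^ j) = 1" "b ^ (p ^ j) = 1" "infinite {\<xi> \<in> ?S. \<exists>\<omega>. G \<xi> (a, b) \<omega>}"
    by simp_all
  have av1: "av a = 1" "av b = 1" by (rule av_eq_1_if_power_eq_1[OF _ pp], rule ab)+
  then have ab0: "a \<noteq> 0" "b \<noteq> 0" by auto
  define W where "W = {\<omega>. \<exists>\<xi>. G \<xi> (a, b) \<omega>}"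
  have "{\<xi> \<in> ?S. \<exists>\<omega>. G \<xi> (a, b) \<omega>} \<subseteq> (\<lambda>\<omega>. a * \<omega>) ` W" by (auto simp: G_def W_def)
  then have infW: "infinite W" using ab(3) finite_surj by blast
  \<comment> \<open>The twist g(x) = f(a x)/b removes the fixed \<open>p\<close>-parts, leaving an
    equation between roots of unity of order prime to \<open>p\<close>, on which Frobenius acts as
    the \<open>Q\<close>-th power.\<close>
  define c' where "c' = (\<lambda>n. inverse b * c n * a powi n)"
  have c': "vanishing av c'" unfolding c'_def by (rule vanishing_scale[OF c(1) av1(1)])
  let ?g = "laurent_eval av c'"
  have g: "?g x = inverse b * ?f (a * x)" if "av x = 1" for x
    unfolding c'_def by (rule laurent_eval_scale[OF c(1) av1(1) that])
  have Wm: "\<exists>m>0. w ^ m = 1 \<and> \<not> p dvd m" if w: "w \<in> W" for w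
  proof -
    obtain m where m: "w ^ m = 1" "\<not> p dvd m" using w unfolding W_def G_def prod.case by blast
    then have "m > 0" by (intro gr0I) simp
    then show ?thesis using m by blast
  qed
  have Wav: "av w = 1" if "w \<in> W" for w using Wm[OF that] av_eq_1_if_power_eq_1 by blast
  have Wg: "?g (w ^ Q) = ?g w ^ Q \<and> ?g w \<noteq> 0" if w: "w \<in> W" for w
  proof -
    obtain m \<omega>' where t: "\<omega>' ^ m = 1" "\<not> p dvd m" "?f (a * w) = b * \<omega>'" "?f (a * w ^ Q) = b * \<omega>' ^ Q"
      using w unfolding W_def G_def prod.case by blast
    have "m \<noteq> 0" using t(2) by (intro notI) simp
    then have "\<omega>' \<noteq> 0" using t(1) by (auto simp: power_0_left)
    then show ?thesis using g[of w] g[of "w ^ Q"] Wav[OF w] t(3,4) ab0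
      by (simp add: av_power flip: mult.assoc)
  qed
  have Wdist: "1 \<le> av (w - w')" if ww: "w \<in> W" "w' \<in> W" "w \<noteq> w'" for w w'
  proof -
    obtain m m' where m: "w ^ m = 1" "\<not> p dvd m" "w' ^ m' = 1" "\<not> p dvd m'"
      using Wm[OF ww(1)] Wm[OF ww(2)] by blast
    have "\<not> p dvd m * m'" using m(2,4) p(1) by (simp add: prime_dvd_mult_iff)
    moreover have "w ^ (m * m') = 1" using m(1) by (simp add: power_mult)
    moreover have "w' ^ (m * m') = 1" using power_power_eq_1[OF m(3), of m] by (simp add: power_mult)
    ultimately show ?thesis using ww(3) by (rule coprime_roots_of_unity_dist)
  qed
  have gQ: "?g (x ^ Q) = ?g x ^ Q" if "av x = 1" for x
    by (rule laurent_power_identity[OF c' infW Wav Wdist _ that]) (use Wg in auto)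
  have gQi: "?g (x ^ (Q ^ i)) = ?g x ^ (Q ^ i)" if "av x = 1" for x i
  proof (induction i)
    case (Suc i)
    have "av (x ^ (Q ^ i)) = 1" using that by (simp add: av_power)
    from gQ[OF this] show ?case using Suc by (simp add: mult.commute[of Q] power_mult)
  qed simp
  have prim: "\<exists>x::'a. primitive_root_of_unity (p ^ i) x" for i
    by (rule primitive_root_of_unity_exists[OF alg_closed nz[OF pp]]) blast
  then obtain z :: "nat \<Rightarrow> 'a" where z: "\<And>i. primitive_root_of_unity (p ^ i) (z i)" by metis
  have zp: "z i ^ (p ^ i) = 1" for i using z by (simp add: primitive_root_of_unity_def)
  have zav: "av (z i) = 1" for i by (rule av_eq_1_if_power_eq_1[OF zp pp])
  have zinj: "inj z"
  proof (rule injI)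
    fix i k assume "z i = z k"
    then have "z i ^ (p ^ k) = 1" "z k ^ (p ^ i) = 1" using zp[of i] zp[of k] by simp_all
    then have "p ^ i dvd p ^ k" "p ^ k dvd p ^ i" using z unfolding primitive_root_of_unity_def by blast+
    then have "p ^ i = p ^ k" by (rule dvd_antisym)
    then show "i = k" using p_gt_1 by simp
  qed
  have zQ: "z i ^ (Q ^ i) = 1" for i
  proof -
    have "Q ^ i = p ^ i * p ^ (e0 * i - i)" using e00 by (simp add: Q flip: power_mult power_add)
    then show ?thesis by (simp add: power_mult zp)
  qed
  have g1: "?g 1 ^ Q = ?g 1" using gQ[of 1] by simp
  have gz: "?g (z i) ^ (Q ^ i) = ?g 1" for i using gQi[OF zav, of i i] zQ by simp
  \<comment> \<open>Otherwise g would vanish at all the z_i, hence identically, although its values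
    on \<open>W\<close> are non-zero.\<close>
  have g10: "?g 1 \<noteq> 0"
  proof
    assume "?g 1 = 0"
    then have "?g (z i) = 0" for i using gz[of i] by simp
    then have "c' k = 0" for k
      by (intro laurent_eval_zero_infinite[OF c', of "range z"])
         (use zav zinj in \<open>auto simp: range_inj_infinite\<close>)
    then have "laurent_sum c' N x = 0" for N x by (simp add: laurent_sum_def)
    then have "?g x = 0" for x by (intro laurent_eval_eqI) (simp add: av_tendsto_def)
    moreover obtain w where "w \<in> W" using infinite_imp_nonempty[OF infW] by blast
    ultimately show False using Wg by blast
  qed
  have "?g 1 ^ (Q - 1) * ?g 1 = 1 * ?g 1" using g1 Q1 by (simp flip: power_Suc2)
  then have "?g 1 ^ (Q - 1) = 1" using mult_right_cancel[OF g10] by blast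
  then have *: "?g (z i) ^ (Q ^ i * (Q - 1)) = 1" for i by (simp add: power_mult gz)
  have **: "(b * ?g (z i)) ^ (p ^ j * (Q ^ i * (Q - 1))) = 1" for i
  proof -
    have "b ^ (p ^ j * (Q ^ i * (Q - 1))) = 1" using ab(2) by (simp add: power_mult)
    moreover have "?g (z i) ^ (p ^ j * (Q ^ i * (Q - 1))) = 1"
      using power_power_eq_1[OF *, of i "p ^ j"] by (simp only: power_mult)
    ultimately show ?thesis by (simp add: power_mult_distrib)
  qed
  have fz: "?f (a * z i) \<in> roots_of_unity" for i
  proof -
    have "p ^ j * (Q ^ i * (Q - 1)) > 0" using Q1 pp by simp
    then have "b * ?g (z i) \<in> roots_of_unity" using ** unfolding roots_of_unity_def by blast
    then show ?thesis using g[OF zav] ab0 by (simp flip: mult.assoc)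
  qed
  show ?thesis
  proof (rule special_if_p_orders_unbounded[OF char0 c])
    fix k
    let ?T = "{\<xi> \<in> roots_of_unity. ?f \<xi> \<in> roots_of_unity \<and>
      (\<forall>M>0. \<xi> ^ M = 1 \<longrightarrow> ?f \<xi> ^ M = 1 \<longrightarrow> p ^ k dvd M)}"
    \<comment> \<open>Multiplication by \<open>a\<close> changes the order of z_i at most by a
      factor p^j, so i \<ge> j + k leaves p^k.\<close>
    have "(\<lambda>i. a * z i) ` {j + k..} \<subseteq> ?T"
    proof safe
      fix i assume i: "i \<ge> j + k"
      have "(a * z i) ^ (p ^ j * p ^ i) = 1"
        using ab(1) power_power_eq_1[OF zp[of i], of "p ^ j"] by (simp add: power_mult_distrib power_mult)
      moreover have "p ^ j * p ^ i > 0" using pp by simp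
      ultimately show "a * z i \<in> roots_of_unity" unfolding roots_of_unity_def by blast
      show "?f (a * z i) \<in> roots_of_unity" by (rule fz)
      fix M :: nat assume M: "M > 0" "(a * z i) ^ M = 1"
      have "(a * z i) ^ (p ^ j * M) = 1" using power_power_eq_1[OF M(2), of "p ^ j"] by (simp only: power_mult)
      moreover have "a ^ (p ^ j * M) = 1" using ab(1) by (simp add: power_mult)
      ultimately have "z i ^ (p ^ j * M) = 1" by (simp add: power_mult_distrib)
      then have "p ^ i dvd p ^ j * M" using z by (simp add: primitive_root_of_unity_def)
      moreover have "p ^ (j + k) dvd p ^ i" using i by (rule le_imp_power_dvd)
      ultimately have "p ^ j * p ^ k dvd p ^ j * M" by (metis dvd_trans power_add)
      then show "p ^ k dvd M" using p_gt_0 by simp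
    qed
    moreover have "infinite ((\<lambda>i. a * z i) ` {j + k..})"
    proof
      assume "finite ((\<lambda>i. a * z i) ` {j + k..})"
      moreover have "inj_on (\<lambda>i. a * z i) {j + k..}"
        using zinj ab0 by (auto simp: inj_on_def inj_def)
      ultimately have "finite {j + k..}" by (rule finite_imageD)
      then show False using infinite_Ici by blast
    qed
    ultimately show "infinite ?T" using finite_subset by blast
  qed
qed

text \<open>The clause on all common exponents M says that p^j divides the lcm of the orders of
  \<xi> and f(\<xi>). If it holds for only finitely many points for some j, then its negation holds
  for infinitely many.\<close>

lemma special_if_infinite:
  assumes c: "vanishing av c" "\<And>n. c n \<in> K"
    and inf: "infinite {\<xi> \<in> roots_of_unity. laurent_eval av c \<xi> \<in> roots_of_unity}"
  shows "special c"
proof (cases "CHAR('a) > 0")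
  case True
  then show ?thesis by (rule special_if_char_pos[OF _ c inf])
next
  case False
  then have char0: "CHAR('a) = 0" by simp
  let ?f = "laurent_eval av c"
  let ?S = "\<lambda>j. {\<xi> \<in> roots_of_unity. ?f \<xi> \<in> roots_of_unity \<and>
      (\<forall>M>0. \<xi> ^ M = 1 \<longrightarrow> ?f \<xi> ^ M = 1 \<longrightarrow> p ^ j dvd M)}"
  show ?thesis
  proof (cases "\<forall>j. infinite (?S j)")
    case True
    then show ?thesis using special_if_p_orders_unbounded[OF char0 c] by blast
  next
    case False
    then obtain j where j: "finite (?S j)" by blast
    let ?T = "{\<xi> \<in> roots_of_unity. \<exists>M>0. \<xi> ^ M = 1 \<and> ?f \<xi> ^ M = 1 \<and> \<not> p ^ j dvd M}"
    have sub: "{\<xi> \<in> roots_of_unity. ?f \<xi> \<in> roots_of_unity} \<subseteq> ?S j \<union> ?T"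
    proof
      fix \<xi> assume \<xi>: "\<xi> \<in> {\<xi> \<in> roots_of_unity. ?f \<xi> \<in> roots_of_unity}"
      show "\<xi> \<in> ?S j \<union> ?T"
        by (cases "\<forall>M>0. \<xi> ^ M = 1 \<longrightarrow> ?f \<xi> ^ M = 1 \<longrightarrow> p ^ j dvd M") (use \<xi> in auto)
    qed
    have "infinite ?T"
    proof
      assume "finite ?T"
      with j have "finite (?S j \<union> ?T)" by (rule finite_UnI)
      then show False using inf finite_subset[OF sub] by blast
    qed
    then show ?thesis by (rule special_if_p_orders_bounded[OF char0 c])
  qed
qed

end

theorem theoremA:
  fixes av :: "'a::field \<Rightarrow> real" and K :: "'a set" and c :: "int \<Rightarrow> 'a"
  assumes "nonarch_abs av"
    and "nonarch_local_field av K"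
    and "completed_alg_closure av K"
    and "laurent_A11 av K c"
    and "infinite {\<xi>\<in>roots_of_unity. laurent_eval av c \<xi> \<in> roots_of_unity}"
  shows "special c"
proof -
  interpret nonarch_field av using assms(1) by unfold_locales
  have K: "is_subfield K" "av_complete av K" using assms(2) by (auto simp: nonarch_local_field_def)
  obtain \<pi> where \<pi>: "\<pi> \<in> K" "0 < av \<pi>" "av \<pi> < 1"
    "\<And>x. x \<in> K \<Longrightarrow> x \<noteq> 0 \<Longrightarrow> \<exists>k::int. av x = av \<pi> powi k"
    using assms(2) unfolding nonarch_local_field_def by blast
  obtain S where S: "finite S" "S \<subseteq> {x \<in> K. av x \<le> 1}"
    "\<And>x. x \<in> K \<Longrightarrow> av x \<le> 1 \<Longrightarrow> \<exists>s\<in>S. av (x - s) < 1"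
    using assms(2) unfolding nonarch_local_field_def by blast
  obtain p where p: "prime p" "av (of_nat p) < 1"
    using residue_characteristic_exists[OF K(1) S(1,3)] by blast
  have \<Omega>: "alg_closed_field TYPE('a)" "av_complete av UNIV"
    using assms(3) by (auto simp: completed_alg_closure_def)
  interpret local_field_closure av K p \<pi>
    by unfold_locales (use K \<Omega> p \<pi> in auto)
  obtain f where f: "f > 0" "\<And>x. x \<in> K \<Longrightarrow> av x \<le> 1 \<Longrightarrow> av (x ^ (p ^ f) - x) < 1"
    using frobenius_power_exists[OF S] by blast
  interpret local_field_frobenius av K p \<pi> "p ^ f" f
    by unfold_locales (use f in auto)
  have c: "vanishing av c" "\<And>n. c n \<in> K"
    using assms(4) by (auto simp: laurent_A11_def vanishing_def)
  show ?thesis by (rule special_if_infinite[OF c assms(5)])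
qed

end
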